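(* Let $\Sigma$ be an elliptic Weingarten surface in $\mathbb{R}^3$ with Gauss map $N:\Sigma\to\mathbb{S}^2$, and suppose that the Gauss map image $N(\Sigma)$ is contained in a closed hemisphere of $\mathbb{S}^2$. Then either $N(\Sigma)$ is contained in the interior of this hemisphere (so that $\Sigma$ is a multigraph), or $\Sigma$ is a piece of a plane or of a cylinder.
   Context: Surfaces are connected, oriented, immersed in $\mathbb{R}^3$ and of class $C^2$ (not assumed complete here). $N$ is the unit normal, $\kappa_1,\kappa_2$ are the principal curvatures, $H=(\kappa_1+\kappa_2)/2$ the mean curvature, $K=\kappa_1\kappa_2$ the Gauss curvature. An elliptic Weingarten surface is an immersed oriented surface whose mean and Gauss curvatures satisfy $H=g(H^2-K)$ for some $g\in C^2([0,\infty))$ with $4t\,(g'(t))^2<1$ for all $t\ge 0$. A surface is a multigraph if its Gauss map image is contained in an open hemisphere of $\mathbb{S}^2$ (equivalently, there is a fixed plane $P$ such that $\Sigma$ is, locally around each point, a graph over $P$). "Cylinder" means right circular cylinder, and "a piece of" a surface means that the image of the immersion is contained in that surface. *)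

theory Defs
  imports "HOL-Analysis.Analysis"
begin

definition C1_on :: "'a::real_normed_vector set \<Rightarrow> ('a \<Rightarrow> 'b::real_normed_vector) \<Rightarrow> bool" where
  "C1_on U f \<longleftrightarrow>
     (\<exists>f' :: 'a \<Rightarrow> 'a \<Rightarrow>\<^sub>L 'b.
        (\<forall>x\<in>U. (f has_derivative blinfun_apply (f' x)) (at x)) \<and> continuous_on U f')"

definition C2_on :: "'a::real_normed_vector set \<Rightarrow> ('a \<Rightarrow> 'b::real_normed_vector) \<Rightarrow> bool" where
  "C2_on U f \<longleftrightarrow>
     (\<exists>f' :: 'a \<Rightarrow> 'a \<Rightarrow>\<^sub>L 'b.
        (\<forall>x\<in>U. (f has_derivative blinfun_apply (f' x)) (at x)) \<and> C1_on U f')"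

text \<open>A chart is a pair of its domain and its coordinate map; the coordinate map is only
  relevant on the domain. Below, \<open>X\<close> is the underlying topological space of a surface, \<open>A\<close> an
  oriented atlas (not necessarily maximal) and \<open>\<psi>\<close> an immersion into three-space.\<close>

type_synonym 'a chart = "'a set \<times> ('a \<Rightarrow> real^2)"

definition in_chart :: "'a chart \<Rightarrow> ('a \<Rightarrow> 'b) \<Rightarrow> real^2 \<Rightarrow> 'b" where
  "in_chart c f = f \<circ> inv_into (fst c) (snd c)"

definition is_chart :: "'a topology \<Rightarrow> 'a chart \<Rightarrow> bool" where
  "is_chart X c \<longleftrightarrow>
     openin X (fst c) \<and> open (snd c ` fst c) \<and>
     homeomorphic_map (subtopology X (fst c)) (top_of_set (snd c ` fst c)) (snd c)"

definition oriented_C2_atlas :: "'a topology \<Rightarrow> 'a chart set \<Rightarrow> bool" where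
  "oriented_C2_atlas X A \<longleftrightarrow>
     (\<forall>c\<in>A. is_chart X c) \<and> (\<Union>c\<in>A. fst c) = topspace X \<and>
     (\<forall>c\<in>A. \<forall>d\<in>A.
        C2_on (snd c ` (fst c \<inter> fst d)) (in_chart c (snd d)) \<and>
        (\<forall>z \<in> snd c ` (fst c \<inter> fst d).
           det (matrix (frechet_derivative (in_chart c (snd d)) (at z))) > 0))"

definition C2_immersion :: "'a chart set \<Rightarrow> ('a \<Rightarrow> real^3) \<Rightarrow> bool" where
  "C2_immersion A \<psi> \<longleftrightarrow>
     (\<forall>c\<in>A. C2_on (snd c ` fst c) (in_chart c \<psi>) \<and>
        (\<forall>z \<in> snd c ` fst c. inj (frechet_derivative (in_chart c \<psi>) (at z))))"

definition oriented_immersed_surface ::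
    "'a topology \<Rightarrow> 'a chart set \<Rightarrow> ('a \<Rightarrow> real^3) \<Rightarrow> bool" where
  "oriented_immersed_surface X A \<psi> \<longleftrightarrow>
     Hausdorff_space X \<and> second_countable X \<and> connected_space X \<and>
     oriented_C2_atlas X A \<and> C2_immersion A \<psi>"

text \<open>The normalised cross product of the coordinate tangent vectors does not depend on the
  chart of the oriented atlas, so an arbitrary chart around the point may be chosen.\<close>

definition chart_normal :: "'a chart \<Rightarrow> ('a \<Rightarrow> real^3) \<Rightarrow> 'a \<Rightarrow> real^3" where
  "chart_normal c \<psi> p =
     (let D = frechet_derivative (in_chart c \<psi>) (at (snd c p))
      in sgn (cross3 (D (axis 1 1)) (D (axis 2 1))))"

definition gauss_map :: "'a chart set \<Rightarrow> ('a \<Rightarrow> real^3) \<Rightarrow> 'a \<Rightarrow> real^3" where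
  "gauss_map A \<psi> p = chart_normal (SOME c. c \<in> A \<and> p \<in> fst c) \<psi> p"

text \<open>The principal curvatures are the eigenvalues of the shape operator \<open>- dN\<close>, tangent
  vectors being written as images of coordinate vectors under \<open>d\<psi>\<close>. At an umbilic there is only
  one eigenvalue, which is then the value of both \<open>\<kappa>\<^sub>1\<close> and \<open>\<kappa>\<^sub>2\<close> below.\<close>

definition principal_curvatures :: "'a chart set \<Rightarrow> ('a \<Rightarrow> real^3) \<Rightarrow> 'a \<Rightarrow> real set" where
  "principal_curvatures A \<psi> p =
     {\<kappa>. \<exists>c\<in>A. p \<in> fst c \<and>
        (\<exists>v. v \<noteq> 0 \<and>
           - frechet_derivative (in_chart c (gauss_map A \<psi>)) (at (snd c p)) v
           = \<kappa> *\<^sub>R frechet_derivative (in_chart c \<psi>) (at (snd c p)) v)}"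

definition \<kappa>\<^sub>1 :: "'a chart set \<Rightarrow> ('a \<Rightarrow> real^3) \<Rightarrow> 'a \<Rightarrow> real" where
  "\<kappa>\<^sub>1 A \<psi> p = Min (principal_curvatures A \<psi> p)"

definition \<kappa>\<^sub>2 :: "'a chart set \<Rightarrow> ('a \<Rightarrow> real^3) \<Rightarrow> 'a \<Rightarrow> real" where
  "\<kappa>\<^sub>2 A \<psi> p = Max (principal_curvatures A \<psi> p)"

definition mean_curvature :: "'a chart set \<Rightarrow> ('a \<Rightarrow> real^3) \<Rightarrow> 'a \<Rightarrow> real" where
  "mean_curvature A \<psi> p = (\<kappa>\<^sub>1 A \<psi> p + \<kappa>\<^sub>2 A \<psi> p) / 2"

definition gauss_curvature :: "'a chart set \<Rightarrow> ('a \<Rightarrow> real^3) \<Rightarrow> 'a \<Rightarrow> real" where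
  "gauss_curvature A \<psi> p = \<kappa>\<^sub>1 A \<psi> p * \<kappa>\<^sub>2 A \<psi> p"

text \<open>Derivatives of \<open>g\<close> at \<open>0\<close> are one-sided; values of \<open>g\<close> at negative arguments are
  irrelevant.\<close>

definition elliptic_function :: "(real \<Rightarrow> real) \<Rightarrow> bool" where
  "elliptic_function g \<longleftrightarrow>
     (\<exists>g' g''.
        (\<forall>t\<ge>0. (g has_real_derivative g' t) (at t within {0..})) \<and>
        (\<forall>t\<ge>0. (g' has_real_derivative g'' t) (at t within {0..})) \<and>
        continuous_on {0..} g'' \<and>
        (\<forall>t\<ge>0. 4 * t * (g' t)\<^sup>2 < 1))"

definition elliptic_weingarten_surface ::
    "'a topology \<Rightarrow> 'a chart set \<Rightarrow> ('a \<Rightarrow> real^3) \<Rightarrow> bool" where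
  "elliptic_weingarten_surface X A \<psi> \<longleftrightarrow>
     oriented_immersed_surface X A \<psi> \<and>
     (\<exists>g. elliptic_function g \<and>
        (\<forall>p\<in>topspace X.
           mean_curvature A \<psi> p = g ((mean_curvature A \<psi> p)\<^sup>2 - gauss_curvature A \<psi> p)))"

definition closed_hemisphere :: "real^3 \<Rightarrow> (real^3) set" where
  "closed_hemisphere a = {x \<in> sphere 0 1. 0 \<le> a \<bullet> x}"

definition open_hemisphere :: "real^3 \<Rightarrow> (real^3) set" where
  "open_hemisphere a = {x \<in> sphere 0 1. 0 < a \<bullet> x}"

definition multigraph :: "'a topology \<Rightarrow> 'a chart set \<Rightarrow> ('a \<Rightarrow> real^3) \<Rightarrow> bool" where
  "multigraph X A \<psi> \<longleftrightarrow>
     (\<exists>a. norm a = 1 \<and> gauss_map A \<psi> ` topspace X \<subseteq> open_hemisphere a)"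

definition is_plane :: "(real^3) set \<Rightarrow> bool" where
  "is_plane P \<longleftrightarrow> (\<exists>n b. n \<noteq> 0 \<and> P = {x. n \<bullet> x = b})"

text \<open>The axis passes through \<open>q\<close> in the direction \<open>d\<close>, and \<open>r\<close> is the radius.\<close>

definition is_cylinder :: "(real^3) set \<Rightarrow> bool" where
  "is_cylinder Z \<longleftrightarrow>
     (\<exists>q d r. norm d = 1 \<and> 0 < r \<and> Z = {x. infdist x {q + t *\<^sub>R d |t. True} = r})"

definition piece_of :: "'a topology \<Rightarrow> ('a \<Rightarrow> real^3) \<Rightarrow> (real^3) set \<Rightarrow> bool" where
  "piece_of X \<psi> S \<longleftrightarrow> \<psi> ` topspace X \<subseteq> S"

end

theory Submission
  imports Defs
begin

text \<open>Suppose the angle function \<open>a \<bullet> N \<ge> 0\<close> vanishes at a point. Near it the surface is a graph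
  \<open>u\<close> over its tangent plane, which contains \<open>a\<close>, and \<open>a \<bullet> N\<close> is a negative multiple of the
  derivative \<open>q\<close> of \<open>u\<close> in the direction \<open>a\<close>. The graph solves a fully nonlinear elliptic
  equation which is invariant under translation, so the difference quotients of \<open>u\<close> in the
  direction \<open>a\<close> solve linear, uniformly elliptic equations without zero order term; applying
  Hopf's barrier argument to them and passing to the limit gives the strong maximum principle for
  \<open>q\<close> although \<open>u\<close> is only \<open>C\<^sup>2\<close>. Hence \<open>a \<bullet> N\<close> vanishes near the point, and by
  connectedness everywhere. Then one principal curvature is \<open>0\<close> and the other one \<open>2 c\<close>, where
  \<open>c = g (c\<^sup>2)\<close> has at most one solution by ellipticity. With \<open>P\<close> the projection along \<open>a\<close>,
  the map \<open>N + 2 c P \<psi>\<close> has derivative \<open>0\<close>, so it is constant.\<close>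

section \<open>The Weingarten operator of a graph\<close>

text \<open>Writing the relation as H = g (H^2 - K), and not through the principal curvatures, keeps
  the operator continuously differentiable at umbilics, where the principal curvatures need not be
  differentiable. The price is that g lives on the half line and has a one-sided derivative at 0, so
  H^2 - K must be known to be nonnegative before any chain rule. The obstacle is regularity: an
  equation for q itself would contain third derivatives of u. Two translates of u along a solve the
  same equation, and the mean value theorem on the segment between their tuples (p, q, r, s, t)
  makes their difference solve a linear equation. Its coefficients depend on the step h and come
  without any continuity, but they are bounded and elliptic uniformly in h, and a barrier asks for
  nothing more. All constants of the barrier are fixed before h tends to 0, so the limit is a
  pointwise lower bound for -q. Since q is differentiable, comparing slopes at a boundary zero of q
  gives the contradiction.\<close>

text \<open>Mean and Gauss curvature of the graph of \<open>u\<close> at a point with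
  \<open>(u\<^sub>x, u\<^sub>y, u\<^sub>x\<^sub>x, u\<^sub>x\<^sub>y, u\<^sub>y\<^sub>y) = (p, q, r, s, t)\<close>.\<close>

definition graph_mean :: "real \<Rightarrow> real \<Rightarrow> real \<Rightarrow> real \<Rightarrow> real \<Rightarrow> real" where
  "graph_mean p q r s t =
     ((1 + q\<^sup>2) * r - 2 * p * q * s + (1 + p\<^sup>2) * t) / (2 * sqrt (1 + p\<^sup>2 + q\<^sup>2) ^ 3)"

definition graph_gauss :: "real \<Rightarrow> real \<Rightarrow> real \<Rightarrow> real \<Rightarrow> real \<Rightarrow> real" where
  "graph_gauss p q r s t = (r * t - s\<^sup>2) / (1 + p\<^sup>2 + q\<^sup>2)\<^sup>2"

lemma area_element_pos: "0 < 1 + p\<^sup>2 + (q::real)\<^sup>2"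
  by (simp add: add_pos_nonneg)

lemma sqrt_area_pow:
  fixes p q :: real
  defines "W \<equiv> sqrt (1 + p\<^sup>2 + q\<^sup>2)"
  shows "0 < W" "W ^ 2 = 1 + p\<^sup>2 + q\<^sup>2"
  using area_element_pos[of p q] by (simp_all add: W_def)

text \<open>In terms of the principal curvatures this is the square of half their difference, but
  here it is needed for arbitrary numbers, so that g is only evaluated on the half line. With E, F,
  G the coefficients of the first fundamental form, the numerator times E^2 is a square plus 4 (E G
  - F^2) times a square, and E G - F^2 = W^2 > 0.\<close>

lemma graph_discriminant_nonneg: "0 \<le> (graph_mean p q r s t)\<^sup>2 - graph_gauss p q r s t"
proof -
  define W where "W = sqrt (1 + p\<^sup>2 + q\<^sup>2)"
  have W: "0 < W" "W ^ 2 = 1 + p\<^sup>2 + q\<^sup>2"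
    using sqrt_area_pow[of p q] by (simp_all add: W_def)
  define E F G where "E = 1 + p\<^sup>2" and "F = p * q" and "G = 1 + q\<^sup>2"
  have E: "E > 0" unfolding E_def by (simp add: add_pos_nonneg)
  have W2: "W ^ 2 = E * G - F\<^sup>2"
    unfolding W(2) E_def F_def G_def by (simp add: algebra_simps power2_eq_square)
  have "E\<^sup>2 * ((G * r - 2 * F * s + E * t)\<^sup>2 - 4 * (E * G - F\<^sup>2) * (r * t - s\<^sup>2))
      = (E * (E * t - G * r) - 2 * F * (E * s - F * r))\<^sup>2 + 4 * (E * G - F\<^sup>2) * (E * s - F * r)\<^sup>2"
    by (simp add: algebra_simps power2_eq_square)
  also have "\<dots> \<ge> 0" unfolding W2[symmetric] by simp
  finally have *: "0 \<le> (G * r - 2 * F * s + E * t)\<^sup>2 - 4 * W^2 * (r * t - s\<^sup>2)"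
    unfolding W2 using E by (simp add: zero_le_mult_iff)
  have "(graph_mean p q r s t)\<^sup>2 - graph_gauss p q r s t
      = (G * r - 2 * F * s + E * t)\<^sup>2 / (4 * W ^ 6) - (r * t - s\<^sup>2) / W ^ 4"
    unfolding graph_mean_def graph_gauss_def W_def[symmetric] W(2)[symmetric]
    by (simp add: E_def F_def G_def power_divide power_mult_distrib mult.assoc flip: power_mult)
  also have "\<dots> = ((G * r - 2 * F * s + E * t)\<^sup>2 - 4 * W^2 * (r * t - s\<^sup>2)) / (4 * W ^ 6)"
    using W(1) by (simp add: divide_simps) (simp add: algebra_simps eval_nat_numeral)
  finally show ?thesis using * W by simp
qed

text \<open>The partial derivatives of \<open>H\<close> and \<open>K\<close> in \<open>(p, q, r, s, t)\<close>, and the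
  coefficient of the linearisation of \<open>H - g (H\<^sup>2 - K)\<close> that belongs to a variable in which \<open>H\<close>
  and \<open>K\<close> have the derivatives \<open>h\<close> and \<open>k\<close>.\<close>

context
  fixes g' :: "real \<Rightarrow> real" and p q r s t :: real
begin

definition "mean_p = (p * t - q * s) / sqrt (1 + p\<^sup>2 + q\<^sup>2) ^ 3
    - 3 * p * ((1 + q\<^sup>2) * r - 2 * p * q * s + (1 + p\<^sup>2) * t) / (2 * sqrt (1 + p\<^sup>2 + q\<^sup>2) ^ 5)"
definition "mean_q = (q * r - p * s) / sqrt (1 + p\<^sup>2 + q\<^sup>2) ^ 3
    - 3 * q * ((1 + q\<^sup>2) * r - 2 * p * q * s + (1 + p\<^sup>2) * t) / (2 * sqrt (1 + p\<^sup>2 + q\<^sup>2) ^ 5)"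
definition "mean_r = (1 + q\<^sup>2) / (2 * sqrt (1 + p\<^sup>2 + q\<^sup>2) ^ 3)"
definition "mean_s = - 2 * p * q / (2 * sqrt (1 + p\<^sup>2 + q\<^sup>2) ^ 3)"
definition "mean_t = (1 + p\<^sup>2) / (2 * sqrt (1 + p\<^sup>2 + q\<^sup>2) ^ 3)"
definition "gauss_p = - 4 * p * (r * t - s\<^sup>2) / (1 + p\<^sup>2 + q\<^sup>2) ^ 3"
definition "gauss_q = - 4 * q * (r * t - s\<^sup>2) / (1 + p\<^sup>2 + q\<^sup>2) ^ 3"
definition "gauss_r = t / (1 + p\<^sup>2 + q\<^sup>2)\<^sup>2"
definition "gauss_s = - 2 * s / (1 + p\<^sup>2 + q\<^sup>2)\<^sup>2"
definition "gauss_t = r / (1 + p\<^sup>2 + q\<^sup>2)\<^sup>2"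

definition "lin_coeff h k =
  h - g' ((graph_mean p q r s t)\<^sup>2 - graph_gauss p q r s t) * (2 * graph_mean p q r s t * h - k)"

end

text \<open>The tested variation of (r, s, t) is the rank one Hessian with entries \<xi>^2, \<xi>
  \<eta>, \<eta>^2, and \<open>h\<close>, \<open>k\<close> are the derivatives of H and K along it.
  The core is \<open>(2 * H * h - k)\<^sup>2 \<le> 4 * (H\<^sup>2 - K) * h\<^sup>2\<close>; with 4 t
  g'(t)^2 < 1 at t = H^2 - K it makes the term containing g' smaller than \<open>h\<close>, which is
  positive.\<close>

lemma ellipticity:
  assumes g': "\<forall>t\<ge>0. 4 * t * (g' t)\<^sup>2 < (1::real)" and nz: "(\<xi>, \<eta>) \<noteq> (0, 0)"
  shows "0 < lin_coeff g' p q r s t (mean_r p q) (gauss_r p q t) * \<xi>\<^sup>2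
           + lin_coeff g' p q r s t (mean_s p q) (gauss_s p q s) * \<xi> * \<eta>
           + lin_coeff g' p q r s t (mean_t p q) (gauss_t p q r) * \<eta>\<^sup>2"
proof -
  define W where "W = sqrt (1 + p\<^sup>2 + q\<^sup>2)"
  have W: "0 < W" "W ^ 2 = 1 + p\<^sup>2 + q\<^sup>2"
    using sqrt_area_pow[of p q] by (simp_all add: W_def)
  define E F G where "E = 1 + p\<^sup>2" and "F = p * q" and "G = 1 + q\<^sup>2"
  have W2: "W ^ 2 = E * G - F\<^sup>2"
    unfolding W(2) E_def F_def G_def by (simp add: algebra_simps power2_eq_square)
  define hh kk where "hh = G * \<xi>\<^sup>2 - 2 * F * \<xi> * \<eta> + E * \<eta>\<^sup>2"
    and "kk = t * \<xi>\<^sup>2 - 2 * s * \<xi> * \<eta> + r * \<eta>\<^sup>2"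
  define h k where "h = hh / (2 * W^3)" and "k = kk / W ^ 4"
  define H K where "H = graph_mean p q r s t" and "K = graph_gauss p q r s t"
  have H: "H = (G * r - 2 * F * s + E * t) / (2 * W ^ 3)"
    unfolding H_def graph_mean_def W_def G_def F_def E_def by (simp add: mult.assoc)
  have K: "K = (r * t - s\<^sup>2) / W ^ 4"
    unfolding K_def graph_gauss_def W(2)[symmetric] by (simp flip: power_mult)
  have "hh = \<xi>\<^sup>2 + \<eta>\<^sup>2 + (q * \<xi> - p * \<eta>)\<^sup>2"
    unfolding hh_def E_def F_def G_def by (simp add: algebra_simps power2_eq_square)
  moreover have "\<xi>\<^sup>2 + \<eta>\<^sup>2 > 0" using nz by (simp add: sum_power2_gt_zero_iff)
  ultimately have "hh > 0" by (simp add: add_pos_nonneg)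
  then have h: "h > 0" using W by (simp add: h_def)
  \<comment> \<open>\<open>hh\<close> and \<open>kk\<close> are the first fundamental form and the
    Hessian of the graph evaluated on v = (-\<eta>, \<xi>). The vector w is orthogonal to v for the
    first fundamental form, and the gap in the core inequality is the square of the mixed Hessian
    entry of v and w.\<close>
  define v1 v2 where "v1 = - \<eta>" and "v2 = \<xi>"
  define w1 w2 where "w1 = - (F * v1 + G * v2)" and "w2 = E * v1 + F * v2"
  have sq: "(G * r - 2 * F * s + E * t) * hh * kk - W\<^sup>2 * kk\<^sup>2 - (r * t - s\<^sup>2) * hh\<^sup>2
      = (r * v1 * w1 + s * (v1 * w2 + v2 * w1) + t * v2 * w2)\<^sup>2"
    unfolding W2 hh_def kk_def w1_def w2_def v1_def v2_def by algebra
  have "4 * H * h * k - k\<^sup>2 - 4 * K * h\<^sup>2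
     = ((G * r - 2 * F * s + E * t) * hh * kk - W\<^sup>2 * kk\<^sup>2 - (r * t - s\<^sup>2) * hh\<^sup>2) / W ^ 10"
    unfolding H K h_def k_def using W(1)
    by (simp add: divide_simps) (simp add: algebra_simps eval_nat_numeral)
  also have "\<dots> \<ge> 0" unfolding sq using W(1) by simp
  finally have *: "(2 * H * h - k)\<^sup>2 \<le> 4 * (H\<^sup>2 - K) * h\<^sup>2"
    by (simp add: algebra_simps power2_eq_square)
  define m where "m = g' (H\<^sup>2 - K)"
  have T: "0 \<le> H\<^sup>2 - K" unfolding H_def K_def by (rule graph_discriminant_nonneg)
  have "(m * (2 * H * h - k))\<^sup>2 \<le> m\<^sup>2 * (4 * (H\<^sup>2 - K) * h\<^sup>2)"
    using * by (simp add: power_mult_distrib mult_left_mono)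
  also have "\<dots> = (4 * (H\<^sup>2 - K) * m\<^sup>2) * h\<^sup>2" by simp
  also have "\<dots> < 1 * h\<^sup>2"
    using spec[OF g', of "H\<^sup>2 - K"] T h unfolding m_def by (intro mult_strict_right_mono) simp_all
  finally have "m * (2 * H * h - k) < h" using h
    by (metis abs_le_square_iff abs_of_pos linorder_not_le mult_1 order_less_le_trans abs_ge_self)
  moreover have "lin_coeff g' p q r s t (mean_r p q) (gauss_r p q t) * \<xi>\<^sup>2
           + lin_coeff g' p q r s t (mean_s p q) (gauss_s p q s) * \<xi> * \<eta>
           + lin_coeff g' p q r s t (mean_t p q) (gauss_t p q r) * \<eta>\<^sup>2 = h - m * (2 * H * h - k)"
    unfolding lin_coeff_def H_def[symmetric] K_def[symmetric] m_def[symmetric] 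
      mean_r_def mean_s_def mean_t_def gauss_r_def gauss_s_def gauss_t_def W_def[symmetric] 
      W(2)[symmetric] h_def k_def hh_def kk_def E_def F_def G_def
    using W(1) by (simp add: divide_simps flip: power_mult) (simp add: algebra_simps eval_nat_numeral)
  ultimately show ?thesis by simp
qed


lemma continuous_on_lin_coeff:
  fixes p q r s t h k :: "'a::topological_space \<Rightarrow> real"
  assumes g': "continuous_on {0..} g'"
    and c: "continuous_on S p" "continuous_on S q" "continuous_on S r" "continuous_on S s" "continuous_on S t"
      "continuous_on S h" "continuous_on S k"
  shows "continuous_on S (\<lambda>x. lin_coeff g' (p x) (q x) (r x) (s x) (t x) (h x) (k x))"
proof -
  have nz: "sqrt (1 + (p x)\<^sup>2 + (q x)\<^sup>2) \<noteq> 0" "1 + (p x)\<^sup>2 + (q x)\<^sup>2 \<noteq> 0" for x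
    using area_element_pos[of "p x" "q x"] by auto
  have m: "continuous_on S (\<lambda>x. graph_mean (p x) (q x) (r x) (s x) (t x))"
    unfolding graph_mean_def by (intro continuous_intros c) (use nz in auto)
  have "continuous_on S (\<lambda>x. graph_gauss (p x) (q x) (r x) (s x) (t x))"
    unfolding graph_gauss_def by (intro continuous_intros c) (use nz in auto)
  with m have "continuous_on S (\<lambda>x. (graph_mean (p x) (q x) (r x) (s x) (t x))\<^sup>2
      - graph_gauss (p x) (q x) (r x) (s x) (t x))"
    by (intro continuous_intros)
  then have "continuous_on S (\<lambda>x. g' ((graph_mean (p x) (q x) (r x) (s x) (t x))\<^sup>2
      - graph_gauss (p x) (q x) (r x) (s x) (t x)))"
    by (rule continuous_on_compose2[OF g']) (use graph_discriminant_nonneg in auto)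
  with m show ?thesis unfolding lin_coeff_def by (intro continuous_intros c)
qed

lemma continuous_on_partials:
  fixes p q r s t :: "'a::topological_space \<Rightarrow> real"
  assumes c: "continuous_on S p" "continuous_on S q" "continuous_on S r" "continuous_on S s" "continuous_on S t"
  shows "continuous_on S (\<lambda>x. mean_p (p x) (q x) (r x) (s x) (t x))"
    "continuous_on S (\<lambda>x. mean_q (p x) (q x) (r x) (s x) (t x))"
    "continuous_on S (\<lambda>x. mean_r (p x) (q x))"
    "continuous_on S (\<lambda>x. mean_s (p x) (q x))"
    "continuous_on S (\<lambda>x. mean_t (p x) (q x))"
    "continuous_on S (\<lambda>x. gauss_p (p x) (q x) (r x) (s x) (t x))"
    "continuous_on S (\<lambda>x. gauss_q (p x) (q x) (r x) (s x) (t x))"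
    "continuous_on S (\<lambda>x. gauss_r (p x) (q x) (t x))"
    "continuous_on S (\<lambda>x. gauss_s (p x) (q x) (s x))"
    "continuous_on S (\<lambda>x. gauss_t (p x) (q x) (r x))"
proof -
  have nz: "sqrt (1 + (p x)\<^sup>2 + (q x)\<^sup>2) \<noteq> 0" "1 + (p x)\<^sup>2 + (q x)\<^sup>2 \<noteq> 0" for x
    using area_element_pos[of "p x" "q x"] by auto
  note defs = mean_p_def mean_q_def mean_r_def mean_s_def mean_t_def
    gauss_p_def gauss_q_def gauss_r_def gauss_s_def gauss_t_def
  show "continuous_on S (\<lambda>x. mean_p (p x) (q x) (r x) (s x) (t x))"
    "continuous_on S (\<lambda>x. mean_q (p x) (q x) (r x) (s x) (t x))"
    "continuous_on S (\<lambda>x. mean_r (p x) (q x))"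
    "continuous_on S (\<lambda>x. mean_s (p x) (q x))"
    "continuous_on S (\<lambda>x. mean_t (p x) (q x))"
    "continuous_on S (\<lambda>x. gauss_p (p x) (q x) (r x) (s x) (t x))"
    "continuous_on S (\<lambda>x. gauss_q (p x) (q x) (r x) (s x) (t x))"
    "continuous_on S (\<lambda>x. gauss_r (p x) (q x) (t x))"
    "continuous_on S (\<lambda>x. gauss_s (p x) (q x) (s x))"
    "continuous_on S (\<lambda>x. gauss_t (p x) (q x) (r x))"
    unfolding defs by (intro continuous_intros c; use nz in force)+
qed

lemma DERIV_graph_mean:
  fixes p q r s t :: "real \<Rightarrow> real"
  assumes d: "(p has_real_derivative p') (at x)" "(q has_real_derivative q') (at x)"
    "(r has_real_derivative r') (at x)" "(s has_real_derivative s') (at x)" "(t has_real_derivative t') (at x)"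
  shows "((\<lambda>x. graph_mean (p x) (q x) (r x) (s x) (t x)) has_real_derivative
     mean_p (p x) (q x) (r x) (s x) (t x) * p' + mean_q (p x) (q x) (r x) (s x) (t x) * q'
     + mean_r (p x) (q x) * r' + mean_s (p x) (q x) * s' + mean_t (p x) (q x) * t') (at x)"
proof -
  define W where "W = sqrt (1 + (p x)\<^sup>2 + (q x)\<^sup>2)"
  have W: "0 < W" "W ^ 2 = 1 + (p x)\<^sup>2 + (q x)\<^sup>2"
    using sqrt_area_pow[of "p x" "q x"] by (simp_all add: W_def)
  define N where "N = (1 + (q x)\<^sup>2) * r x - 2 * p x * q x * s x + (1 + (p x)\<^sup>2) * t x"
  define N' where "N' = 2 * q x * q' * r x + (1 + (q x)\<^sup>2) * r' - 2 * p' * q x * s x - 2 * p x * q' * s x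
    - 2 * p x * q x * s' + 2 * p x * p' * t x + (1 + (p x)\<^sup>2) * t'"
  have dW: "((\<lambda>x. sqrt (1 + (p x)\<^sup>2 + (q x)\<^sup>2)) has_real_derivative (p x * p' + q x * q') / W) (at x)"
  proof -
    have "((\<lambda>x. 1 + (p x)\<^sup>2 + (q x)\<^sup>2) has_real_derivative 2 * (p x * p' + q x * q')) (at x)"
      by (auto intro!: derivative_eq_intros d simp: algebra_simps)
    from DERIV_chain2[where f = sqrt, OF DERIV_real_sqrt this] area_element_pos[of "p x" "q x"]
    have "((\<lambda>x. sqrt (1 + (p x)\<^sup>2 + (q x)\<^sup>2)) has_real_derivative
        inverse (sqrt (1 + (p x)\<^sup>2 + (q x)\<^sup>2)) / 2 * (2 * (p x * p' + q x * q'))) (at x)"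
      by simp
    then
    show ?thesis
    proof (rule DERIV_cong)
      have "inverse W / 2 * (2 * A) = A / W" for A using W(1) by (simp add: field_simps)
      then show "inverse (sqrt (1 + (p x)\<^sup>2 + (q x)\<^sup>2)) / 2 * (2 * (p x * p' + q x * q'))
          = (p x * p' + q x * q') / W"
        unfolding W_def by blast
    qed
  qed
  have dN: "((\<lambda>x. (1 + (q x)\<^sup>2) * r x - 2 * p x * q x * s x + (1 + (p x)\<^sup>2) * t x)
      has_real_derivative N') (at x)"
    by (auto intro!: derivative_eq_intros d simp: N'_def algebra_simps)
  have dW3: "((\<lambda>x. 2 * sqrt (1 + (p x)\<^sup>2 + (q x)\<^sup>2) ^ 3) has_real_derivative
      6 * W * (p x * p' + q x * q')) (at x)"
    by (rule DERIV_cong[OF DERIV_cmult[OF DERIV_power[OF dW, of 3], of 2]])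
      (use W(1) in \<open>simp only: W_def[symmetric], simp add: field_simps power2_eq_square\<close>)
  have "((\<lambda>x. graph_mean (p x) (q x) (r x) (s x) (t x)) has_real_derivative
      (N' * (2 * W ^ 3) - N * (6 * W * (p x * p' + q x * q'))) / ((2 * W ^ 3) * (2 * W ^ 3))) (at x)"
    unfolding graph_mean_def
    using DERIV_divide[OF dN dW3] W(1) by (simp add: W_def[symmetric] N_def)
  also have "(N' * (2 * W ^ 3) - N * (6 * W * (p x * p' + q x * q'))) / ((2 * W ^ 3) * (2 * W ^ 3))
     = N' / (2 * W ^ 3) - 3 * N * (p x * p' + q x * q') / (2 * W ^ 5)"
    using W(1) by (simp add: divide_simps) (simp add: algebra_simps eval_nat_numeral)
  also have "\<dots> = mean_p (p x) (q x) (r x) (s x) (t x) * p' + mean_q (p x) (q x) (r x) (s x) (t x) * q'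
     + mean_r (p x) (q x) * r' + mean_s (p x) (q x) * s' + mean_t (p x) (q x) * t'"
    unfolding mean_p_def mean_q_def mean_r_def mean_s_def mean_t_def W_def[symmetric]
      N_def[symmetric] N'_def
    by (simp add: add_divide_distrib diff_divide_distrib algebra_simps)
  finally show ?thesis .
qed

lemma DERIV_graph_gauss:
  fixes p q r s t :: "real \<Rightarrow> real"
  assumes d: "(p has_real_derivative p') (at x)" "(q has_real_derivative q') (at x)"
    "(r has_real_derivative r') (at x)" "(s has_real_derivative s') (at x)" "(t has_real_derivative t') (at x)"
  shows "((\<lambda>x. graph_gauss (p x) (q x) (r x) (s x) (t x)) has_real_derivative
     gauss_p (p x) (q x) (r x) (s x) (t x) * p' + gauss_q (p x) (q x) (r x) (s x) (t x) * q'
     + gauss_r (p x) (q x) (t x) * r' + gauss_s (p x) (q x) (s x) * s' + gauss_t (p x) (q x) (r x) * t') (at x)"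
proof -
  define V where "V = 1 + (p x)\<^sup>2 + (q x)\<^sup>2"
  have V: "V > 0" unfolding V_def by (rule area_element_pos)
  have dN: "((\<lambda>x. r x * t x - (s x)\<^sup>2) has_real_derivative (r' * t x + r x * t' - 2 * s x * s')) (at x)"
    by (auto intro!: derivative_eq_intros d)
  have dV: "((\<lambda>x. (1 + (p x)\<^sup>2 + (q x)\<^sup>2)\<^sup>2) has_real_derivative 4 * V * (p x * p' + q x * q')) (at x)"
    by (auto intro!: derivative_eq_intros d simp: V_def algebra_simps)
  have "((\<lambda>x. graph_gauss (p x) (q x) (r x) (s x) (t x)) has_real_derivative
      ((r' * t x + r x * t' - 2 * s x * s') * V\<^sup>2 - (r x * t x - (s x)\<^sup>2) * (4 * V * (p x * p' + q x * q')))
        / (V\<^sup>2 * V\<^sup>2)) (at x)"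
    unfolding graph_gauss_def
    using DERIV_divide[OF dN dV] V by (simp add: V_def[symmetric])
  also have "((r' * t x + r x * t' - 2 * s x * s') * V\<^sup>2 - (r x * t x - (s x)\<^sup>2) * (4 * V * (p x * p' + q x * q')))
        / (V\<^sup>2 * V\<^sup>2)
     = gauss_p (p x) (q x) (r x) (s x) (t x) * p' + gauss_q (p x) (q x) (r x) (s x) (t x) * q'
     + gauss_r (p x) (q x) (t x) * r' + gauss_s (p x) (q x) (s x) * s' + gauss_t (p x) (q x) (r x) * t'"
    unfolding gauss_p_def gauss_q_def gauss_r_def gauss_s_def gauss_t_def V_def[symmetric]
    using V by (simp add: divide_simps) (simp add: algebra_simps eval_nat_numeral)
  finally show ?thesis .
qed

definition weingarten_defect :: "(real \<Rightarrow> real) \<Rightarrow> real \<Rightarrow> real \<Rightarrow> real \<Rightarrow> real \<Rightarrow> real \<Rightarrow> real" where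
  "weingarten_defect g p q r s t = graph_mean p q r s t - g ((graph_mean p q r s t)\<^sup>2 - graph_gauss p q r s t)"

lemma DERIV_weingarten_defect:
  fixes p q r s t :: "real \<Rightarrow> real"
  assumes g: "\<forall>t\<ge>0. (g has_real_derivative g' t) (at t within {0..})"
    and d: "(p has_real_derivative p') (at x)" "(q has_real_derivative q') (at x)"
    "(r has_real_derivative r') (at x)" "(s has_real_derivative s') (at x)" "(t has_real_derivative t') (at x)"
  shows "((\<lambda>x. weingarten_defect g (p x) (q x) (r x) (s x) (t x)) has_real_derivative
     lin_coeff g' (p x) (q x) (r x) (s x) (t x) (mean_p (p x) (q x) (r x) (s x) (t x)) 
        (gauss_p (p x) (q x) (r x) (s x) (t x)) * p'
     + lin_coeff g' (p x) (q x) (r x) (s x) (t x) (mean_q (p x) (q x) (r x) (s x) (t x)) 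
        (gauss_q (p x) (q x) (r x) (s x) (t x)) * q'
     + lin_coeff g' (p x) (q x) (r x) (s x) (t x) (mean_r (p x) (q x)) (gauss_r (p x) (q x) (t x)) * r'
     + lin_coeff g' (p x) (q x) (r x) (s x) (t x) (mean_s (p x) (q x)) (gauss_s (p x) (q x) (s x)) * s'
     + lin_coeff g' (p x) (q x) (r x) (s x) (t x) (mean_t (p x) (q x)) (gauss_t (p x) (q x) (r x)) * t') (at x)"
proof -
  define H where "H y = graph_mean (p y) (q y) (r y) (s y) (t y)" for y
  define K where "K y = graph_gauss (p y) (q y) (r y) (s y) (t y)" for y
  obtain H' where H': "H' = mean_p (p x) (q x) (r x) (s x) (t x) * p' + mean_q (p x) (q x) (r x) (s x) (t x) * q'
     + mean_r (p x) (q x) * r' + mean_s (p x) (q x) * s' + mean_t (p x) (q x) * t'" by blast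
  obtain K' where K': "K' = gauss_p (p x) (q x) (r x) (s x) (t x) * p' + gauss_q (p x) (q x) (r x) (s x) (t x) * q'
     + gauss_r (p x) (q x) (t x) * r' + gauss_s (p x) (q x) (s x) * s' + gauss_t (p x) (q x) (r x) * t'" by blast
  have dH: "(H has_real_derivative H') (at x)"
    unfolding H_def H' by (rule DERIV_graph_mean[OF d])
  have dK: "(K has_real_derivative K') (at x)"
    unfolding K_def K' by (rule DERIV_graph_gauss[OF d])
  have dT: "((\<lambda>y. (H y)\<^sup>2 - K y) has_real_derivative 2 * H x * H' - K') (at x)"
    by (auto intro!: derivative_eq_intros dH dK)
  have nonneg: "0 \<le> (H y)\<^sup>2 - K y" for y
    unfolding H_def K_def by (rule graph_discriminant_nonneg)
  \<comment> \<open>At an umbilic the argument of g is the end point 0 of its domain. The chain rule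
    only asks for differentiability within the range of the inner function, which lies in the half
    line by the sign of the discriminant.\<close>
  have "(g has_real_derivative g' ((H x)\<^sup>2 - K x)) (at ((H x)\<^sup>2 - K x) within range (\<lambda>y. (H y)\<^sup>2 - K y))"
  proof (rule DERIV_subset[of g _ _ "{0..}"])
    show "(g has_real_derivative g' ((H x)\<^sup>2 - K x)) (at ((H x)\<^sup>2 - K x) within {0..})"
      using g nonneg by blast
    show "range (\<lambda>y. (H y)\<^sup>2 - K y) \<subseteq> {0..}"
      using nonneg by (simp only: image_subset_iff atLeast_iff) blast
  qed
  from DERIV_image_chain[OF this dT]
  have "((\<lambda>y. g ((H y)\<^sup>2 - K y)) has_real_derivative g' ((H x)\<^sup>2 - K x) * (2 * H x * H' - K')) (at x)"
    by (simp add: o_def)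
  from DERIV_diff[OF dH this]
  have *: "((\<lambda>x. weingarten_defect g (p x) (q x) (r x) (s x) (t x)) has_real_derivative
     H' - g' ((H x)\<^sup>2 - K x) * (2 * H x * H' - K')) (at x)"
    by (simp add: weingarten_defect_def H_def K_def)
  show ?thesis
    by (rule DERIV_cong[OF *])
      (simp only: lin_coeff_def H_def[symmetric] K_def[symmetric] H' K', simp only: algebra_simps)
qed

lemma compact_bounded_real:
  fixes f :: "'a::topological_space \<Rightarrow> real"
  assumes "compact S" "continuous_on S f"
  shows "\<exists>B>0. \<forall>x\<in>S. \<bar>f x\<bar> \<le> B"
  using compact_imp_bounded[OF compact_continuous_image[OF assms(2,1)]]
  by (auto simp: bounded_pos)

text \<open>The mean value theorem for the defect on the segment between the two tuples yields
  coefficients taken at one intermediate tuple. The cube with half side M is convex, so that tuple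
  stays in a compact set on which \<open>l\<close> and \<open>L\<close> are chosen once and for all.
  Here \<open>a12\<close> is the full coefficient of the mixed derivative, that is, twice the
  off-diagonal entry of the symmetric coefficient matrix.\<close>

lemma linearized_weingarten:
  assumes g: "\<forall>t\<ge>0. (g has_real_derivative g' t) (at t within {0..})"
    and cont: "continuous_on {0..} g'"
    and ell: "\<forall>t\<ge>0. 4 * t * (g' t)\<^sup>2 < 1"
    and M: "0 \<le> M"
  obtains l L where "0 < l" "0 < L"
    "\<And>p0 q0 r0 s0 t0 p1 q1 r1 s1 t1.
      \<lbrakk>\<bar>p0\<bar> \<le> M; \<bar>q0\<bar> \<le> M; \<bar>r0\<bar> \<le> M; \<bar>s0\<bar> \<le> M; \<bar>t0\<bar> \<le> M;
       \<bar>p1\<bar> \<le> M; \<bar>q1\<bar> \<le> M; \<bar>r1\<bar> \<le> M; \<bar>s1\<bar> \<le> M; \<bar>t1\<bar> \<le> M;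
       weingarten_defect g p0 q0 r0 s0 t0 = 0; weingarten_defect g p1 q1 r1 s1 t1 = 0\<rbrakk>
      \<Longrightarrow> \<exists>a11 a12 a22 b1 b2. (\<forall>\<xi> \<eta>. l * (\<xi>\<^sup>2 + \<eta>\<^sup>2) \<le> a11 * \<xi>\<^sup>2 + a12 * \<xi> * \<eta> + a22 * \<eta>\<^sup>2)
         \<and> \<bar>a11\<bar> \<le> L \<and> \<bar>a22\<bar> \<le> L \<and> \<bar>b1\<bar> \<le> L \<and> \<bar>b2\<bar> \<le> L
         \<and> a11 * (r1 - r0) + a12 * (s1 - s0) + a22 * (t1 - t0) + b1 * (p1 - p0) + b2 * (q1 - q0) = 0"
proof -
  define I where "I = {- M..M}"
  define S where "S = Product_Type.Times I (Product_Type.Times I (Product_Type.Times I (Product_Type.Times I I)))"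
  have "compact I" unfolding I_def by simp
  then have S: "compact S" unfolding S_def by (intro compact_Times)
  define cp cq cr cs ct :: "real \<times> real \<times> real \<times> real \<times> real \<Rightarrow> real"
    where "cp z = fst z" and "cq z = fst (snd z)" and "cr z = fst (snd (snd z))"
      and "cs z = fst (snd (snd (snd z)))" and "ct z = snd (snd (snd (snd z)))" for z
  have c: "continuous_on T cp" "continuous_on T cq" "continuous_on T cr" "continuous_on T cs"
      "continuous_on T ct" for T
    unfolding cp_def cq_def cr_def cs_def ct_def by (intro continuous_intros)+
  define lc where "lc h k z = lin_coeff g' (cp z) (cq z) (cr z) (cs z) (ct z) (h z) (k z)"
    for h k :: "real \<times> real \<times> real \<times> real \<times> real \<Rightarrow> real" and z
  define A11 A12 A22 B1 B2 where
      "A11 = lc (\<lambda>z. mean_r (cp z) (cq z)) (\<lambda>z. gauss_r (cp z) (cq z) (ct z))"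
    and "A12 = lc (\<lambda>z. mean_s (cp z) (cq z)) (\<lambda>z. gauss_s (cp z) (cq z) (cs z))"
    and "A22 = lc (\<lambda>z. mean_t (cp z) (cq z)) (\<lambda>z. gauss_t (cp z) (cq z) (cr z))"
    and "B1 = lc (\<lambda>z. mean_p (cp z) (cq z) (cr z) (cs z) (ct z)) (\<lambda>z. gauss_p (cp z) (cq z) (cr z) (cs z) (ct z))"
    and "B2 = lc (\<lambda>z. mean_q (cp z) (cq z) (cr z) (cs z) (ct z)) (\<lambda>z. gauss_q (cp z) (cq z) (cr z) (cs z) (ct z))"
  have contA: "continuous_on S A11" "continuous_on S A12" "continuous_on S A22"
      "continuous_on S B1" "continuous_on S B2"
    unfolding A11_def A12_def A22_def B1_def B2_def lc_def
    by (intro continuous_on_lin_coeff cont c continuous_on_partials[OF c])+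
  obtain L1 where L1: "L1 > 0" "\<And>x. x \<in> S \<Longrightarrow> \<bar>A11 x\<bar> \<le> L1"
    using compact_bounded_real[OF S contA(1)] by blast
  obtain L2 where L2: "L2 > 0" "\<And>x. x \<in> S \<Longrightarrow> \<bar>A22 x\<bar> \<le> L2"
    using compact_bounded_real[OF S contA(3)] by blast
  obtain L3 where L3: "L3 > 0" "\<And>x. x \<in> S \<Longrightarrow> \<bar>B1 x\<bar> \<le> L3"
    using compact_bounded_real[OF S contA(4)] by blast
  obtain L4 where L4: "L4 > 0" "\<And>x. x \<in> S \<Longrightarrow> \<bar>B2 x\<bar> \<le> L4"
    using compact_bounded_real[OF S contA(5)] by blast
  define L where "L = L1 + L2 + L3 + L4"
  have L: "L > 0" "\<And>x. x \<in> S \<Longrightarrow> \<bar>A11 x\<bar> \<le> L \<and> \<bar>A22 x\<bar> \<le> L \<and> \<bar>B1 x\<bar> \<le> L \<and> \<bar>B2 x\<bar> \<le> L"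
  proof -
    have le: "L1 \<le> L" "L2 \<le> L" "L3 \<le> L" "L4 \<le> L" "0 < L"
      using L1(1) L2(1) L3(1) L4(1) unfolding L_def by linarith+
    show "L > 0" by (rule le)
    show "\<bar>A11 x\<bar> \<le> L \<and> \<bar>A22 x\<bar> \<le> L \<and> \<bar>B1 x\<bar> \<le> L \<and> \<bar>B2 x\<bar> \<le> L" if "x \<in> S" for x
      using L1(2)[OF that] L2(2)[OF that] L3(2)[OF that] L4(2)[OF that] le by linarith
  qed
  \<comment> \<open>The quadratic form is homogeneous of degree two, so its minimum over the cube
    times the unit circle is a uniform ellipticity constant; it is positive because it is
    attained.\<close>
  define C where "C = sphere (0::real \<times> real) 1"
  define Q where "Q w = A11 (fst w) * (fst (snd w))\<^sup>2 + A12 (fst w) * fst (snd w) * snd (snd w)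
      + A22 (fst w) * (snd (snd w))\<^sup>2" for w
  have cS: "compact (Product_Type.Times S C)" unfolding C_def by (intro compact_Times S compact_sphere)
  have cQ: "continuous_on (Product_Type.Times S C) Q"
    unfolding Q_def
    by (intro continuous_intros continuous_on_compose2[OF contA(1)] continuous_on_compose2[OF contA(2)]
        continuous_on_compose2[OF contA(3)]) auto
  have "((0,0,0,0,0), (1,0)) \<in> Product_Type.Times S C"
    using M by (simp add: S_def I_def C_def norm_Pair)
  then obtain w0 where w0: "w0 \<in> Product_Type.Times S C" "\<And>w. w \<in> Product_Type.Times S C \<Longrightarrow> Q w0 \<le> Q w"
    using continuous_attains_inf[OF cS _ cQ] by blast
  define l where "l = Q w0"
  have "(fst (snd w0), snd (snd w0)) \<noteq> (0,0)"
    using w0(1) by (auto simp: C_def)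
  from ellipticity[OF ell this, of "cp (fst w0)" "cq (fst w0)" "cr (fst w0)" "cs (fst w0)" "ct (fst w0)"]
  have l: "l > 0" unfolding l_def Q_def A11_def A12_def A22_def lc_def by blast
  have lower: "l * (\<xi>\<^sup>2 + \<eta>\<^sup>2) \<le> A11 z * \<xi>\<^sup>2 + A12 z * \<xi> * \<eta> + A22 z * \<eta>\<^sup>2" if z: "z \<in> S" for z \<xi> \<eta>
  proof (cases "\<xi>\<^sup>2 + \<eta>\<^sup>2 = 0")
    case True then show ?thesis by (simp add: sum_power2_eq_zero_iff)
  next
    case False
    define n where "n = sqrt (\<xi>\<^sup>2 + \<eta>\<^sup>2)"
    have n: "n > 0" "n\<^sup>2 = \<xi>\<^sup>2 + \<eta>\<^sup>2"
      using False by (auto simp: n_def add_nonneg_pos less_le)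
    have "(\<xi> / n)\<^sup>2 + (\<eta> / n)\<^sup>2 = 1"
      unfolding power_divide add_divide_distrib[symmetric] n(2)[symmetric] using n(1) by simp
    then have "(z, (\<xi> / n, \<eta> / n)) \<in> Product_Type.Times S C"
      using z by (simp add: C_def norm_Pair power_divide)
    from w0(2)[OF this] have "l \<le> A11 z * (\<xi>/n)\<^sup>2 + A12 z * (\<xi>/n) * (\<eta>/n) + A22 z * (\<eta>/n)\<^sup>2"
      by (simp add: l_def Q_def)
    also have "\<dots> = (A11 z * \<xi>\<^sup>2 + A12 z * \<xi> * \<eta> + A22 z * \<eta>\<^sup>2) / n\<^sup>2"
      by (simp add: power_divide add_divide_distrib power2_eq_square)
    finally show ?thesis unfolding n(2)[symmetric] using n(1) by (simp add: pos_le_divide_eq)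
  qed
  show ?thesis
  proof (rule that[OF l L(1)])
    fix p0 q0 r0 s0 t0 p1 q1 r1 s1 t1
    assume b0: "\<bar>p0\<bar> \<le> M" "\<bar>q0\<bar> \<le> M" "\<bar>r0\<bar> \<le> M" "\<bar>s0\<bar> \<le> M" "\<bar>t0\<bar> \<le> M"
      and b1: "\<bar>p1\<bar> \<le> M" "\<bar>q1\<bar> \<le> M" "\<bar>r1\<bar> \<le> M" "\<bar>s1\<bar> \<le> M" "\<bar>t1\<bar> \<le> M"
      and z0: "weingarten_defect g p0 q0 r0 s0 t0 = 0" and z1: "weingarten_defect g p1 q1 r1 s1 t1 = 0"
    define pt where "pt x y \<theta> = x + \<theta> * (y - x)" for x y \<theta> :: real
    have dpt: "(pt x y has_real_derivative (y - x)) (at \<theta>)" for x y \<theta>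
      unfolding pt_def by (auto intro!: derivative_eq_intros)
    have ptI: "pt x y \<theta> \<in> I" if "\<bar>x\<bar> \<le> M" "\<bar>y\<bar> \<le> M" "0 \<le> \<theta>" "\<theta> \<le> 1" for x y \<theta>
    proof -
      have "pt x y \<theta> = (1 - \<theta>) *\<^sub>R x + \<theta> *\<^sub>R y" by (simp add: pt_def algebra_simps)
      moreover have "convex I" unfolding I_def by simp
      moreover have "x \<in> I" "y \<in> I" using that by (auto simp: I_def)
      ultimately show ?thesis using convexD[of I x y "1 - \<theta>" \<theta>] that by simp
    qed
    define Z where "Z \<theta> = (pt p0 p1 \<theta>, pt q0 q1 \<theta>, pt r0 r1 \<theta>, pt s0 s1 \<theta>, pt t0 t1 \<theta>)" for \<theta>
    define f where "f \<theta> = weingarten_defect g (pt p0 p1 \<theta>) (pt q0 q1 \<theta>) (pt r0 r1 \<theta>) (pt s0 s1 \<theta>) (pt t0 t1 \<theta>)" for \<theta>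
    \<comment> \<open>A single intermediate \<theta> serves all five coefficients at once because
      \<open>f\<close> is a scalar function of the segment parameter.\<close>
    have "\<exists>\<theta>>0. \<theta> < 1 \<and> f 1 - f 0 = (1 - 0) *
       (B1 (Z \<theta>) * (p1 - p0) + B2 (Z \<theta>) * (q1 - q0) + A11 (Z \<theta>) * (r1 - r0) + A12 (Z \<theta>) * (s1 - s0)
         + A22 (Z \<theta>) * (t1 - t0))"
      unfolding B1_def B2_def A11_def A12_def A22_def lc_def Z_def cp_def cq_def cr_def cs_def ct_def fst_conv snd_conv f_def
      by (rule MVT2[OF zero_less_one]) (rule DERIV_weingarten_defect[OF g dpt dpt dpt dpt dpt])
    moreover have "f 1 - f 0 = 0" using z0 z1 by (simp add: f_def pt_def)
    ultimately obtain \<theta> where \<theta>: "0 < \<theta>" "\<theta> < 1" 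
      "B1 (Z \<theta>) * (p1 - p0) + B2 (Z \<theta>) * (q1 - q0) + A11 (Z \<theta>) * (r1 - r0) + A12 (Z \<theta>) * (s1 - s0)
         + A22 (Z \<theta>) * (t1 - t0) = 0" by (metis diff_zero mult_1)
    have ZS: "Z \<theta> \<in> S" unfolding Z_def S_def by (intro SigmaI ptI b0 b1 less_imp_le \<theta>)
    have eq: "A11 (Z \<theta>) * (r1 - r0) + A12 (Z \<theta>) * (s1 - s0) + A22 (Z \<theta>) * (t1 - t0)
        + B1 (Z \<theta>) * (p1 - p0) + B2 (Z \<theta>) * (q1 - q0) = 0" using \<theta>(3) by linarith
    show "\<exists>a11 a12 a22 b1 b2. (\<forall>\<xi> \<eta>. l * (\<xi>\<^sup>2 + \<eta>\<^sup>2) \<le> a11 * \<xi>\<^sup>2 + a12 * \<xi> * \<eta> + a22 * \<eta>\<^sup>2)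
         \<and> \<bar>a11\<bar> \<le> L \<and> \<bar>a22\<bar> \<le> L \<and> \<bar>b1\<bar> \<le> L \<and> \<bar>b2\<bar> \<le> L
         \<and> a11 * (r1 - r0) + a12 * (s1 - s0) + a22 * (t1 - t0) + b1 * (p1 - p0) + b2 * (q1 - q0) = 0"
      using lower[OF ZS] L(2)[OF ZS] eq by blast
  qed
qed

section \<open>Second-order condition at a minimum, and Hopf's barrier\<close>

lemma DERIV_along_line:
  fixes w :: "'a::real_normed_vector \<Rightarrow> real"
  assumes "(w has_derivative D) (at (x + \<tau> *\<^sub>R v))"
  shows "((\<lambda>\<tau>. w (x + \<tau> *\<^sub>R v)) has_real_derivative D v) (at \<tau>)"
proof -
  have "((\<lambda>\<tau>. x + \<tau> *\<^sub>R v) has_derivative (\<lambda>h. h *\<^sub>R v)) (at \<tau>)"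
    by (auto intro!: derivative_eq_intros)
  from has_derivative_compose[OF this assms]
  have "((\<lambda>\<tau>. w (x + \<tau> *\<^sub>R v)) has_derivative (\<lambda>h. D (h *\<^sub>R v))) (at \<tau>)" .
  moreover have "D (h *\<^sub>R v) = D v * h" for h
    using linear_scale[OF has_derivative_linear[OF assms]] by simp
  ultimately show ?thesis by (simp add: has_field_derivative_def)
qed

text \<open>The second derivatives exist at \<open>x\<close> only, so no Taylor formula with
  second-order remainder is used: along a line with negative quadratic form the first derivative,
  zero at \<open>x\<close>, becomes negative just to the right, and the mean value theorem produces
  a smaller value. The mixed entries are kept apart, as only their sum matters.\<close>

lemma local_min_hessian:
  fixes w :: "real^2 \<Rightarrow> real"
  assumes U: "open U" "x \<in> U"
    and w: "\<And>y. y \<in> U \<Longrightarrow> (w has_derivative (\<lambda>h. w1 y * h$1 + w2 y * h$2)) (at y)"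
    and w1: "(w1 has_derivative (\<lambda>h. m11 * h$1 + m12 * h$2)) (at x)"
    and w2: "(w2 has_derivative (\<lambda>h. m21 * h$1 + m22 * h$2)) (at x)"
    and min: "\<And>y. y \<in> U \<Longrightarrow> w x \<le> w y"
  shows "w1 x = 0" "w2 x = 0" "0 \<le> m11 * \<xi>\<^sup>2 + (m12 + m21) * \<xi> * \<eta> + m22 * \<eta>\<^sup>2"
proof -
  have D0: "(\<lambda>h::real^2. w1 x * h$1 + w2 x * h$2) = (\<lambda>h. 0)"
    by (rule differential_zero_maxmin[OF U(2,1) w[OF U(2)]]) (use min in blast)
  from fun_cong[OF D0, of "axis 1 1"] show 1: "w1 x = 0" by (simp add: axis_def)
  from fun_cong[OF D0, of "axis 2 1"] show 2: "w2 x = 0" by (simp add: axis_def)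
  show "0 \<le> m11 * \<xi>\<^sup>2 + (m12 + m21) * \<xi> * \<eta> + m22 * \<eta>\<^sup>2" (is "0 \<le> ?Q")
  proof (rule ccontr)
    assume "\<not> 0 \<le> ?Q"
    then have neg: "?Q < 0" by simp
    define v :: "real^2" where "v = vector [\<xi>, \<eta>]"
    have v: "v $ 1 = \<xi>" "v $ 2 = \<eta>" by (simp_all add: v_def)
    define k where "k \<tau> = w (x + \<tau> *\<^sub>R v)" for \<tau>
    define k' where "k' \<tau> = w1 (x + \<tau> *\<^sub>R v) * \<xi> + w2 (x + \<tau> *\<^sub>R v) * \<eta>" for \<tau>
    have dk: "(k has_real_derivative k' \<tau>) (at \<tau>)" if "x + \<tau> *\<^sub>R v \<in> U" for \<tau>
      using DERIV_along_line[OF w[OF that]] unfolding k_def k'_def v .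
    have d1: "((\<lambda>\<tau>. w1 (x + \<tau> *\<^sub>R v)) has_real_derivative m11 * \<xi> + m12 * \<eta>) (at 0)"
      using DERIV_along_line[of w1 "\<lambda>h. m11 * h$1 + m12 * h$2" x 0 v] w1 by (simp add: v)
    have d2: "((\<lambda>\<tau>. w2 (x + \<tau> *\<^sub>R v)) has_real_derivative m21 * \<xi> + m22 * \<eta>) (at 0)"
      using DERIV_along_line[of w2 "\<lambda>h. m21 * h$1 + m22 * h$2" x 0 v] w2 by (simp add: v)
    have "(k' has_real_derivative ?Q) (at 0)"
      unfolding k'_def by (rule DERIV_cong[OF DERIV_add[OF DERIV_cmult_right[OF d1] DERIV_cmult_right[OF d2]]])
        (simp add: algebra_simps power2_eq_square)
    from DERIV_neg_dec_right[OF this neg] obtain d where d: "d > 0" "\<And>h. 0 < h \<Longrightarrow> h < d \<Longrightarrow> k' h < k' 0"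
      by auto
    have k'0: "k' 0 = 0" by (simp add: k'_def 1 2)
    have "continuous_on UNIV (\<lambda>\<tau>. x + \<tau> *\<^sub>R v)" by (intro continuous_intros)
    then have "open ((\<lambda>\<tau>. x + \<tau> *\<^sub>R v) -` U)" using U(1) open_vimage by blast
    moreover have "0 \<in> (\<lambda>\<tau>. x + \<tau> *\<^sub>R v) -` U" using U(2) by simp
    ultimately obtain e where e: "e > 0" "ball 0 e \<subseteq> (\<lambda>\<tau>. x + \<tau> *\<^sub>R v) -` U"
      using open_contains_ball by blast
    define h where "h = min d e / 2"
    have h: "0 < h" "h < d" "h < e" using d(1) e(1) by (auto simp: h_def)
    have inU: "x + \<tau> *\<^sub>R v \<in> U" if "0 \<le> \<tau>" "\<tau> \<le> h" for \<tau>
      using e(2) that h by (auto simp: subset_iff)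
    obtain \<tau> where \<tau>: "0 < \<tau>" "\<tau> < h" "k h - k 0 = (h - 0) * k' \<tau>"
      using MVT2[OF h(1), of k k'] dk inU by blast
    have "k' \<tau> < 0" using d(2)[of \<tau>] \<tau> h k'0 by auto
    then have "k h < k 0" using \<tau>(3) h(1) by (simp add: mult_pos_neg algebra_simps)
    then show False using min[OF inU[of h]] h(1) by (simp add: k_def)
  qed
qed

text \<open>This is the nonnegativity of the trace of a product of a positive definite and a
  positive semidefinite matrix, where \<open>a12\<close> is twice the off-diagonal entry. Completing
  the square, \<open>a11\<close> times the trace equals the second form at (a11, a12 / 2) plus the
  determinant of the first matrix times \<open>m22\<close>.\<close>

lemma trace_product_nonneg:
  fixes a11 a12 a22 m11 m12 m22 :: real
  assumes a: "\<And>\<xi> \<eta>. l * (\<xi>\<^sup>2 + \<eta>\<^sup>2) \<le> a11 * \<xi>\<^sup>2 + a12 * \<xi> * \<eta> + a22 * \<eta>\<^sup>2" and l: "l > 0"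
    and m: "\<And>\<xi> \<eta>. 0 \<le> m11 * \<xi>\<^sup>2 + 2 * m12 * \<xi> * \<eta> + m22 * \<eta>\<^sup>2"
  shows "0 \<le> a11 * m11 + a12 * m12 + a22 * m22"
proof -
  have a11: "a11 > 0" using a[of 1 0] l by simp
  have "0 \<le> l * ((- a12 / 2)\<^sup>2 + a11\<^sup>2)" using l by simp
  also note a[of "- a12 / 2" a11]
  also have "a11 * (- a12 / 2)\<^sup>2 + a12 * (- a12 / 2) * a11 + a22 * a11\<^sup>2 = a11 * (a11 * a22 - a12\<^sup>2 / 4)"
    by (simp add: power2_eq_square algebra_simps)
  finally have d: "0 \<le> a11 * a22 - a12\<^sup>2 / 4" using a11 by (simp add: zero_le_mult_iff)
  have m22: "0 \<le> m22" using m[of 0 1] by simp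
  have "a11 * (a11 * m11 + a12 * m12 + a22 * m22)
      = (m11 * a11\<^sup>2 + 2 * m12 * a11 * (a12 / 2) + m22 * (a12 / 2)\<^sup>2) + (a11 * a22 - a12\<^sup>2 / 4) * m22"
    by (simp add: power2_eq_square algebra_simps)
  also have "\<dots> \<ge> 0" using m[of a11 "a12 / 2"] d m22 by simp
  finally show ?thesis using a11 by (simp add: zero_le_mult_iff)
qed


lemma dist_vec2: "(dist x y)\<^sup>2 = (x$1 - y$1)\<^sup>2 + (x$2 - y$2)\<^sup>2" for x y :: "real^2"
  by (simp add: dist_norm norm_vec_def L2_set_def sum_2)

lemma has_derivative_vec2_nth [derivative_intros]:
  "((\<lambda>x::real^2. x $ i) has_derivative (\<lambda>h. h $ i)) (at x)"
  by (rule bounded_linear_imp_has_derivative[OF bounded_linear_vec_nth])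

text \<open>Hopf's barrier exp (-\<alpha> |x - c|^2), written in coordinates so that its first and
  second derivatives come out as explicit products with the barrier itself.\<close>

definition hopf :: "real \<Rightarrow> real^2 \<Rightarrow> real^2 \<Rightarrow> real" where
  "hopf \<alpha> c x = exp (- \<alpha> * ((x$1 - c$1)\<^sup>2 + (x$2 - c$2)\<^sup>2))"

lemma hopf_deriv:
  shows "(hopf \<alpha> c has_derivative (\<lambda>h. (- 2 * \<alpha> * (x$1 - c$1) * hopf \<alpha> c x) * h$1
      + (- 2 * \<alpha> * (x$2 - c$2) * hopf \<alpha> c x) * h$2)) (at x)"
  unfolding hopf_def[abs_def]
  by (rule has_derivative_eq_rhs, (rule derivative_intros)+) (auto simp: algebra_simps)

lemma hopf_deriv_1:
  shows "((\<lambda>x. - 2 * \<alpha> * (x$1 - c$1) * hopf \<alpha> c x) has_derivative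
     (\<lambda>h. ((4 * \<alpha>\<^sup>2 * (x$1 - c$1)\<^sup>2 - 2 * \<alpha>) * hopf \<alpha> c x) * h$1
      + (4 * \<alpha>\<^sup>2 * (x$1 - c$1) * (x$2 - c$2) * hopf \<alpha> c x) * h$2)) (at x)"
  by (rule has_derivative_eq_rhs, (rule derivative_intros hopf_deriv)+)
    (auto simp: algebra_simps power2_eq_square)

lemma hopf_deriv_2:
  shows "((\<lambda>x. - 2 * \<alpha> * (x$2 - c$2) * hopf \<alpha> c x) has_derivative
     (\<lambda>h. (4 * \<alpha>\<^sup>2 * (x$1 - c$1) * (x$2 - c$2) * hopf \<alpha> c x) * h$1
      + ((4 * \<alpha>\<^sup>2 * (x$2 - c$2)\<^sup>2 - 2 * \<alpha>) * hopf \<alpha> c x) * h$2)) (at x)"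
  by (rule has_derivative_eq_rhs, (rule derivative_intros hopf_deriv)+)
    (auto simp: algebra_simps power2_eq_square)

text \<open>The quantity is the linear operator applied to the barrier and divided by the barrier,
  with y = x - c. It factors as 2 \<alpha> (2 \<alpha> Q(y) - trace - b y), where Q is the quadratic
  form of the second-order coefficients. On the annulus Q(y) is at least l (R / 2)^2, and \<alpha>
  is chosen so that 2 \<alpha> l (R / 2)^2 exceeds the bound 2 L + 2 L R of the other terms by
  1.\<close>

lemma hopf_subsolution:
  fixes y1 y2 :: real
  assumes a: "\<And>\<xi> \<eta>. l * (\<xi>\<^sup>2 + \<eta>\<^sup>2) \<le> a11 * \<xi>\<^sup>2 + a12 * \<xi> * \<eta> + a22 * \<eta>\<^sup>2" and l: "l > 0"
    and L: "\<bar>a11\<bar> \<le> L" "\<bar>a22\<bar> \<le> L" "\<bar>b1\<bar> \<le> L" "\<bar>b2\<bar> \<le> L"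
    and R: "0 < R" "(R / 2)\<^sup>2 \<le> y1\<^sup>2 + y2\<^sup>2" "y1\<^sup>2 + y2\<^sup>2 \<le> R\<^sup>2"
    and \<alpha>: "\<alpha> = 2 * (2 * L + 2 * L * R + 1) / (l * R\<^sup>2)"
  shows "0 < a11 * (4 * \<alpha>\<^sup>2 * y1\<^sup>2 - 2 * \<alpha>) + a12 * (4 * \<alpha>\<^sup>2 * y1 * y2) + a22 * (4 * \<alpha>\<^sup>2 * y2\<^sup>2 - 2 * \<alpha>)
      + b1 * (- 2 * \<alpha> * y1) + b2 * (- 2 * \<alpha> * y2)"
proof -
  have L0: "0 \<le> L" using L(1) by linarith
  have \<alpha>0: "\<alpha> > 0" unfolding \<alpha> using l R(1) L0
    by (intro divide_pos_pos mult_pos_pos add_nonneg_pos) auto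
  have "y1\<^sup>2 \<le> R\<^sup>2" "y2\<^sup>2 \<le> R\<^sup>2"
    using R(3) zero_le_power2[of y1] zero_le_power2[of y2] by linarith+
  then have y: "\<bar>y1\<bar> \<le> R" "\<bar>y2\<bar> \<le> R"
    using R(1) by (simp_all flip: abs_le_square_iff)
  have "\<bar>b1 * y1\<bar> \<le> L * R" "\<bar>b2 * y2\<bar> \<le> L * R"
    using L y by (auto simp: abs_mult intro!: mult_mono)
  then have b: "b1 * y1 + b2 * y2 \<le> 2 * L * R" by linarith
  have aL: "a11 + a22 \<le> 2 * L" using L by linarith
  have "l * (R / 2)\<^sup>2 \<le> l * (y1\<^sup>2 + y2\<^sup>2)" using R l by simp
  also note a[of y1 y2]
  finally have "2 * \<alpha> * (l * (R / 2)\<^sup>2) \<le> 2 * \<alpha> * (a11 * y1\<^sup>2 + a12 * y1 * y2 + a22 * y2\<^sup>2)"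
    using \<alpha>0 by simp
  moreover have "2 * \<alpha> * (l * (R / 2)\<^sup>2) = 2 * L + 2 * L * R + 1"
    unfolding \<alpha> using l R(1) by (simp add: power_divide)
  ultimately have "0 < 2 * \<alpha> * (a11 * y1\<^sup>2 + a12 * y1 * y2 + a22 * y2\<^sup>2) - (a11 + a22) - (b1 * y1 + b2 * y2)"
    using b aL by linarith
  then have "0 < 2 * \<alpha> * (2 * \<alpha> * (a11 * y1\<^sup>2 + a12 * y1 * y2 + a22 * y2\<^sup>2) - (a11 + a22) - (b1 * y1 + b2 * y2))"
    using \<alpha>0 by simp
  also have "\<dots> = a11 * (4 * \<alpha>\<^sup>2 * y1\<^sup>2 - 2 * \<alpha>) + a12 * (4 * \<alpha>\<^sup>2 * y1 * y2) + a22 * (4 * \<alpha>\<^sup>2 * y2\<^sup>2 - 2 * \<alpha>)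
      + b1 * (- 2 * \<alpha> * y1) + b2 * (- 2 * \<alpha> * y2)"
    by (simp add: algebra_simps power2_eq_square)
  finally show ?thesis .
qed

section \<open>A strong maximum principle for directional derivatives\<close>

text \<open>The partial derivatives are parameters, so no derivative operator has to be evaluated;
  using the same \<open>s\<close> for both mixed derivatives records the symmetry of the
  Hessian.\<close>

locale weingarten_graph =
  fixes D :: "(real^2) set" and u p q r s t :: "real^2 \<Rightarrow> real" and g g' :: "real \<Rightarrow> real"
  assumes open_D: "open D"
    and du: "\<And>x. x \<in> D \<Longrightarrow> (u has_derivative (\<lambda>h. p x * h$1 + q x * h$2)) (at x)"
    and dp: "\<And>x. x \<in> D \<Longrightarrow> (p has_derivative (\<lambda>h. r x * h$1 + s x * h$2)) (at x)"
    and dq: "\<And>x. x \<in> D \<Longrightarrow> (q has_derivative (\<lambda>h. s x * h$1 + t x * h$2)) (at x)"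
    and cr: "continuous_on D r" and cs: "continuous_on D s" and ct: "continuous_on D t"
    and g: "\<forall>t\<ge>0. (g has_real_derivative g' t) (at t within {0..})"
    and cont_g': "continuous_on {0..} g'"
    and ell: "\<forall>t\<ge>0. 4 * t * (g' t)\<^sup>2 < 1"
    and eq: "\<And>x. x \<in> D \<Longrightarrow> weingarten_defect g (p x) (q x) (r x) (s x) (t x) = 0"
begin

lemma cp: "continuous_on D p" and cq: "continuous_on D q"
  using dp dq by (meson has_derivative_continuous continuous_at_imp_continuous_on)+

text \<open>The difference quotients of \<open>- u\<close> in the second variable solve linear elliptic equations
  whose ellipticity constants do not depend on \<open>h\<close>; only a limit of order zero is
  needed, so no third derivatives of \<open>u\<close> occur.\<close>

lemma difference_quotient_barrier:
  assumes cb: "cball z (2 * R) \<subseteq> D" and R: "0 < R"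
    and sub: "\<And>x. x \<in> D \<Longrightarrow> q x \<le> 0"
    and inside: "\<And>x. dist z x < R \<Longrightarrow> q x < 0"
  obtains \<alpha> \<delta> where "0 < \<alpha>" "0 < \<delta>"
    "\<And>x. R / 2 \<le> dist z x \<Longrightarrow> dist z x \<le> R \<Longrightarrow> \<delta> * (hopf \<alpha> z x - exp (- \<alpha> * R\<^sup>2)) \<le> - q x"
proof -
  define e :: "real^2" where "e = axis 2 1"
  have e12: "e $ 1 = 0" "e $ 2 = 1" by (simp_all add: e_def axis_def)
  have "norm e = 1" by (simp add: e_def norm_eq_1 inner_axis_axis)
  note e = e12 this
  have bnd: "\<exists>B>0. \<forall>x\<in>cball z (2 * R). \<bar>f x\<bar> \<le> B" if "continuous_on D f" for f :: "real^2 \<Rightarrow> real"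
    using compact_bounded_real[OF compact_cball continuous_on_subset[OF that cb]] .
  obtain M1 where M1: "M1 > 0" "\<And>x. x \<in> cball z (2 * R) \<Longrightarrow> \<bar>p x\<bar> \<le> M1"
    using bnd[OF cp] by blast
  obtain M2 where M2: "M2 > 0" "\<And>x. x \<in> cball z (2 * R) \<Longrightarrow> \<bar>q x\<bar> \<le> M2"
    using bnd[OF cq] by blast
  obtain M3 where M3: "M3 > 0" "\<And>x. x \<in> cball z (2 * R) \<Longrightarrow> \<bar>r x\<bar> \<le> M3"
    using bnd[OF cr] by blast
  obtain M4 where M4: "M4 > 0" "\<And>x. x \<in> cball z (2 * R) \<Longrightarrow> \<bar>s x\<bar> \<le> M4"
    using bnd[OF cs] by blast
  obtain M5 where M5: "M5 > 0" "\<And>x. x \<in> cball z (2 * R) \<Longrightarrow> \<bar>t x\<bar> \<le> M5"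
    using bnd[OF ct] by blast
  define M where "M = M1 + M2 + M3 + M4 + M5"
  have M0: "0 \<le> M" and Mge: "M1 \<le> M" "M2 \<le> M" "M3 \<le> M" "M4 \<le> M" "M5 \<le> M"
    using M1(1) M2(1) M3(1) M4(1) M5(1) unfolding M_def by linarith+
  have bM: "\<bar>p x\<bar> \<le> M" "\<bar>q x\<bar> \<le> M" "\<bar>r x\<bar> \<le> M" "\<bar>s x\<bar> \<le> M" "\<bar>t x\<bar> \<le> M" if "x \<in> cball z (2 * R)" for x
    using M1(2)[OF that] M2(2)[OF that] M3(2)[OF that] M4(2)[OF that] M5(2)[OF that] Mge
    by linarith+
  obtain l L where l: "0 < l" and L: "0 < L" and
    lin: "\<And>p0 q0 r0 s0 t0 p1 q1 r1 s1 t1.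
      \<lbrakk>\<bar>p0\<bar> \<le> M; \<bar>q0\<bar> \<le> M; \<bar>r0\<bar> \<le> M; \<bar>s0\<bar> \<le> M; \<bar>t0\<bar> \<le> M;
       \<bar>p1\<bar> \<le> M; \<bar>q1\<bar> \<le> M; \<bar>r1\<bar> \<le> M; \<bar>s1\<bar> \<le> M; \<bar>t1\<bar> \<le> M;
       weingarten_defect g p0 q0 r0 s0 t0 = 0; weingarten_defect g p1 q1 r1 s1 t1 = 0\<rbrakk>
      \<Longrightarrow> \<exists>a11 a12 a22 b1 b2. (\<forall>\<xi> \<eta>. l * (\<xi>\<^sup>2 + \<eta>\<^sup>2) \<le> a11 * \<xi>\<^sup>2 + a12 * \<xi> * \<eta> + a22 * \<eta>\<^sup>2)
         \<and> \<bar>a11\<bar> \<le> L \<and> \<bar>a22\<bar> \<le> L \<and> \<bar>b1\<bar> \<le> L \<and> \<bar>b2\<bar> \<le> L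
         \<and> a11 * (r1 - r0) + a12 * (s1 - s0) + a22 * (t1 - t0) + b1 * (p1 - p0) + b2 * (q1 - q0) = 0"
    using linearized_weingarten[OF g cont_g' ell M0] by blast
  define \<alpha> where "\<alpha> = 2 * (2 * L + 2 * L * R + 1) / (l * R\<^sup>2)"
  have \<alpha>0: "\<alpha> > 0" unfolding \<alpha>_def using l R L
    by (intro divide_pos_pos mult_pos_pos add_pos_pos) auto
  define \<phi> where "\<phi> x = hopf \<alpha> z x - exp (- \<alpha> * R\<^sup>2)" for x
  have hopf_dist: "hopf \<alpha> z x = exp (- \<alpha> * (dist z x)\<^sup>2)" for x
    by (simp add: hopf_def dist_vec2 power2_commute)
  have "hopf \<alpha> z x \<le> 1" for x unfolding hopf_dist using \<alpha>0 by simp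
  then have \<phi>1: "\<phi> x \<le> 1" for x
    unfolding \<phi>_def using exp_gt_zero[of "- \<alpha> * R\<^sup>2"] by (smt (verit))
  have "compact (cball z (3 * R / 4))" "cball z (3 * R / 4) \<noteq> {}" using R by auto
  moreover have "continuous_on (cball z (3 * R / 4)) (\<lambda>x. - q x)"
    by (intro continuous_on_minus continuous_on_subset[OF cq] order_trans[OF _ cb] subset_cball) (use R in auto)
  ultimately obtain x0 where x0: "x0 \<in> cball z (3 * R / 4)" "\<And>x. x \<in> cball z (3 * R / 4) \<Longrightarrow> - q x0 \<le> - q x"
    using continuous_attains_inf by metis
  define \<delta> where "\<delta> = - q x0"
  have "dist z x0 < R" using x0(1) R by simp
  then have \<delta>0: "\<delta> > 0" unfolding \<delta>_def using inside by simp
  define v where "v h x = - (u (x + h *\<^sub>R e) - u x) / h" for h x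
  \<comment> \<open>A difference quotient is a value of -q at an intermediate point and so inherits
    the bounds of -q on both boundary circles.\<close>
  have mv: "\<exists>\<theta>. 0 < \<theta> \<and> \<theta> < h \<and> v h x = - q (x + \<theta> *\<^sub>R e)"
    if h: "0 < h" "h < R / 4" and x: "dist z x \<le> R" for h x
  proof -
    have "((\<lambda>\<tau>. u (x + \<tau> *\<^sub>R e)) has_real_derivative q (x + \<tau> *\<^sub>R e)) (at \<tau>)" if "0 \<le> \<tau>" "\<tau> \<le> h" for \<tau>
    proof -
      have "dist z (x + \<tau> *\<^sub>R e) \<le> dist z x + norm (\<tau> *\<^sub>R e)"
        using dist_triangle[of z "x + \<tau> *\<^sub>R e" x] by (simp add: dist_norm)
      then have "x + \<tau> *\<^sub>R e \<in> D" using cb h x that R e by (auto simp: subset_iff)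
      from DERIV_along_line[OF du[OF this]] show ?thesis by (simp add: e)
    qed
    from MVT2[OF h(1) this] obtain \<theta> where \<theta>: "0 < \<theta>" "\<theta> < h"
      "u (x + h *\<^sub>R e) - u (x + 0 *\<^sub>R e) = (h - 0) * q (x + \<theta> *\<^sub>R e)" by blast
    then show ?thesis using h(1) by (intro exI[of _ \<theta>]) (simp add: v_def)
  qed
  \<comment> \<open>Comparison on the annulus between R / 2 and R. A negative minimum of v -
    \<delta> \<phi> cannot lie on the outer circle, where \<phi> = 0 \<le> v, nor on the inner one,
    where \<delta> \<phi> \<le> \<delta> \<le> v. An interior minimum contradicts the strict sign of
    the linear operator on the barrier.\<close>
  have claim1: "\<delta> * \<phi> x \<le> v h x"
    if h: "0 < h" "h < R / 4" and x: "R / 2 \<le> dist z x" "dist z x \<le> R" for h x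
  proof (rule ccontr)
    assume neg: "\<not> \<delta> * \<phi> x \<le> v h x"
    define \<omega> where "\<omega> x = v h x - \<delta> * \<phi> x" for x
    have shift: "y + \<tau> *\<^sub>R e \<in> cball z (dist z y + \<tau>)" if "0 \<le> \<tau>" for y \<tau>
      using dist_triangle[of z "y + \<tau> *\<^sub>R e" y] that e by (simp add: dist_norm)
    have in2: "y \<in> cball z (2 * R)" "y + h *\<^sub>R e \<in> cball z (2 * R)" if "dist z y \<le> R" for y
      using that h shift[of h y] R by auto
    have inD: "y \<in> D" "y + h *\<^sub>R e \<in> D" if "dist z y \<le> R" for y
      using in2[OF that] cb by blast+
    have sh: "((\<lambda>y. f (y + h *\<^sub>R e)) has_derivative f') (at y)" if "(f has_derivative f') (at (y + h *\<^sub>R e))"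
      for f :: "real^2 \<Rightarrow> real" and f' y
    proof -
      have "((\<lambda>y. y + h *\<^sub>R e) has_derivative (\<lambda>k. k)) (at y)"
        by (auto intro!: derivative_eq_intros)
      from has_derivative_compose[OF this that] show ?thesis .
    qed
    define w1 where "w1 y = - (p (y + h *\<^sub>R e) - p y) / h - \<delta> * (- 2 * \<alpha> * (y$1 - z$1) * hopf \<alpha> z y)" for y
    define w2 where "w2 y = - (q (y + h *\<^sub>R e) - q y) / h - \<delta> * (- 2 * \<alpha> * (y$2 - z$2) * hopf \<alpha> z y)" for y
    define m11 where "m11 y = - (r (y + h *\<^sub>R e) - r y) / h - \<delta> * ((4 * \<alpha>\<^sup>2 * (y$1 - z$1)\<^sup>2 - 2 * \<alpha>) * hopf \<alpha> z y)" for y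
    define m12 where "m12 y = - (s (y + h *\<^sub>R e) - s y) / h - \<delta> * (4 * \<alpha>\<^sup>2 * (y$1 - z$1) * (y$2 - z$2) * hopf \<alpha> z y)" for y
    define m22 where "m22 y = - (t (y + h *\<^sub>R e) - t y) / h - \<delta> * ((4 * \<alpha>\<^sup>2 * (y$2 - z$2)\<^sup>2 - 2 * \<alpha>) * hopf \<alpha> z y)" for y
    have quot: "((\<lambda>x. - (f (x + h *\<^sub>R e) - f x) / h - \<delta> * k x) has_derivative
        (\<lambda>v. - (f2 v - f1 v) / h - \<delta> * k' v)) (at y)"
      if "(f has_derivative f1) (at y)" "(f has_derivative f2) (at (y + h *\<^sub>R e))" "(k has_derivative k') (at y)"
      for f k :: "real^2 \<Rightarrow> real" and f1 f2 k' y
    proof -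
      have qe: "- X / h = - inverse h * X" for X :: real by (simp add: divide_inverse)
      have "((\<lambda>x. - inverse h * (f (x + h *\<^sub>R e) - f x) - \<delta> * k x) has_derivative
        (\<lambda>v. - inverse h * (f2 v - f1 v) - \<delta> * k' v)) (at y)"
        by (intro has_derivative_diff has_derivative_mult_right sh that)
      then show ?thesis unfolding qe .
    qed
    have d\<omega>: "(\<omega> has_derivative (\<lambda>k. w1 y * k$1 + w2 y * k$2)) (at y)" if y: "dist z y \<le> R" for y
    proof -
      have "((\<lambda>x. \<phi> x) has_derivative (\<lambda>k. (- 2 * \<alpha> * (y$1 - z$1) * hopf \<alpha> z y) * k$1
          + (- 2 * \<alpha> * (y$2 - z$2) * hopf \<alpha> z y) * k$2 - 0)) (at y)"
        unfolding \<phi>_def by (intro has_derivative_diff hopf_deriv has_derivative_const)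
      from quot[OF du[OF inD(1)[OF y]] du[OF inD(2)[OF y]] this]
      show ?thesis unfolding \<omega>_def[abs_def] v_def
        by (rule has_derivative_eq_rhs) (use h in \<open>simp add: w1_def w2_def fun_eq_iff divide_simps\<close>,
           simp add: algebra_simps)
    qed
    have dw1: "(w1 has_derivative (\<lambda>k. m11 y * k$1 + m12 y * k$2)) (at y)" if y: "dist z y \<le> R" for y
      using quot[OF dp[OF inD(1)[OF y]] dp[OF inD(2)[OF y]] hopf_deriv_1] unfolding w1_def[abs_def]
      by (rule has_derivative_eq_rhs) (use h in \<open>simp add: m11_def m12_def fun_eq_iff divide_simps\<close>,
           simp add: algebra_simps)
    have dw2: "(w2 has_derivative (\<lambda>k. m12 y * k$1 + m22 y * k$2)) (at y)" if y: "dist z y \<le> R" for y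
      using quot[OF dq[OF inD(1)[OF y]] dq[OF inD(2)[OF y]] hopf_deriv_2] unfolding w2_def[abs_def]
      by (rule has_derivative_eq_rhs) (use h in \<open>simp add: m12_def m22_def fun_eq_iff divide_simps\<close>,
           simp add: algebra_simps)
    define An where "An = cball z R - ball z (R / 2)"
    have "compact An" unfolding An_def by (intro compact_diff) auto
    moreover have "x \<in> An" using x by (simp add: An_def)
    moreover have "continuous_on An \<omega>"
      by (intro continuous_at_imp_continuous_on ballI has_derivative_continuous[OF d\<omega>]) (simp add: An_def)
    ultimately obtain x1 where x1: "x1 \<in> An" "\<And>y. y \<in> An \<Longrightarrow> \<omega> x1 \<le> \<omega> y"
      using continuous_attains_inf by (metis empty_iff)
    have "\<omega> x1 < 0" using x1(2)[OF \<open>x \<in> An\<close>] neg by (simp add: \<omega>_def)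
    have dx1: "R / 2 \<le> dist z x1" "dist z x1 \<le> R" using x1(1) by (auto simp: An_def)
    obtain \<theta> where \<theta>: "0 < \<theta>" "\<theta> < h" "v h x1 = - q (x1 + \<theta> *\<^sub>R e)" using mv[OF h dx1(2)] by blast
    have "dist z x1 \<noteq> R"
    proof
      assume "dist z x1 = R"
      then have "\<phi> x1 = 0" by (simp add: \<phi>_def hopf_dist)
      moreover have "x1 + \<theta> *\<^sub>R e \<in> D" using shift[of \<theta> x1] \<theta> h dx1 cb by (auto simp: subset_iff)
      ultimately show False using sub \<theta>(3) \<open>\<omega> x1 < 0\<close> by (fastforce simp: \<omega>_def)
    qed
    moreover have "dist z x1 \<noteq> R / 2"
    proof
      assume *: "dist z x1 = R / 2"
      have "x1 + \<theta> *\<^sub>R e \<in> cball z (3 * R / 4)" using shift[of \<theta> x1] \<theta> h * by auto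
      then have "\<delta> \<le> v h x1" using x0(2) \<theta>(3) by (simp add: \<delta>_def)
      moreover have "\<delta> * \<phi> x1 \<le> \<delta> * 1" using \<phi>1 \<delta>0 by (intro mult_left_mono) auto
      ultimately show False using \<open>\<omega> x1 < 0\<close> by (simp add: \<omega>_def)
    qed
    ultimately have strict: "R / 2 < dist z x1" "dist z x1 < R" using dx1 by auto
    define U where "U = ball z R - cball z (R / 2)"
    have U: "open U" "x1 \<in> U" "U \<subseteq> An" "\<And>y. y \<in> U \<Longrightarrow> dist z y \<le> R"
      using strict unfolding U_def An_def by (auto intro: open_Diff)
    note hess = local_min_hessian[OF U(1,2) d\<omega>[OF U(4)] dw1[OF dx1(2)] dw2[OF dx1(2)] x1(2)[OF subsetD[OF U(3)]]]
    obtain a11 a12 a22 b1 b2 where a: "\<And>\<xi> \<eta>. l * (\<xi>\<^sup>2 + \<eta>\<^sup>2) \<le> a11 * \<xi>\<^sup>2 + a12 * \<xi> * \<eta> + a22 * \<eta>\<^sup>2"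
      and aL: "\<bar>a11\<bar> \<le> L" "\<bar>a22\<bar> \<le> L" "\<bar>b1\<bar> \<le> L" "\<bar>b2\<bar> \<le> L"
      and zero: "a11 * (r (x1 + h *\<^sub>R e) - r x1) + a12 * (s (x1 + h *\<^sub>R e) - s x1) + a22 * (t (x1 + h *\<^sub>R e) - t x1)
         + b1 * (p (x1 + h *\<^sub>R e) - p x1) + b2 * (q (x1 + h *\<^sub>R e) - q x1) = 0"
      using lin[OF bM[OF in2(1)[OF dx1(2)]] bM[OF in2(2)[OF dx1(2)]] eq[OF inD(1)[OF dx1(2)]] eq[OF inD(2)[OF dx1(2)]]]
      by blast
    have tr: "0 \<le> a11 * m11 x1 + a12 * m12 x1 + a22 * m22 x1"
    proof (rule trace_product_nonneg[OF a l])
      show "0 \<le> m11 x1 * \<xi>\<^sup>2 + 2 * m12 x1 * \<xi> * \<eta> + m22 x1 * \<eta>\<^sup>2" for \<xi> \<eta>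
        using hess(3)[of \<xi> \<eta>] by (simp add: algebra_simps)
    qed
    define y1 y2 where "y1 = x1$1 - z$1" and "y2 = x1$2 - z$2"
    have y12: "(dist z x1)\<^sup>2 = y1\<^sup>2 + y2\<^sup>2" by (simp add: dist_commute[of z] dist_vec2 y1_def y2_def)
    have "(R / 2)\<^sup>2 \<le> y1\<^sup>2 + y2\<^sup>2" "y1\<^sup>2 + y2\<^sup>2 \<le> R\<^sup>2"
      unfolding y12[symmetric] using dx1 R by (auto intro: power_mono)
    note hs = hopf_subsolution[OF a l aL R this \<alpha>_def]
    define E where "E = hopf \<alpha> z x1"
    have E: "E > 0" by (simp add: E_def hopf_def)
    define S where "S = a11 * (4 * \<alpha>\<^sup>2 * y1\<^sup>2 - 2 * \<alpha>) + a12 * (4 * \<alpha>\<^sup>2 * y1 * y2) + a22 * (4 * \<alpha>\<^sup>2 * y2\<^sup>2 - 2 * \<alpha>)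
      + b1 * (- 2 * \<alpha> * y1) + b2 * (- 2 * \<alpha> * y2)"
    \<comment> \<open>The operator annihilates the difference quotient by \<open>zero\<close>, which
      leaves the negative contribution of the barrier. At a minimum, however, the first derivatives
      vanish and the second-order part is nonnegative by \<open>tr\<close>.\<close>
    have "a11 * m11 x1 + a12 * m12 x1 + a22 * m22 x1 + b1 * w1 x1 + b2 * w2 x1
       = - (a11 * (r (x1 + h *\<^sub>R e) - r x1) + a12 * (s (x1 + h *\<^sub>R e) - s x1) + a22 * (t (x1 + h *\<^sub>R e) - t x1)
         + b1 * (p (x1 + h *\<^sub>R e) - p x1) + b2 * (q (x1 + h *\<^sub>R e) - q x1)) / h - \<delta> * E * S"
      unfolding m11_def m12_def m22_def w1_def w2_def S_def E_def[symmetric] y1_def[symmetric] y2_def[symmetric]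
      using h(1) by (simp add: field_simps)
    also have "\<dots> = - (\<delta> * E * S)" unfolding zero by simp
    also have "\<dots> < 0" using \<delta>0 E hs by (simp add: S_def)
    finally show False using tr hess(1,2) by simp
  qed
  show ?thesis
  proof (rule that[OF \<alpha>0 \<delta>0])
    fix x assume x: "R / 2 \<le> dist z x" "dist z x \<le> R"
    have xD: "x \<in> D" using x(2) cb R by auto
    have "((\<lambda>\<tau>. u (x + \<tau> *\<^sub>R e)) has_real_derivative q x) (at 0)"
      using DERIV_along_line[of u _ x 0 e] du[OF xD] by (fastforce simp: e)
    then have "((\<lambda>h. (u (x + h *\<^sub>R e) - u x) / h) \<longlongrightarrow> q x) (at 0)"
      by (simp add: DERIV_def)
    then have "((\<lambda>h. (u (x + h *\<^sub>R e) - u x) / h) \<longlongrightarrow> q x) (at_right 0)"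
      by (rule tendsto_within_subset) simp
    from tendsto_minus[OF this] have lim: "((\<lambda>h. v h x) \<longlongrightarrow> - q x) (at_right 0)"
      by (simp only: v_def minus_divide_left)
    \<comment> \<open>Neither \<alpha> nor \<delta> depends on h, so the bound passes to the limit
      as h decreases to 0.\<close>
    have "eventually (\<lambda>h. \<delta> * \<phi> x \<le> v h x) (at_right 0)"
      unfolding eventually_at_right_field using claim1 x R by (intro exI[of _ "R / 4"]) auto
    from tendsto_lowerbound[OF lim this] show "\<delta> * (hopf \<alpha> z x - exp (- \<alpha> * R\<^sup>2)) \<le> - q x"
      by (simp add: \<phi>_def trivial_limit_at_right_real)
  qed
qed

text \<open>Hopf's argument at a zero \<open>y\<close> of q nearest to \<open>x\<close>: the ball
  around \<open>x\<close> through \<open>y\<close> contains no zero inside. At \<open>y\<close> the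
  maximum of q forces a vanishing slope, whereas the barrier below -q has a strictly positive slope
  towards \<open>x\<close>. The factor 4 leaves room for the ball of twice the radius on which the
  barrier is built.\<close>

lemma strong_maximum_principle:
  assumes sub: "\<And>x. x \<in> D \<Longrightarrow> q x \<le> 0"
    and ball: "cball x0 (4 * \<rho>) \<subseteq> D" and \<rho>: "0 < \<rho>" and zero: "q x0 = 0" and x: "dist x0 x < \<rho>"
  shows "q x = 0"
proof (rule ccontr)
  assume "q x \<noteq> 0"
  \<comment> \<open>Restricting the zeros to a closed ball inside \<open>D\<close> makes
    \<open>Z\<close> closed. Points closer to \<open>x\<close> than \<open>R\<close> still lie in
    this ball, so none of them can be a zero.\<close>
  define Z where "Z = {y \<in> cball x0 (2 * \<rho>). q y = 0}"
  have "cball x0 (2 * \<rho>) \<subseteq> D" using ball \<rho> by (auto simp: subset_iff)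
  then have "closed Z" unfolding Z_def
    by (intro continuous_closed_preimage_constant continuous_on_subset[OF cq]) auto
  moreover have "x0 \<in> Z" using zero \<rho> by (simp add: Z_def)
  ultimately obtain y where y: "y \<in> Z" "\<And>w. w \<in> Z \<Longrightarrow> dist x y \<le> dist x w"
    using distance_attains_inf[of Z x] by blast
  define R where "R = dist x y"
  have "R \<le> dist x x0" unfolding R_def by (rule y(2)) fact
  then have R\<rho>: "R < \<rho>" using x by (simp add: dist_commute)
  have R: "0 < R" using y(1) \<open>q x \<noteq> 0\<close> by (auto simp: R_def Z_def)
  have far: "dist x0 w \<le> 3 * \<rho>" if "dist x w \<le> 2 * R" for w
    using dist_triangle[of x0 w x] that x R\<rho> by linarith
  have cb: "cball x (2 * R) \<subseteq> D" using far ball \<rho> by (force simp: subset_iff)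
  have inside: "q w < 0" if w: "dist x w < R" for w
  proof -
    have "dist x0 w \<le> 2 * \<rho>" using dist_triangle[of x0 w x] w x R\<rho> by linarith
    then have "q w \<noteq> 0" using y(2)[of w] w by (auto simp: Z_def R_def)
    moreover have "w \<in> D" using cb w R by auto
    ultimately show ?thesis using sub by (simp add: less_le)
  qed
  obtain \<alpha> \<delta> where \<alpha>: "0 < \<alpha>" and \<delta>: "0 < \<delta>" and
    low: "\<And>w. R / 2 \<le> dist x w \<Longrightarrow> dist x w \<le> R \<Longrightarrow> \<delta> * (hopf \<alpha> x w - exp (- \<alpha> * R\<^sup>2)) \<le> - q w"
    using difference_quotient_barrier[OF cb R sub inside] by blast
  have yD: "y \<in> D" and qy: "q y = 0" using y(1) cb R by (auto simp: Z_def R_def)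
  have D0: "(\<lambda>h::real^2. s y * h$1 + t y * h$2) = (\<lambda>h. 0)"
    by (rule differential_zero_maxmin[OF yD open_D dq[OF yD]]) (use sub qy in auto)
  \<comment> \<open>The inward direction at the touching point; the barrier grows along it at the
    rate 2 \<alpha> R^2 exp (-\<alpha> R^2).\<close>
  define v where "v = x - y"
  have d1: "((\<lambda>\<tau>. q (y + \<tau> *\<^sub>R v)) has_real_derivative 0) (at 0)"
    using DERIV_along_line[of q "\<lambda>h. s y * h$1 + t y * h$2" y 0 v] dq[OF yD] fun_cong[OF D0, of v] by simp
  have hy: "hopf \<alpha> x y = exp (- \<alpha> * R\<^sup>2)"
    by (simp add: hopf_def R_def dist_commute[of x] dist_vec2)
  have "((\<lambda>\<tau>. hopf \<alpha> x (y + \<tau> *\<^sub>R v)) has_real_derivative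
      (- 2 * \<alpha> * (y$1 - x$1) * hopf \<alpha> x y) * v$1 + (- 2 * \<alpha> * (y$2 - x$2) * hopf \<alpha> x y) * v$2) (at 0)"
    using DERIV_along_line[of "hopf \<alpha> x" _ y 0 v] hopf_deriv[of \<alpha> x y] by fastforce
  also have "(- 2 * \<alpha> * (y$1 - x$1) * hopf \<alpha> x y) * v$1 + (- 2 * \<alpha> * (y$2 - x$2) * hopf \<alpha> x y) * v$2
      = 2 * \<alpha> * R\<^sup>2 * exp (- \<alpha> * R\<^sup>2)"
  proof -
    define E where "E = exp (- \<alpha> * R\<^sup>2)"
    have R2: "R\<^sup>2 = (y$1 - x$1)\<^sup>2 + (y$2 - x$2)\<^sup>2"
      by (simp add: R_def dist_commute[of x] dist_vec2)
    show ?thesis unfolding hy E_def[symmetric]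
      by (simp only: R2) (simp add: v_def algebra_simps power2_eq_square)
  qed
  finally have d2: "((\<lambda>\<tau>. hopf \<alpha> x (y + \<tau> *\<^sub>R v)) has_real_derivative 2 * \<alpha> * R\<^sup>2 * exp (- \<alpha> * R\<^sup>2)) (at 0)" .
  define k where "k \<tau> = - q (y + \<tau> *\<^sub>R v) - \<delta> * (hopf \<alpha> x (y + \<tau> *\<^sub>R v) - exp (- \<alpha> * R\<^sup>2))" for \<tau>
  have dk: "(k has_real_derivative - (\<delta> * (2 * \<alpha> * R\<^sup>2 * exp (- \<alpha> * R\<^sup>2)))) (at 0)"
    unfolding k_def[abs_def]
    by (rule DERIV_cong, (rule derivative_intros d1 d2)+) simp
  have "- (\<delta> * (2 * \<alpha> * R\<^sup>2 * exp (- \<alpha> * R\<^sup>2))) < 0" using \<delta> \<alpha> R by simp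
  from DERIV_neg_dec_right[OF dk this] obtain d where d: "d > 0" "\<And>h. 0 < h \<Longrightarrow> h < d \<Longrightarrow> k h < k 0"
    by auto
  \<comment> \<open>The bound 1 / 2 keeps the point within the annulus R / 2 \<le> dist \<le> R
    where the barrier estimate is available.\<close>
  define h where "h = min (d / 2) (1 / 2)"
  have h: "0 < h" "h < d" "h \<le> 1 / 2" using d(1) by (auto simp: h_def)
  have "k 0 = 0" by (simp add: k_def qy hy)
  moreover have "x - (y + h *\<^sub>R v) = (1 - h) *\<^sub>R (x - y)" by (simp add: v_def algebra_simps)
  then have dh: "dist x (y + h *\<^sub>R v) = (1 - h) * R" using h by (simp add: dist_norm R_def)
  have "R / 2 \<le> (1 - h) * R" "(1 - h) * R \<le> R"
    using h R by (simp_all add: field_simps)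
  with low[of "y + h *\<^sub>R v"] have "0 \<le> k h" unfolding dh by (simp add: k_def)
  ultimately show False using d(2)[OF h(1,2)] by linarith
qed

end

section \<open>Tools: mixed partials, eigenvalues of a matrix, distance to a line, uniqueness of
  c\<close>

lemma mixed_partials:
  fixes u p q r s s' t :: "real^2 \<Rightarrow> real"
  assumes D: "open D" "x \<in> D"
    and du: "\<And>x. x \<in> D \<Longrightarrow> (u has_derivative (\<lambda>h. p x * h$1 + q x * h$2)) (at x)"
    and dp: "\<And>x. x \<in> D \<Longrightarrow> (p has_derivative (\<lambda>h. r x * h$1 + s x * h$2)) (at x)"
    and dq: "\<And>x. x \<in> D \<Longrightarrow> (q has_derivative (\<lambda>h. s' x * h$1 + t x * h$2)) (at x)"
    and cs: "continuous_on D s" and cs': "continuous_on D s'"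
  shows "s x = s' x"
proof (rule ccontr)
  assume ne: "s x \<noteq> s' x"
  define \<epsilon> where "\<epsilon> = \<bar>s x - s' x\<bar> / 2"
  have \<epsilon>: "\<epsilon> > 0" using ne by (simp add: \<epsilon>_def)
  have "isCont s x" "isCont s' x"
    using cs cs' D by (auto simp: continuous_on_eq_continuous_at)
  then obtain d1 d2 where d1: "d1 > 0" "\<And>y. dist y x < d1 \<Longrightarrow> dist (s y) (s x) < \<epsilon>"
    and d2: "d2 > 0" "\<And>y. dist y x < d2 \<Longrightarrow> dist (s' y) (s' x) < \<epsilon>"
    using \<epsilon> unfolding continuous_at_eps_delta by (metis dist_norm real_norm_def)
  obtain d3 where d3: "d3 > 0" "ball x d3 \<subseteq> D" using D open_contains_ball by blast
  define e1 e2 :: "real^2" where "e1 = axis 1 1" and "e2 = axis 2 1"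
  have e: "e1$1 = 1" "e1$2 = 0" "e2$1 = 0" "e2$2 = 1" by (simp_all add: e1_def e2_def axis_def)
  have ne: "norm e1 = 1" "norm e2 = 1"
    by (simp_all add: e1_def e2_def norm_eq_1 inner_axis_axis)
  define h where "h = min d1 (min d2 d3) / 3"
  have h: "0 < h" "2 * h < d1" "2 * h < d2" "2 * h < d3" using d1(1) d2(1) d3(1) by (auto simp: h_def)
  have near: "dist (x + \<tau> *\<^sub>R e1 + \<sigma> *\<^sub>R e2) x \<le> 2 * h" if "0 \<le> \<tau>" "\<tau> \<le> h" "0 \<le> \<sigma>" "\<sigma> \<le> h" for \<tau> \<sigma>
    using norm_triangle_ineq[of "\<tau> *\<^sub>R e1" "\<sigma> *\<^sub>R e2"] that by (simp add: dist_norm ne)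
  have inD: "x + \<tau> *\<^sub>R e1 + \<sigma> *\<^sub>R e2 \<in> D" if "0 \<le> \<tau>" "\<tau> \<le> h" "0 \<le> \<sigma>" "\<sigma> \<le> h" for \<tau> \<sigma>
    using near[OF that] h(4) d3(2) by (auto simp: dist_commute subset_iff)
  define U where "U \<tau> \<sigma> = u (x + \<tau> *\<^sub>R e1 + \<sigma> *\<^sub>R e2)" for \<tau> \<sigma>
  define P where "P \<tau> \<sigma> = p (x + \<tau> *\<^sub>R e1 + \<sigma> *\<^sub>R e2)" for \<tau> \<sigma>
  define Q where "Q \<tau> \<sigma> = q (x + \<tau> *\<^sub>R e1 + \<sigma> *\<^sub>R e2)" for \<tau> \<sigma>
  define S where "S \<tau> \<sigma> = s (x + \<tau> *\<^sub>R e1 + \<sigma> *\<^sub>R e2)" for \<tau> \<sigma>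
  define S' where "S' \<tau> \<sigma> = s' (x + \<tau> *\<^sub>R e1 + \<sigma> *\<^sub>R e2)" for \<tau> \<sigma>
  have swap: "x + \<tau> *\<^sub>R e1 + \<sigma> *\<^sub>R e2 = x + \<sigma> *\<^sub>R e2 + \<tau> *\<^sub>R e1" for \<tau> \<sigma> by simp
  have U1: "((\<lambda>\<tau>. U \<tau> \<sigma>) has_real_derivative P \<tau> \<sigma>) (at \<tau>)"
    and Q1: "((\<lambda>\<tau>. Q \<tau> \<sigma>) has_real_derivative S' \<tau> \<sigma>) (at \<tau>)"
    if "0 \<le> \<tau>" "\<tau> \<le> h" "0 \<le> \<sigma>" "\<sigma> \<le> h" for \<tau> \<sigma>
    using DERIV_along_line[OF du[OF inD[OF that, unfolded swap]]]
      DERIV_along_line[OF dq[OF inD[OF that, unfolded swap]]]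
    unfolding U_def P_def Q_def S'_def swap by (simp_all add: e)
  have U2: "((\<lambda>\<sigma>. U \<tau> \<sigma>) has_real_derivative Q \<tau> \<sigma>) (at \<sigma>)"
    and P2: "((\<lambda>\<sigma>. P \<tau> \<sigma>) has_real_derivative S \<tau> \<sigma>) (at \<sigma>)"
    if "0 \<le> \<tau>" "\<tau> \<le> h" "0 \<le> \<sigma>" "\<sigma> \<le> h" for \<tau> \<sigma>
    using DERIV_along_line[OF du[OF inD[OF that]]] DERIV_along_line[OF dp[OF inD[OF that]]]
    unfolding U_def P_def Q_def S_def by (simp_all add: e)
  \<comment> \<open>The alternating sum over the corners of a square of side h is evaluated in both
    orders by the mean value theorem: it is h^2 times a value of \<open>s\<close> and also h^2 times
    a value of \<open>s'\<close>, both taken near \<open>x\<close>.\<close>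
  have "\<exists>\<tau>>0. \<tau> < h \<and> (U h h - U h 0) - (U 0 h - U 0 0) = (h - 0) * (P \<tau> h - P \<tau> 0)"
    using h(1) by (rule MVT2[where f = "\<lambda>\<tau>. U \<tau> h - U \<tau> 0"]) (use h(1) in \<open>auto intro!: DERIV_diff U1\<close>)
  then obtain \<tau> where \<tau>: "0 < \<tau>" "\<tau> < h" "(U h h - U h 0) - (U 0 h - U 0 0) = h * (P \<tau> h - P \<tau> 0)"
    by auto
  have "\<exists>\<sigma>>0. \<sigma> < h \<and> P \<tau> h - P \<tau> 0 = (h - 0) * S \<tau> \<sigma>"
    using h(1) by (rule MVT2[where f = "\<lambda>\<sigma>. P \<tau> \<sigma>"]) (use \<tau> in \<open>auto intro!: P2\<close>)
  then obtain \<sigma> where \<sigma>: "0 < \<sigma>" "\<sigma> < h" "P \<tau> h - P \<tau> 0 = h * S \<tau> \<sigma>" by auto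
  have "\<exists>\<sigma>>0. \<sigma> < h \<and> (U h h - U 0 h) - (U h 0 - U 0 0) = (h - 0) * (Q h \<sigma> - Q 0 \<sigma>)"
    using h(1) by (rule MVT2[where f = "\<lambda>\<sigma>. U h \<sigma> - U 0 \<sigma>"]) (use h(1) in \<open>auto intro!: DERIV_diff U2\<close>)
  then obtain \<sigma>' where \<sigma>': "0 < \<sigma>'" "\<sigma>' < h" "(U h h - U 0 h) - (U h 0 - U 0 0) = h * (Q h \<sigma>' - Q 0 \<sigma>')"
    by auto
  have "\<exists>\<tau>>0. \<tau> < h \<and> Q h \<sigma>' - Q 0 \<sigma>' = (h - 0) * S' \<tau> \<sigma>'"
    using h(1) by (rule MVT2[where f = "\<lambda>\<tau>. Q \<tau> \<sigma>'"]) (use \<sigma>' in \<open>auto intro!: Q1\<close>)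
  then obtain \<tau>' where \<tau>': "0 < \<tau>'" "\<tau>' < h" "Q h \<sigma>' - Q 0 \<sigma>' = h * S' \<tau>' \<sigma>'" by auto
  have "h * (h * S \<tau> \<sigma>) = h * (h * S' \<tau>' \<sigma>')"
    unfolding \<sigma>(3)[symmetric] \<tau>'(3)[symmetric] \<tau>(3)[symmetric] \<sigma>'(3)[symmetric] by simp
  then have SS: "S \<tau> \<sigma> = S' \<tau>' \<sigma>'" using h(1) by simp
  have "dist (S \<tau> \<sigma>) (s x) < \<epsilon>" unfolding S_def
    by (rule d1(2)) (use near[of \<tau> \<sigma>] \<tau> \<sigma> h in linarith)
  moreover have "dist (S' \<tau>' \<sigma>') (s' x) < \<epsilon>" unfolding S'_def
    by (rule d2(2)) (use near[of \<tau>' \<sigma>'] \<tau>' \<sigma>' h in linarith)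
  ultimately show False
    using dist_triangle3[of "s x" "s' x" "S' \<tau>' \<sigma>'"] unfolding SS \<epsilon>_def
    by (simp add: dist_real_def[of "s x"])
qed

text \<open>The shape operator in graph coordinates is not a symmetric matrix, so reality of the
  eigenvalues enters as the sign of the discriminant. At a double root the set is a singleton and
  Min and Max both return it, which is the multiplicity that trace and determinant need.\<close>

lemma eigenvalues_2x2:
  fixes a b c d :: real
  defines "S \<equiv> {\<kappa>. \<exists>v::real^2. v \<noteq> 0 \<and> a * v$1 + b * v$2 = \<kappa> * v$1 \<and> c * v$1 + d * v$2 = \<kappa> * v$2}"
  assumes disc: "0 \<le> (a + d)\<^sup>2 - 4 * (a * d - b * c)"
  shows "Min S + Max S = a + d" "Min S * Max S = a * d - b * c"
proof -
  have vec_nz: "v \<noteq> 0 \<longleftrightarrow> v$1 \<noteq> 0 \<or> v$2 \<noteq> 0" for v :: "real^2"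
    by (auto simp: vec_eq_iff forall_2)
  define w where "w = sqrt ((a + d)\<^sup>2 - 4 * (a * d - b * c))"
  have w: "w\<^sup>2 = (a + d)\<^sup>2 - 4 * (a * d - b * c)" "0 \<le> w" using disc by (simp_all add: w_def)
  have root: "\<kappa> \<in> S \<longleftrightarrow> (a - \<kappa>) * (d - \<kappa>) - b * c = 0" for \<kappa>
  proof
    assume "\<kappa> \<in> S"
    then obtain v :: "real^2" where v: "v \<noteq> 0" "(a - \<kappa>) * v$1 + b * v$2 = 0" "c * v$1 + (d - \<kappa>) * v$2 = 0"
      unfolding S_def by (auto simp: algebra_simps)
    have "((a - \<kappa>) * (d - \<kappa>) - b * c) * v$1 = 0" "((a - \<kappa>) * (d - \<kappa>) - b * c) * v$2 = 0"
      using v(2,3) by algebra+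
    then show "(a - \<kappa>) * (d - \<kappa>) - b * c = 0" using v(1) vec_nz by auto
  next
    assume *: "(a - \<kappa>) * (d - \<kappa>) - b * c = 0"
    \<comment> \<open>For a root \<kappa>, (b, \<kappa> - a) and (\<kappa> - d, c) both solve the
      eigenvector equations; they vanish together only for \<kappa> times the identity, where every
      nonzero vector serves.\<close>
    consider "b \<noteq> 0 \<or> \<kappa> - a \<noteq> 0" | "\<kappa> - d \<noteq> 0 \<or> c \<noteq> 0" | "b = 0" "\<kappa> = a" "\<kappa> = d" "c = 0" by auto
    then show "\<kappa> \<in> S"
    proof cases
      case 1
      then show ?thesis unfolding S_def using *
        by (intro CollectI exI[of _ "vector [b, \<kappa> - a]"]) (simp add: vec_nz algebra_simps)
    next
      case 2
      then show ?thesis unfolding S_def using *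
        by (intro CollectI exI[of _ "vector [\<kappa> - d, c]"]) (simp add: vec_nz algebra_simps)
    next
      case 3
      then show ?thesis unfolding S_def
        by (intro CollectI exI[of _ "vector [1, 0]"]) (simp add: vec_nz)
    qed
  qed
  have "(a - \<kappa>) * (d - \<kappa>) - b * c = (\<kappa> - (a + d - w) / 2) * (\<kappa> - (a + d + w) / 2)" for \<kappa>
  proof -
    have "(\<kappa> - (a + d - w) / 2) * (\<kappa> - (a + d + w) / 2) = \<kappa>\<^sup>2 - (a + d) * \<kappa> + ((a + d)\<^sup>2 - w\<^sup>2) / 4"
      by (simp add: field_simps power2_eq_square)
    also have "((a + d)\<^sup>2 - w\<^sup>2) / 4 = a * d - b * c" unfolding w(1) by simp
    finally show ?thesis by (simp add: algebra_simps power2_eq_square)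
  qed
  then have "S = {(a + d - w) / 2, (a + d + w) / 2}" using root by auto
  then have mm: "Min S = (a + d - w) / 2" "Max S = (a + d + w) / 2" using w(2) by auto
  show "Min S + Max S = a + d" unfolding mm by (simp add: field_simps)
  have "Min S * Max S = ((a + d)\<^sup>2 - w\<^sup>2) / 4" unfolding mm by (simp add: field_simps power2_eq_square)
  then show "Min S * Max S = a * d - b * c" unfolding w(1) by simp
qed

text \<open>Pythagoras: the foot of the perpendicular is a nearest point of the line. This turns the
  description of a cylinder by distance into a norm of a projection.\<close>

lemma infdist_line:
  fixes x q d :: "'a::euclidean_space"
  assumes d: "norm d = 1"
  shows "infdist x {q + t *\<^sub>R d |t. True} = norm ((x - q) - ((x - q) \<bullet> d) *\<^sub>R d)"
proof -
  define L where "L = {q + t *\<^sub>R d |t. True}"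
  define y where "y = q + ((x - q) \<bullet> d) *\<^sub>R d"
  have yL: "y \<in> L" by (auto simp: L_def y_def)
  have dy: "dist x y = norm ((x - q) - ((x - q) \<bullet> d) *\<^sub>R d)"
    by (simp add: dist_norm y_def algebra_simps)
  have dd: "d \<bullet> d = 1" using d by (simp add: norm_eq_1)
  have "dist x y \<le> dist x w" if wL: "w \<in> L" for w
  proof -
    obtain t where w: "w = q + t *\<^sub>R d" using wL unfolding L_def by blast
    define z where "z = (x - q) - ((x - q) \<bullet> d) *\<^sub>R d"
    have zd: "z \<bullet> d = 0" by (simp add: z_def inner_diff_left dd)
    have "x - w = z + ((x - q) \<bullet> d - t) *\<^sub>R d" by (simp add: z_def w algebra_simps)
    moreover have "(norm (z + k *\<^sub>R d))\<^sup>2 = (norm z)\<^sup>2 + k\<^sup>2" for k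
      unfolding power2_norm_eq_inner
      by (simp add: inner_add_left inner_add_right inner_commute[of d z] zd dd power2_eq_square)
    ultimately have "(norm (x - w))\<^sup>2 = (norm z)\<^sup>2 + ((x - q) \<bullet> d - t)\<^sup>2" by simp
    then have "norm z \<le> norm (x - w)" by (metis le_add_same_cancel1 norm_ge_zero power2_le_imp_le zero_le_power2)
    then show ?thesis unfolding dy z_def[symmetric] dist_norm[of x w] .
  qed
  moreover have "L \<noteq> {}" using yL by auto
  ultimately have "dist x y \<le> infdist x L" by (simp add: infdist_notempty cINF_greatest)
  moreover have "infdist x L \<le> dist x y" by (rule infdist_le[OF yL])
  ultimately show ?thesis using dy L_def by simp
qed

text \<open>The derivative of z - g (z^2) is 1 - 2 z g'(z^2), and the square of the subtracted term
  is 4 t g'(t)^2 < 1 with t = z^2, so the function is strictly increasing. When K = 0 the Weingarten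
  relation is exactly H = g (H^2), so H is determined.\<close>

lemma elliptic_square_inj:
  assumes g: "\<forall>t\<ge>0. (g has_real_derivative g' t) (at t within {0..})"
    and ell: "\<forall>t\<ge>0. 4 * t * (g' t)\<^sup>2 < 1"
    and x: "x = g (x\<^sup>2)" and y: "y = g (y\<^sup>2)"
  shows "x = (y::real)"
proof -
  define k where "k z = z - g (z\<^sup>2)" for z
  have dk: "(k has_real_derivative 1 - g' (z\<^sup>2) * (2 * z)) (at z)" for z
  proof -
    have d2: "((\<lambda>z. z\<^sup>2) has_real_derivative 2 * z) (at z)" by (auto intro!: derivative_eq_intros)
    have "(g has_real_derivative g' (z\<^sup>2)) (at (z\<^sup>2) within range (\<lambda>z. z\<^sup>2))"
      by (rule DERIV_subset[of g _ _ "{0..}"]) (use g in auto)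
    from DERIV_image_chain[OF this d2] have "((\<lambda>z. g (z\<^sup>2)) has_real_derivative g' (z\<^sup>2) * (2 * z)) (at z)"
      by (simp add: o_def)
    from DERIV_diff[OF DERIV_ident this] show ?thesis unfolding k_def[abs_def] .
  qed
  have pos: "0 < 1 - g' (z\<^sup>2) * (2 * z)" for z
  proof -
    have "(g' (z\<^sup>2) * (2 * z))\<^sup>2 = 4 * z\<^sup>2 * (g' (z\<^sup>2))\<^sup>2" by (simp add: power_mult_distrib)
    also have "\<dots> < 1" using ell by simp
    finally have "\<bar>g' (z\<^sup>2) * (2 * z)\<bar> < 1" by (simp add: abs_square_less_1)
    then show ?thesis by linarith
  qed
  have "k v < k w" if "v < w" for v w
    using DERIV_pos_imp_increasing[OF that, of k] dk pos by blast
  moreover have "k x = 0" "k y = 0" using x y by (simp_all add: k_def)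
  ultimately show ?thesis by (metis less_irrefl linorder_neqE_linordered_idom)
qed

section \<open>Local graphs over the tangent plane\<close>

lemma real2_basis_expansion: "v = v$1 *\<^sub>R axis 1 1 + v$2 *\<^sub>R axis 2 1" for v :: "real^2"
  by (simp add: vec_eq_iff forall_2 axis_def)

lemma bounded_bilinear_cross3: "bounded_bilinear cross3"
  by (simp add: bilinear_cross flip: bilinear_conv_bounded_bilinear)

lemma cross3_linear_combination:
  "cross3 (a *\<^sub>R x + b *\<^sub>R y) (c *\<^sub>R x + d *\<^sub>R y) = (a * d - b * c) *\<^sub>R cross3 x y"
  by (simp add: cross3_simps)

text \<open>The order of the factors makes (e, a, n) positively oriented. With \<open>e\<close> as
  first and \<open>a\<close> as second coordinate direction, q becomes the slope in the direction
  \<open>a\<close> and the graph normal agrees in sign with N.\<close>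

lemma orthonormal_cross_expansion:
  fixes a n y :: "real^3"
  assumes a: "norm a = 1" and n: "norm n = 1" and an: "a \<bullet> n = 0"
  defines "e \<equiv> cross3 a n"
  shows "norm e = 1" "e \<bullet> a = 0" "e \<bullet> n = 0" "cross3 e a = n"
    "y = (y \<bullet> e) *\<^sub>R e + (y \<bullet> a) *\<^sub>R a + (y \<bullet> n) *\<^sub>R n"
proof -
  have aa: "a \<bullet> a = 1" "n \<bullet> n = 1" using a n by (simp_all add: norm_eq_1)
  show ea: "e \<bullet> a = 0" and en: "e \<bullet> n = 0" unfolding e_def by (simp_all add: dot_cross_self)
  have "(norm e)\<^sup>2 = 1" using norm_cross_dot[of a n] a n an by (simp add: e_def)
  then show ne: "norm e = 1" using real_sqrt_unique[of "norm e" 1] by simp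
  then have ee: "e \<bullet> e = 1" by (simp add: norm_eq_1)
  have "cross3 e a = - cross3 a (cross3 a n)" unfolding e_def by (rule cross_skew)
  then show ean: "cross3 e a = n" by (simp add: Lagrange an aa)
  define d where "d = y - ((y \<bullet> e) *\<^sub>R e + (y \<bullet> a) *\<^sub>R a + (y \<bullet> n) *\<^sub>R n)"
  have d: "d \<bullet> e = 0" "d \<bullet> a = 0" "d \<bullet> n = 0"
    unfolding d_def inner_diff_left inner_add_left inner_scaleR_left
    using ea en an by (simp_all add: ee aa inner_commute[of a e] inner_commute[of n e] inner_commute[of n a])
  \<comment> \<open>A remainder orthogonal to e, a and n has zero cross product and zero inner
    product with the unit vector n, hence vanishes.\<close>
  have "cross3 d n = cross3 d (cross3 e a)" by (simp add: ean)
  also have "\<dots> = 0" by (simp add: Lagrange d)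
  finally have "d = 0" using norm_cross_dot[of d n] d(3) n by simp
  then show "y = (y \<bullet> e) *\<^sub>R e + (y \<bullet> a) *\<^sub>R a + (y \<bullet> n) *\<^sub>R n" by (simp add: d_def)
qed

text \<open>An immersion read in one chart. Derivatives are bounded linear maps as values, so that
  continuity of the second derivative and the inverse function theorem can be stated for
  them.\<close>

locale surface_patch =
  fixes U :: "(real^2) set" and f :: "real^2 \<Rightarrow> real^3"
    and f' :: "real^2 \<Rightarrow> ((real^2) \<Rightarrow>\<^sub>L (real^3))" and f'' :: "real^2 \<Rightarrow> ((real^2) \<Rightarrow>\<^sub>L ((real^2) \<Rightarrow>\<^sub>L (real^3)))"
  assumes open_U: "open U"
    and df: "\<And>z. z \<in> U \<Longrightarrow> (f has_derivative blinfun_apply (f' z)) (at z)"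
    and ddf: "\<And>z. z \<in> U \<Longrightarrow> (f' has_derivative blinfun_apply (f'' z)) (at z)"
    and cont_f'': "continuous_on U f''"
    and inj_f': "\<And>z. z \<in> U \<Longrightarrow> inj (blinfun_apply (f' z))"
begin

definition f1 where "f1 z = blinfun_apply (f' z) (axis 1 1)"
definition f2 where "f2 z = blinfun_apply (f' z) (axis 2 1)"
text \<open>The unnormalised normal is kept beside \<open>N\<close>: being bilinear in the tangent
  vectors it has the explicit derivative \<open>nv'\<close>, and quotients of its components are the
  slopes of a graph.\<close>

definition nv where "nv z = cross3 (f1 z) (f2 z)"
definition nv' where "nv' z v = cross3 (f1 z) (f'' z v (axis 2 1)) + cross3 (f'' z v (axis 1 1)) (f2 z)"
definition N where "N z = sgn (nv z)"

lemma f'_eq: "f' z v = v$1 *\<^sub>R f1 z + v$2 *\<^sub>R f2 z"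
proof -
  have "f' z v = f' z (v$1 *\<^sub>R axis 1 1 + v$2 *\<^sub>R axis 2 1)" using real2_basis_expansion[of v] by simp
  then show ?thesis by (simp only: blinfun.add_right blinfun.scaleR_right f1_def f2_def)
qed

lemma nv_nonzero: assumes z: "z \<in> U" shows "nv z \<noteq> 0"
proof
  assume "nv z = 0"
  have ker: "v = 0" if "f' z v = 0" for v
    using that injD[OF inj_f'[OF z], of v 0] by (simp add: blinfun.zero_right)
  from \<open>nv z = 0\<close> have "collinear {0, f1 z, f2 z}" by (simp add: nv_def cross_eq_0)
  then consider "f1 z = 0" | "f2 z = 0" | c where "f2 z = c *\<^sub>R f1 z" by (auto simp: collinear_lemma)
  then show False
  proof cases
    case 1 then show False using ker[of "axis 1 1"] by (simp add: f1_def)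
  next
    case 2 then show False using ker[of "axis 2 1"] by (simp add: f2_def)
  next
    case 3
    then have "f' z (axis 2 1 - c *\<^sub>R axis 1 1) = 0" 
      by (simp add: f1_def f2_def blinfun.diff_right blinfun.scaleR_right)
    from ker[OF this] have "(axis 2 1 - c *\<^sub>R axis 1 1 :: real^2) $ 2 = 0" by simp
    then show False by (simp add: axis_def)
  qed
qed

lemma nv_orth: "f' z v \<bullet> nv z = 0"
  by (simp add: f'_eq nv_def inner_add_left dot_cross_self)

lemma d_f1: "z \<in> U \<Longrightarrow> (f1 has_derivative (\<lambda>v. f'' z v (axis 1 1))) (at z)"
  and d_f2: "z \<in> U \<Longrightarrow> (f2 has_derivative (\<lambda>v. f'' z v (axis 2 1))) (at z)"
  unfolding f1_def[abs_def] f2_def[abs_def]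
  by (auto intro!: derivative_eq_intros ddf simp: blinfun.zero_right)

lemma d_nv: "z \<in> U \<Longrightarrow> (nv has_derivative nv' z) (at z)"
  unfolding nv_def[abs_def] nv'_def
  by (rule bounded_bilinear.FDERIV[OF bounded_bilinear_cross3 d_f1 d_f2])

lemma cont_f: "continuous_on U f" "continuous_on U f'" "continuous_on U f1" "continuous_on U f2" "continuous_on U nv"
  using df ddf d_f1 d_f2 d_nv by (meson has_derivative_continuous continuous_at_imp_continuous_on)+

lemma cont_nv': "continuous_on U (\<lambda>z. nv' z v)"
  unfolding nv'_def by (intro continuous_intros continuous_on_cross cont_f cont_f'')

lemma nv'_eq: "nv' z v = v$1 *\<^sub>R nv' z (axis 1 1) + v$2 *\<^sub>R nv' z (axis 2 1)"
proof -
  have lin: "linear (nv' z)"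
    unfolding nv'_def
    by (intro linearI) (simp_all add: blinfun.add_left blinfun.add_right blinfun.scaleR_left blinfun.scaleR_right
      cross_add_left cross_add_right cross_mult_left cross_mult_right algebra_simps)
  have "nv' z v = nv' z (v$1 *\<^sub>R axis 1 1 + v$2 *\<^sub>R axis 2 1)" using real2_basis_expansion[of v] by simp
  then show ?thesis by (simp only: linear_add[OF lin] linear_scale[OF lin])
qed

lemma norm_N: "z \<in> U \<Longrightarrow> norm (N z) = 1"
  using nv_nonzero by (simp add: N_def norm_sgn)

lemma N_differentiable: assumes z: "z \<in> U" shows "N differentiable (at z)"
proof -
  have "(\<lambda>z. (1 / norm (nv z)) *\<^sub>R nv z) differentiable (at z)"
    using d_nv[OF z] nv_nonzero[OF z]
    by (intro derivative_intros differentiable_compose[of norm] differentiable_norm_at) (auto simp: differentiable_def)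
  then show ?thesis by (simp add: N_def[abs_def] sgn_div_norm divide_inverse)
qed

end


text \<open>The map f o \<Phi> parametrises part of the patch over the plane of e and a, with height
  u in the direction n. The locale records what later arguments use of this parametrisation, so that
  the inverse function theorem does not reappear. Openness of \<Phi> carries neighbourhoods back to
  the chart.\<close>

locale graph_patch = surface_patch +
  fixes D :: "(real^2) set" and \<Phi> :: "real^2 \<Rightarrow> real^2" and \<Phi>' :: "real^2 \<Rightarrow> real^2 \<Rightarrow> real^2"
    and e a n :: "real^3" and u p q r s t :: "real^2 \<Rightarrow> real"
  assumes open_D: "open D"
    and \<Phi>_in: "\<And>w. w \<in> D \<Longrightarrow> \<Phi> w \<in> U"
    and open_image: "\<And>W. open W \<Longrightarrow> W \<subseteq> D \<Longrightarrow> open (\<Phi> ` W)"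
    and d\<Phi>: "\<And>w. w \<in> D \<Longrightarrow> (\<Phi> has_derivative \<Phi>' w) (at w)"
    and bij_\<Phi>': "\<And>w. w \<in> D \<Longrightarrow> bij (\<Phi>' w)"
    and frame: "norm e = 1" "norm a = 1" "norm n = 1" "e \<bullet> a = 0" "e \<bullet> n = 0" "a \<bullet> n = 0"
    and du: "\<And>w. w \<in> D \<Longrightarrow> (u has_derivative (\<lambda>h. p w * h$1 + q w * h$2)) (at w)"
    and dp: "\<And>w. w \<in> D \<Longrightarrow> (p has_derivative (\<lambda>h. r w * h$1 + s w * h$2)) (at w)"
    and dq: "\<And>w. w \<in> D \<Longrightarrow> (q has_derivative (\<lambda>h. s w * h$1 + t w * h$2)) (at w)"
    and cr: "continuous_on D r" and cs: "continuous_on D s" and ct: "continuous_on D t"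
    and tangent: "\<And>w h. w \<in> D \<Longrightarrow> f' (\<Phi> w) (\<Phi>' w h) = h$1 *\<^sub>R e + h$2 *\<^sub>R a + (p w * h$1 + q w * h$2) *\<^sub>R n"
    and normal: "\<And>w. w \<in> D \<Longrightarrow> N (\<Phi> w) = (1 / sqrt (1 + (p w)\<^sup>2 + (q w)\<^sup>2)) *\<^sub>R (n - p w *\<^sub>R e - q w *\<^sub>R a)"

context surface_patch
begin

text \<open>The inverse function theorem is applied to the projection of the patch to its tangent
  plane. The slopes are not obtained by differentiating \<Phi> twice but as quotients of components
  of the normal, which is once continuously differentiable; this is what makes u of class
  C^2.\<close>

lemma tangent_graph_exists:
  assumes z0: "z0 \<in> U" and a: "norm a = 1" and an: "a \<bullet> N z0 = 0"
  obtains D \<Phi> \<Phi>' u p q r s t w0 where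
    "graph_patch U f f' f'' D \<Phi> \<Phi>' (cross3 a (N z0)) a (N z0) u p q r s t" "w0 \<in> D" "\<Phi> w0 = z0"
proof -
  define n where "n = N z0"
  define e where "e = cross3 a n"
  have n: "norm n = 1" unfolding n_def by (rule norm_N[OF z0])
  have an: "a \<bullet> n = 0" using an by (simp add: n_def)
  note on = orthonormal_cross_expansion[OF a n an, folded e_def]
  have aa: "a \<bullet> a = 1" "n \<bullet> n = 1" "e \<bullet> e = 1" using a n on(1) by (simp_all add: norm_eq_1)
  \<comment> \<open>Where the normal keeps a positive component along n, a tangent vector is
    determined by its e and a components, so the projection has an injective derivative.\<close>
  define U1 where "U1 = U \<inter> (\<lambda>z. nv z \<bullet> n) -` {0<..}"
  have "continuous_on U (\<lambda>z. nv z \<bullet> n)" by (intro continuous_intros cont_f)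
  then have openU1: "open U1" unfolding U1_def
    using continuous_open_preimage[OF _ open_U open_greaterThan[of 0]] by blast
  have U1: "z \<in> U" "0 < nv z \<bullet> n" if "z \<in> U1" for z using that by (auto simp: U1_def)
  have "nv z0 \<bullet> n = norm (nv z0)"
    using nv_nonzero[OF z0] by (simp add: n_def N_def sgn_div_norm power2_norm_eq_inner[symmetric] power2_eq_square)
  then have z0U1: "z0 \<in> U1" using z0 nv_nonzero[OF z0] by (simp add: U1_def)
  define \<pi> :: "real^3 \<Rightarrow> real^2" where "\<pi> y = (\<chi> i. if i = 1 then y \<bullet> e else y \<bullet> a)" for y
  have \<pi>12: "\<pi> y $ 1 = y \<bullet> e" "\<pi> y $ 2 = y \<bullet> a" for y by (simp_all add: \<pi>_def)
  have lin\<pi>: "bounded_linear \<pi>"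
    by (intro linear_conv_bounded_linear[THEN iffD1] linearI)
      (simp_all add: vec_eq_iff forall_2 \<pi>12 inner_add_left)
  define B where "B = Blinfun \<pi>"
  have B: "blinfun_apply B = \<pi>" unfolding B_def by (rule bounded_linear_Blinfun_apply[OF lin\<pi>])
  define G where "G z = \<pi> (f z)" for z
  define G' where "G' z = B o\<^sub>L f' z" for z
  have G'_apply: "G' z v = \<pi> (f' z v)" for z v by (simp add: G'_def B)
  have dG: "(G has_derivative blinfun_apply (G' z)) (at z)" if "z \<in> U1" for z
    using has_derivative_compose[OF df[OF U1(1)[OF that]] bounded_linear_imp_has_derivative[OF lin\<pi>]]
    by (simp add: G_def[abs_def] G'_apply[abs_def])
  have contG': "continuous_on U1 G'"
    unfolding G'_def
    by (intro bounded_bilinear.continuous_on[OF bounded_bilinear_blinfun_compose] continuous_on_const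
        continuous_on_subset[OF cont_f(2)]) (auto simp: U1_def)
  have expand: "f' z v = (f' z v \<bullet> e) *\<^sub>R e + (f' z v \<bullet> a) *\<^sub>R a
      + (- (nv z \<bullet> e) / (nv z \<bullet> n) * (f' z v \<bullet> e) + - (nv z \<bullet> a) / (nv z \<bullet> n) * (f' z v \<bullet> a)) *\<^sub>R n"
    if z: "z \<in> U1" for z v
  proof -
    define y where "y = f' z v"
    have y: "y = (y \<bullet> e) *\<^sub>R e + (y \<bullet> a) *\<^sub>R a + (y \<bullet> n) *\<^sub>R n" by (rule on(5))
    have "0 = y \<bullet> nv z" by (simp add: y_def nv_orth)
    also have "\<dots> = (y \<bullet> e) * (nv z \<bullet> e) + (y \<bullet> a) * (nv z \<bullet> a) + (y \<bullet> n) * (nv z \<bullet> n)"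
      by (subst y) (simp add: inner_add_left inner_commute[of "nv z"])
    finally have "y \<bullet> n = - (nv z \<bullet> e) / (nv z \<bullet> n) * (y \<bullet> e) + - (nv z \<bullet> a) / (nv z \<bullet> n) * (y \<bullet> a)"
      using U1(2)[OF z] by (simp add: field_simps)
    then show ?thesis using y by (simp add: y_def)
  qed
  have injG': "inj (blinfun_apply (G' z))" if z: "z \<in> U1" for z
  proof (rule injI)
    fix v w assume "G' z v = G' z w"
    then have "f' z v \<bullet> e = f' z w \<bullet> e" "f' z v \<bullet> a = f' z w \<bullet> a"
      unfolding G'_apply by (metis \<pi>12)+
    then have "f' z v = f' z w" using expand[OF z, of v] expand[OF z, of w] by simp
    then show "v = w" using inj_f'[OF U1(1)[OF z]] by (simp add: inj_eq)
  qed
  have "\<exists>g. linear g \<and> g \<circ> blinfun_apply (G' z0) = id"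
    by (rule linear_injective_left_inverse[OF _ injG'[OF z0U1]])
      (simp add: blinfun.bounded_linear_right bounded_linear.linear)
  then obtain g where g: "linear g" "g \<circ> blinfun_apply (G' z0) = id" by blast
  have gB: "blinfun_apply (Blinfun g) = g"
    using g(1) by (intro bounded_linear_Blinfun_apply) (simp add: linear_conv_bounded_linear)
  have "Blinfun g o\<^sub>L G' z0 = id_blinfun"
    by (rule blinfun_eqI) (use g(2) in \<open>simp add: gB fun_eq_iff\<close>)
  from inverse_function_theorem[OF openU1 dG contG' z0U1 this]
  obtain V D \<Phi> \<Phi>' where V: "open V" "V \<subseteq> U1" "z0 \<in> V" and D: "open D" "G z0 \<in> D"
    and hom: "homeomorphism V D G \<Phi>"
    and d\<Phi>: "\<And>w. w \<in> D \<Longrightarrow> (\<Phi> has_derivative \<Phi>' w) (at w)"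
    and \<Phi>': "\<And>w. w \<in> D \<Longrightarrow> \<Phi>' w = inv (blinfun_apply (G' (\<Phi> w)))"
    and bijG: "\<And>w. w \<in> D \<Longrightarrow> bij (blinfun_apply (G' (\<Phi> w)))"
    by metis
  have \<Phi>V: "\<Phi> w \<in> V" if "w \<in> D" for w using hom that by (auto simp: homeomorphism_def)
  then have \<Phi>U1: "\<Phi> w \<in> U1" if "w \<in> D" for w using V(2) that by blast
  have G\<Phi>': "G' (\<Phi> w) (\<Phi>' w h) = h" if "w \<in> D" for w h
    unfolding \<Phi>'[OF that] using bijG[OF that] by (simp add: bij_is_surj surj_f_inv_f)
  have comp: "f' (\<Phi> w) (\<Phi>' w h) \<bullet> e = h$1" "f' (\<Phi> w) (\<Phi>' w h) \<bullet> a = h$2" if "w \<in> D" for w h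
    using G\<Phi>'[OF that, of h] unfolding G'_apply by (metis \<pi>12)+
  \<comment> \<open>The slope of the graph in the direction b: a tangent vector is orthogonal to the
    normal, which gives its n component as this combination of the other two.\<close>
  define P where "P b z = - (nv z \<bullet> b) / (nv z \<bullet> n)" for b z
  define P' where "P' b z v = - (nv' z v \<bullet> b) / (nv z \<bullet> n) + (nv z \<bullet> b) * (nv' z v \<bullet> n) / (nv z \<bullet> n)\<^sup>2" for b z v
  have dP: "(P b has_derivative P' b z) (at z)" if z: "z \<in> U1" for b z
  proof -
    have d: "((\<lambda>z. nv z \<bullet> b) has_derivative (\<lambda>v. nv' z v \<bullet> b)) (at z)" for b
      by (rule has_derivative_inner_left[OF d_nv[OF U1(1)[OF z]]])
    have "((\<lambda>z. - (nv z \<bullet> b) / (nv z \<bullet> n)) has_derivative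
       (\<lambda>v. - (- (nv z \<bullet> b)) * (inverse (nv z \<bullet> n) * (nv' z v \<bullet> n) * inverse (nv z \<bullet> n)) + - (nv' z v \<bullet> b) / (nv z \<bullet> n))) (at z)"
      using has_derivative_divide[OF has_derivative_minus[OF d[of b]] d[of n]] U1(2)[OF z] by simp
    then show ?thesis unfolding P_def[abs_def] P'_def[abs_def]
      by (rule has_derivative_eq_rhs) (auto simp: fun_eq_iff divide_inverse power2_eq_square)
  qed
  have contP': "continuous_on U1 (\<lambda>z. P' b z v)" for b v
    unfolding P'_def using U1 
    by (intro continuous_intros continuous_on_subset[OF cont_f(5)] continuous_on_subset[OF cont_nv']) force+
  have P'_eq: "P' b z v = P' b z (axis 1 1) * v$1 + P' b z (axis 2 1) * v$2" for b z v
    unfolding P'_def nv'_eq[of z v]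
    by (simp add: inner_add_left algebra_simps add_divide_distrib diff_divide_distrib)
  define R where "R b i w = P' b (\<Phi> w) (\<Phi>' w (axis i 1))" for b w and i :: 2
  have contf: "continuous_on D \<Phi>" using hom by (simp add: homeomorphism_def)
  define J where "J z = nv z \<bullet> n" for z
  \<comment> \<open>The inverse function theorem provides \<Phi>' only as an abstract inverse.
    Cramer's rule makes its entries explicit, and hence continuous; the determinant is nv \<bullet>
    n because n = e \<times> a.\<close>
  have cramer: "\<Phi>' w h $ 1 = ((f2 (\<Phi> w) \<bullet> a) * h$1 - (f2 (\<Phi> w) \<bullet> e) * h$2) / J (\<Phi> w)"
     "\<Phi>' w h $ 2 = ((f1 (\<Phi> w) \<bullet> e) * h$2 - (f1 (\<Phi> w) \<bullet> a) * h$1) / J (\<Phi> w)" if w: "w \<in> D" for w h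
  proof -
    define v where "v = \<Phi>' w h"
    define A1 A2 B1 B2 where "A1 = f1 (\<Phi> w) \<bullet> e" and "A2 = f2 (\<Phi> w) \<bullet> e" and "B1 = f1 (\<Phi> w) \<bullet> a" and "B2 = f2 (\<Phi> w) \<bullet> a"
    have J: "J (\<Phi> w) = A1 * B2 - A2 * B1"
      unfolding J_def nv_def A1_def A2_def B1_def B2_def on(4)[symmetric]
      by (simp add: dot_cross)
    have "h$1 = A1 * v$1 + A2 * v$2" "h$2 = B1 * v$1 + B2 * v$2"
      using comp[OF w, of h] unfolding v_def[symmetric] f'_eq A1_def A2_def B1_def B2_def
      by (simp_all add: inner_add_left mult.commute)
    then have "J (\<Phi> w) * v$1 = B2 * h$1 - A2 * h$2" "J (\<Phi> w) * v$2 = A1 * h$2 - B1 * h$1"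
      unfolding J by (simp_all add: algebra_simps)
    moreover have "J (\<Phi> w) \<noteq> 0" using U1(2)[OF \<Phi>U1[OF w]] by (simp add: J_def)
    ultimately show "\<Phi>' w h $ 1 = ((f2 (\<Phi> w) \<bullet> a) * h$1 - (f2 (\<Phi> w) \<bullet> e) * h$2) / J (\<Phi> w)"
     "\<Phi>' w h $ 2 = ((f1 (\<Phi> w) \<bullet> e) * h$2 - (f1 (\<Phi> w) \<bullet> a) * h$1) / J (\<Phi> w)"
      unfolding v_def[symmetric] A1_def A2_def B1_def B2_def by (simp_all add: nonzero_eq_divide_eq mult.commute)
  qed
  have onD: "continuous_on D (\<lambda>w. k (\<Phi> w))" if "continuous_on U k" for k :: "real^2 \<Rightarrow> 'b::topological_space"
    by (rule continuous_on_compose2[OF that contf]) (use \<Phi>U1 U1 in blast)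
  have onD1: "continuous_on D (\<lambda>w. k (\<Phi> w))" if "continuous_on U1 k" for k :: "real^2 \<Rightarrow> 'b::topological_space"
    by (rule continuous_on_compose2[OF that contf]) (use \<Phi>U1 in blast)
  have J0: "J (\<Phi> w) \<noteq> 0" if "w \<in> D" for w using U1(2)[OF \<Phi>U1[OF that]] by (simp add: J_def)
  have cont\<Phi>': "continuous_on D (\<lambda>w. \<Phi>' w h $ 1)" "continuous_on D (\<lambda>w. \<Phi>' w h $ 2)" for h
  proof -
    have "continuous_on D (\<lambda>w. ((f2 (\<Phi> w) \<bullet> a) * h$1 - (f2 (\<Phi> w) \<bullet> e) * h$2) / J (\<Phi> w))"
      unfolding J_def by (intro continuous_intros onD cont_f) (use J0 J_def in auto)
    then show "continuous_on D (\<lambda>w. \<Phi>' w h $ 1)" by (rule continuous_on_eq) (simp add: cramer)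
    have "continuous_on D (\<lambda>w. ((f1 (\<Phi> w) \<bullet> e) * h$2 - (f1 (\<Phi> w) \<bullet> a) * h$1) / J (\<Phi> w))"
      unfolding J_def by (intro continuous_intros onD cont_f) (use J0 J_def in auto)
    then show "continuous_on D (\<lambda>w. \<Phi>' w h $ 2)" by (rule continuous_on_eq) (simp add: cramer)
  qed
  have contR: "continuous_on D (R b i)" for b i
    unfolding R_def[abs_def]
    by (subst P'_eq) (intro continuous_intros onD1 contP' cont\<Phi>')
  have d: "((\<lambda>w. P b (\<Phi> w)) has_derivative (\<lambda>h. R b 1 w * h$1 + R b 2 w * h$2)) (at w)" if w: "w \<in> D" for b w
  proof -
    have *: "((\<lambda>w. P b (\<Phi> w)) has_derivative (\<lambda>h. P' b (\<Phi> w) (\<Phi>' w h))) (at w)"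
      by (rule has_derivative_compose[OF d\<Phi>[OF w] dP[OF \<Phi>U1[OF w]]])
    note lin = has_derivative_linear[OF *]
    have "P' b (\<Phi> w) (\<Phi>' w h) = R b 1 w * h$1 + R b 2 w * h$2" for h
    proof -
      have "P' b (\<Phi> w) (\<Phi>' w h) = P' b (\<Phi> w) (\<Phi>' w (h$1 *\<^sub>R axis 1 1 + h$2 *\<^sub>R axis 2 1))"
        using real2_basis_expansion[of h] by simp
      also have "\<dots> = h$1 * R b 1 w + h$2 * R b 2 w"
        unfolding R_def using linear_add[OF lin] linear_scale[OF lin] by simp
      finally show ?thesis by simp
    qed
    then show ?thesis using * by simp
  qed
  have tangent: "f' (\<Phi> w) (\<Phi>' w h) = h$1 *\<^sub>R e + h$2 *\<^sub>R a
      + (P e (\<Phi> w) * h$1 + P a (\<Phi> w) * h$2) *\<^sub>R n" if w: "w \<in> D" for w h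
    using expand[OF \<Phi>U1[OF w], of "\<Phi>' w h"] unfolding comp[OF w] P_def .
  have du: "((\<lambda>w. f (\<Phi> w) \<bullet> n) has_derivative (\<lambda>h. P e (\<Phi> w) * h$1 + P a (\<Phi> w) * h$2)) (at w)" if w: "w \<in> D" for w
  proof -
    have "((\<lambda>w. f (\<Phi> w) \<bullet> n) has_derivative (\<lambda>h. f' (\<Phi> w) (\<Phi>' w h) \<bullet> n)) (at w)"
      by (rule has_derivative_inner_left[OF has_derivative_compose[OF d\<Phi>[OF w] df[OF U1(1)[OF \<Phi>U1[OF w]]]]])
    then show ?thesis unfolding tangent[OF w] by (simp add: inner_add_left on(3) an aa)
  qed
  have sym: "R e 2 w = R a 1 w" if w: "w \<in> D" for w
    by (rule mixed_partials[OF D(1) w du d d contR contR])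
  have normal: "N (\<Phi> w) = (1 / sqrt (1 + (P e (\<Phi> w))\<^sup>2 + (P a (\<Phi> w))\<^sup>2)) *\<^sub>R (n - P e (\<Phi> w) *\<^sub>R e - P a (\<Phi> w) *\<^sub>R a)"
    if w: "w \<in> D" for w
  proof -
    define x where "x = nv (\<Phi> w)"
    define m where "m = n - P e (\<Phi> w) *\<^sub>R e - P a (\<Phi> w) *\<^sub>R a"
    have xn: "0 < x \<bullet> n" unfolding x_def by (rule U1(2)[OF \<Phi>U1[OF w]])
    have "x = (x \<bullet> e) *\<^sub>R e + (x \<bullet> a) *\<^sub>R a + (x \<bullet> n) *\<^sub>R n" by (rule on(5))
    also have "\<dots> = (x \<bullet> n) *\<^sub>R m"
      unfolding m_def P_def x_def[symmetric] using xn by (simp add: scaleR_right_distrib)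
    finally have "N (\<Phi> w) = sgn m" using xn unfolding N_def x_def[symmetric]
      by (metis sgn_scaleR sgn_pos scaleR_one)
    moreover have "(norm m)\<^sup>2 = 1 + (P e (\<Phi> w))\<^sup>2 + (P a (\<Phi> w))\<^sup>2"
      unfolding power2_norm_eq_inner m_def
      by (simp add: inner_diff_left inner_diff_right on(2,3) an aa inner_commute[of a e] inner_commute[of n e] inner_commute[of n a] power2_eq_square)
    then have "norm m = sqrt (1 + (P e (\<Phi> w))\<^sup>2 + (P a (\<Phi> w))\<^sup>2)"
      by (metis norm_ge_zero real_sqrt_unique)
    ultimately show ?thesis by (simp add: sgn_div_norm divide_inverse m_def)
  qed
  have "graph_patch U f f' f'' D \<Phi> \<Phi>' e a n (\<lambda>w. f (\<Phi> w) \<bullet> n) (\<lambda>w. P e (\<Phi> w)) (\<lambda>w. P a (\<Phi> w)) (R e 1) (R e 2) (R a 2)"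
  proof (intro graph_patch.intro graph_patch_axioms.intro surface_patch_axioms)
    show "open (\<Phi> ` W)" if "open W" "W \<subseteq> D" for W
    proof -
      \<comment> \<open>\<Phi> is the inverse of the homeomorphism \<open>G\<close>, so images under
        \<Phi> are preimages under \<open>G\<close>.\<close>
      have "\<Phi> ` W = V \<inter> G -` W"
        using hom that(2) unfolding homeomorphism_def by (auto simp: image_iff) (metis subsetD)+
      moreover have "continuous_on V G" using hom by (simp add: homeomorphism_def)
      ultimately show ?thesis using continuous_open_preimage[OF _ V(1) that(1)] by simp
    qed
    show "bij (\<Phi>' w)" if "w \<in> D" for w unfolding \<Phi>'[OF that] by (rule bij_imp_bij_inv[OF bijG[OF that]])
    show "((\<lambda>w. P a (\<Phi> w)) has_derivative (\<lambda>h. R e 2 w * h$1 + R a 2 w * h$2)) (at w)" if "w \<in> D" for w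
      unfolding sym[OF that] by (rule d[OF that])
  qed (use D(1) \<Phi>U1 U1 d\<Phi> on a n an du d contR tangent normal in \<open>auto\<close>)
  moreover have "\<Phi> (G z0) = z0" using hom V(3) by (auto simp: homeomorphism_def)
  ultimately show ?thesis using that D(2) by (auto simp: e_def n_def)
qed

end

section \<open>Shape operator and curvatures of a graph\<close>

context graph_patch
begin

text \<open>The normal along the graph is (n - p e - q a) / W, and \<open>m\<close> is W times the
  differential of W. The chain rule through \<Phi> expresses the shape operator on the coordinate
  vector h.\<close>

lemma N_graph_deriv:
  assumes w: "w \<in> D"
  defines "W \<equiv> sqrt (1 + (p w)\<^sup>2 + (q w)\<^sup>2)"
  defines "dp' \<equiv> \<lambda>h. r w * h$1 + s w * h$2" and "dq' \<equiv> \<lambda>h. s w * h$1 + t w * h$2"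
  defines "m \<equiv> \<lambda>h. p w * dp' h + q w * dq' h"
  shows "- frechet_derivative N (at (\<Phi> w)) (\<Phi>' w h) =
     (dp' h / W - p w * m h / W ^ 3) *\<^sub>R e + (dq' h / W - q w * m h / W ^ 3) *\<^sub>R a + (m h / W ^ 3) *\<^sub>R n"
proof -
  have W: "W > 0" using area_element_pos[of "p w" "q w"] by (simp add: W_def)
  have dp1: "(p has_derivative dp') (at w)" and dq1: "(q has_derivative dq') (at w)"
    unfolding dp'_def dq'_def by (rule dp[OF w], rule dq[OF w])
  have dV: "((\<lambda>w. 1 + (p w)\<^sup>2 + (q w)\<^sup>2) has_derivative (\<lambda>h. 2 * m h)) (at w)"
    by (auto intro!: derivative_eq_intros dp1 dq1 simp: m_def fun_eq_iff algebra_simps)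
  have "((\<lambda>x. 1 / sqrt x) has_real_derivative - (1 / (2 * W ^ 3))) (at (1 + (p w)\<^sup>2 + (q w)\<^sup>2))"
  proof -
    have "(sqrt has_real_derivative inverse W / 2) (at (1 + (p w)\<^sup>2 + (q w)\<^sup>2))"
      unfolding W_def by (rule DERIV_real_sqrt[OF area_element_pos])
    from DERIV_inverse'[OF this] W
    have "((\<lambda>x. inverse (sqrt x)) has_real_derivative - (inverse W * (inverse W / 2) * inverse W)) (at (1 + (p w)\<^sup>2 + (q w)\<^sup>2))"
      by (simp add: W_def)
    then show ?thesis using W by (simp add: inverse_eq_divide power3_eq_cube mult_ac)
  qed
  then have "((\<lambda>x. 1 / sqrt x) has_derivative (\<lambda>k. - (1 / (2 * W ^ 3)) * k)) (at (1 + (p w)\<^sup>2 + (q w)\<^sup>2))"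
    by (simp only: has_field_derivative_def)
  from has_derivative_compose[OF dV this]
  have dW: "((\<lambda>w. 1 / sqrt (1 + (p w)\<^sup>2 + (q w)\<^sup>2)) has_derivative (\<lambda>h. - (m h / W ^ 3))) (at w)"
    by simp
  have dm: "((\<lambda>w. n - p w *\<^sub>R e - q w *\<^sub>R a) has_derivative (\<lambda>h. - dp' h *\<^sub>R e - dq' h *\<^sub>R a)) (at w)"
    by (auto intro!: derivative_eq_intros dp1 dq1)
  have "((\<lambda>w. N (\<Phi> w)) has_derivative (\<lambda>h. (1 / W) *\<^sub>R (- dp' h *\<^sub>R e - dq' h *\<^sub>R a)
      + (- (m h / W ^ 3)) *\<^sub>R (n - p w *\<^sub>R e - q w *\<^sub>R a))) (at w)"
  proof (rule has_derivative_transform_within_open[OF _ open_D w])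
    show "((\<lambda>w. (1 / sqrt (1 + (p w)\<^sup>2 + (q w)\<^sup>2)) *\<^sub>R (n - p w *\<^sub>R e - q w *\<^sub>R a)) has_derivative
      (\<lambda>h. (1 / W) *\<^sub>R (- dp' h *\<^sub>R e - dq' h *\<^sub>R a)
      + (- (m h / W ^ 3)) *\<^sub>R (n - p w *\<^sub>R e - q w *\<^sub>R a))) (at w)"
      unfolding W_def using has_derivative_scaleR[OF dW dm] unfolding W_def .
  qed (simp add: normal)
  moreover have "((\<lambda>w. N (\<Phi> w)) has_derivative (\<lambda>h. frechet_derivative N (at (\<Phi> w)) (\<Phi>' w h))) (at w)"
    by (rule has_derivative_compose[OF d\<Phi>[OF w]])
      (use N_differentiable[OF \<Phi>_in[OF w]] frechet_derivative_works in blast)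
  ultimately have "frechet_derivative N (at (\<Phi> w)) (\<Phi>' w h) = (1 / W) *\<^sub>R (- dp' h *\<^sub>R e - dq' h *\<^sub>R a)
      + (- (m h / W ^ 3)) *\<^sub>R (n - p w *\<^sub>R e - q w *\<^sub>R a)"
    using has_derivative_unique by (metis (mono_tags, lifting))
  then show ?thesis by (simp add: algebra_simps)
qed

lemma frame_coordinates:
  "x *\<^sub>R e + y *\<^sub>R a + z *\<^sub>R n = x' *\<^sub>R e + y' *\<^sub>R a + z' *\<^sub>R n \<longleftrightarrow> x = x' \<and> y = y' \<and> z = z'"
proof
  assume *: "x *\<^sub>R e + y *\<^sub>R a + z *\<^sub>R n = x' *\<^sub>R e + y' *\<^sub>R a + z' *\<^sub>R n"
  have f: "e \<bullet> e = 1" "a \<bullet> a = 1" "n \<bullet> n = 1" "a \<bullet> e = 0" "n \<bullet> e = 0" "n \<bullet> a = 0"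
    using frame by (simp_all add: norm_eq_1 inner_commute)
  from arg_cong[OF *, of "\<lambda>v. v \<bullet> e"] arg_cong[OF *, of "\<lambda>v. v \<bullet> a"] arg_cong[OF *, of "\<lambda>v. v \<bullet> n"]
  show "x = x' \<and> y = y' \<and> z = z'" using f frame by (simp add: inner_add_left)
qed simp

definition "graph_principal w = {\<kappa>. \<exists>v. v \<noteq> 0 \<and>
   - frechet_derivative N (at (\<Phi> w)) v = \<kappa> *\<^sub>R f' (\<Phi> w) v}"

text \<open>In the coordinates h the eigenvalue equation reduces to the matrix with rows (A, B) and
  (C, E), whose trace is 2 H and whose determinant is K. Since \<Phi>' is bijective, all
  eigenvectors arise in this way.\<close>

lemma graph_curvatures:
  assumes w: "w \<in> D"
  shows "Min (graph_principal w) + Max (graph_principal w) = 2 * graph_mean (p w) (q w) (r w) (s w) (t w)"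
    "Min (graph_principal w) * Max (graph_principal w) = graph_gauss (p w) (q w) (r w) (s w) (t w)"
proof -
  define P Q R S T where "P = p w" and "Q = q w" and "R = r w" and "S = s w" and "T = t w"
  define W where "W = sqrt (1 + P\<^sup>2 + Q\<^sup>2)"
  have W: "W > 0" "W\<^sup>2 = 1 + P\<^sup>2 + Q\<^sup>2" using sqrt_area_pow[of P Q] by (simp_all add: W_def)
  define A B C E where "A = ((1 + Q\<^sup>2) * R - P * Q * S) / W ^ 3" and "B = ((1 + Q\<^sup>2) * S - P * Q * T) / W ^ 3"
    and "C = ((1 + P\<^sup>2) * S - P * Q * R) / W ^ 3" and "E = ((1 + P\<^sup>2) * T - P * Q * S) / W ^ 3"
  have eig: "- frechet_derivative N (at (\<Phi> w)) (\<Phi>' w h) = \<kappa> *\<^sub>R f' (\<Phi> w) (\<Phi>' w h)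
      \<longleftrightarrow> A * h$1 + B * h$2 = \<kappa> * h$1 \<and> C * h$1 + E * h$2 = \<kappa> * h$2" for \<kappa> h
  proof -
    define x y where "x = R * h$1 + S * h$2" and "y = S * h$1 + T * h$2"
    have split: "X / W = X * (1 + P\<^sup>2 + Q\<^sup>2) / W ^ 3" for X
      unfolding W(2)[symmetric] using W(1) by (simp add: field_simps eval_nat_numeral)
    have 1: "x / W - P * (P * x + Q * y) / W ^ 3 = A * h$1 + B * h$2"
      unfolding split[of x]
      unfolding A_def B_def x_def y_def 
      by (simp add: add_divide_distrib diff_divide_distrib algebra_simps power2_eq_square)
    have 2: "y / W - Q * (P * x + Q * y) / W ^ 3 = C * h$1 + E * h$2"
      unfolding split[of y]
      unfolding C_def E_def x_def y_def 
      by (simp add: add_divide_distrib diff_divide_distrib algebra_simps power2_eq_square)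
    \<comment> \<open>The derivative of the normal is tangent, so its n component is the slope
      combination of the other two and adds no further condition.\<close>
    have 3: "(P * x + Q * y) / W ^ 3 = P * (A * h$1 + B * h$2) + Q * (C * h$1 + E * h$2)"
      unfolding A_def B_def C_def E_def x_def y_def 
      by (simp add: add_divide_distrib diff_divide_distrib algebra_simps power2_eq_square)
    have L: "- frechet_derivative N (at (\<Phi> w)) (\<Phi>' w h) = (A * h$1 + B * h$2) *\<^sub>R e + (C * h$1 + E * h$2) *\<^sub>R a
       + (P * (A * h$1 + B * h$2) + Q * (C * h$1 + E * h$2)) *\<^sub>R n"
      unfolding N_graph_deriv[OF w]
      unfolding P_def[symmetric] Q_def[symmetric] R_def[symmetric] S_def[symmetric] T_def[symmetric] 
        W_def[symmetric] x_def[symmetric] y_def[symmetric] 1 2 3 ..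
    have Rr: "\<kappa> *\<^sub>R f' (\<Phi> w) (\<Phi>' w h) = (\<kappa> * h$1) *\<^sub>R e + (\<kappa> * h$2) *\<^sub>R a + (P * (\<kappa> * h$1) + Q * (\<kappa> * h$2)) *\<^sub>R n"
      unfolding tangent[OF w] by (simp add: P_def Q_def algebra_simps)
    show ?thesis unfolding L Rr frame_coordinates by auto
  qed
  have lin: "linear (\<Phi>' w)" by (rule has_derivative_linear[OF d\<Phi>[OF w]])
  have nz: "\<Phi>' w h \<noteq> 0 \<longleftrightarrow> h \<noteq> 0" for h
    using bij_is_inj[OF bij_\<Phi>'[OF w]] linear_0[OF lin] by (metis inj_eq)
  have "graph_principal w = {\<kappa>. \<exists>h::real^2. h \<noteq> 0 \<and> A * h$1 + B * h$2 = \<kappa> * h$1 \<and> C * h$1 + E * h$2 = \<kappa> * h$2}"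
  proof (intro set_eqI iffI; clarsimp simp: graph_principal_def)
    fix \<kappa> v assume v: "v \<noteq> 0" "- frechet_derivative N (at (\<Phi> w)) v = \<kappa> *\<^sub>R f' (\<Phi> w) v"
    obtain h where "v = \<Phi>' w h" using bij_is_surj[OF bij_\<Phi>'[OF w]] by (metis surjD)
    then show "\<exists>h::real^2. h \<noteq> 0 \<and> A * h$1 + B * h$2 = \<kappa> * h$1 \<and> C * h$1 + E * h$2 = \<kappa> * h$2"
      using v eig nz by blast
  next
    fix \<kappa> and h :: "real^2" assume "h \<noteq> 0" "A * h$1 + B * h$2 = \<kappa> * h$1" "C * h$1 + E * h$2 = \<kappa> * h$2"
    then show "\<exists>v. v \<noteq> 0 \<and> - frechet_derivative N (at (\<Phi> w)) v = \<kappa> *\<^sub>R f' (\<Phi> w) v"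
      using eig nz by blast
  qed
  note pr = this
  have trace: "A + E = 2 * graph_mean P Q R S T"
    unfolding A_def E_def graph_mean_def W_def[symmetric]
    by (simp add: add_divide_distrib diff_divide_distrib algebra_simps)
  have "A * E - B * C = (R * T - S\<^sup>2) * (1 + P\<^sup>2 + Q\<^sup>2) / W ^ 6"
    unfolding A_def B_def C_def E_def using W(1)
    by (simp add: divide_simps) (simp add: algebra_simps eval_nat_numeral)
  also have "\<dots> = (R * T - S\<^sup>2) / (W\<^sup>2)\<^sup>2"
    unfolding W(2)[symmetric] using W(1) by (simp add: divide_simps)
  finally have det: "A * E - B * C = graph_gauss P Q R S T"
    unfolding graph_gauss_def W(2) .
  have "0 \<le> (A + E)\<^sup>2 - 4 * (A * E - B * C)"
    unfolding trace det using graph_discriminant_nonneg[of P Q R S T] by (simp add: power_mult_distrib)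
  from eigenvalues_2x2[OF this]
  show "Min (graph_principal w) + Max (graph_principal w) = 2 * graph_mean (p w) (q w) (r w) (s w) (t w)"
    "Min (graph_principal w) * Max (graph_principal w) = graph_gauss (p w) (q w) (r w) (s w) (t w)"
    unfolding pr trace det unfolding P_def Q_def R_def S_def T_def .
qed

lemma q_eq: "w \<in> D \<Longrightarrow> a \<bullet> N (\<Phi> w) = - q w / sqrt (1 + (p w)\<^sup>2 + (q w)\<^sup>2)"
  unfolding normal using frame
  by (simp add: inner_diff_right inner_commute[of a e] norm_eq_1[of a])

lemma q_sign:
  assumes "w \<in> D"
  shows "0 \<le> a \<bullet> N (\<Phi> w) \<longleftrightarrow> q w \<le> 0" "a \<bullet> N (\<Phi> w) = 0 \<longleftrightarrow> q w = 0"
  unfolding q_eq[OF assms] using area_element_pos[of "p w" "q w"]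
  by (auto simp: zero_le_divide_iff divide_le_0_iff)

end

section \<open>The angle function on a patch\<close>

definition weingarten_at :: "(real \<Rightarrow> real) \<Rightarrow> real set \<Rightarrow> bool" where
  "weingarten_at g S \<longleftrightarrow> (Min S + Max S) / 2 = g (((Min S + Max S) / 2)\<^sup>2 - Min S * Max S)"

context surface_patch
begin

text \<open>The eigenvalue set in chart coordinates, matching \<open>graph_principal\<close> at
  \<Phi> w; curvatures are compared as sets, before Min and Max are taken.\<close>

definition "principal_at z = {\<kappa>. \<exists>v. v \<noteq> 0 \<and> - frechet_derivative N (at z) v = \<kappa> *\<^sub>R f' z v}"

text \<open>On the graph over the tangent plane at \<open>z0\<close> the hypothesis says q \<le> 0,
  with equality at the base point. The strong maximum principle gives a disc of zeros, and its image
  under the open map \<Phi> is the neighbourhood.\<close>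

lemma angle_zero_open:
  assumes g: "\<forall>t\<ge>0. (g has_real_derivative g' t) (at t within {0..})"
    and cont: "continuous_on {0..} g'"
    and ell: "\<forall>t\<ge>0. 4 * t * (g' t)\<^sup>2 < 1"
    and wein: "\<And>z. z \<in> U \<Longrightarrow> weingarten_at g (principal_at z)"
    and a: "norm a = 1" and nonneg: "\<And>z. z \<in> U \<Longrightarrow> 0 \<le> a \<bullet> N z"
    and z0: "z0 \<in> U" "a \<bullet> N z0 = 0"
  obtains V where "open V" "z0 \<in> V" "V \<subseteq> U" "\<And>z. z \<in> V \<Longrightarrow> a \<bullet> N z = 0"
proof -
  obtain D \<Phi> \<Phi>' u p q r s t w0 where
    gp: "graph_patch U f f' f'' D \<Phi> \<Phi>' (cross3 a (N z0)) a (N z0) u p q r s t" and w0: "w0 \<in> D" "\<Phi> w0 = z0"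
    using tangent_graph_exists[OF z0(1) a z0(2)] by metis
  interpret graph_patch U f f' f'' D \<Phi> \<Phi>' "cross3 a (N z0)" a "N z0" u p q r s t by (rule gp)
  have pr: "graph_principal w = principal_at (\<Phi> w)" for w
    unfolding graph_principal_def principal_at_def ..
  interpret weingarten_graph D u p q r s t g g'
  proof unfold_locales
    show "weingarten_defect g (p x) (q x) (r x) (s x) (t x) = 0" if x: "x \<in> D" for x
      using wein[OF \<Phi>_in[OF x]] graph_curvatures[OF x]
      by (simp add: weingarten_at_def pr weingarten_defect_def)
  qed (use open_D du dp dq cr cs ct g cont ell in auto)
  have q0: "q w0 = 0" using q_sign(2)[OF w0(1)] z0 w0 by simp
  obtain \<rho>' where \<rho>': "\<rho>' > 0" "cball w0 \<rho>' \<subseteq> D" using open_D w0(1) open_contains_cball by blast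
  define \<rho> where "\<rho> = \<rho>' / 4"
  have "\<rho> > 0" "cball w0 (4 * \<rho>) \<subseteq> D" using \<rho>' by (simp_all add: \<rho>_def)
  have sub: "ball w0 \<rho> \<subseteq> D" using \<rho>' by (auto simp: \<rho>_def subset_iff)
  have q0: "q w = 0" if "w \<in> ball w0 \<rho>" for w
    by (rule strong_maximum_principle[OF _ \<open>cball w0 (4 * \<rho>) \<subseteq> D\<close> \<open>\<rho> > 0\<close> q0])
      (use that q_sign(1) nonneg \<Phi>_in in auto)
  show ?thesis
  proof (rule that[of "\<Phi> ` ball w0 \<rho>"])
    show "open (\<Phi> ` ball w0 \<rho>)" by (rule open_image[OF open_ball sub])
    show "z0 \<in> \<Phi> ` ball w0 \<rho>" using \<open>\<rho> > 0\<close> w0(2) by (metis centre_in_ball imageI)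
    show "\<Phi> ` ball w0 \<rho> \<subseteq> U" using sub \<Phi>_in by blast
    show "a \<bullet> N z = 0" if "z \<in> \<Phi> ` ball w0 \<rho>" for z
      using that q0 q_sign(2) sub by blast
  qed
qed

text \<open>On a graph with q = 0 throughout, s and t vanish as derivatives of q; at the base point
  p = 0 as well, because the graph is over the tangent plane there. Only r survives: the shape
  operator is r on e and 0 on a, so K = 0 and c = r / 2 is the mean curvature.\<close>

lemma shape_operator_of_zero_angle:
  assumes g: "\<forall>t\<ge>0. (g has_real_derivative g' t) (at t within {0..})"
    and ell: "\<forall>t\<ge>0. 4 * t * (g' t)\<^sup>2 < 1"
    and wein: "\<And>z. z \<in> U \<Longrightarrow> weingarten_at g (principal_at z)"
    and a: "norm a = 1" and zero: "\<And>z. z \<in> U \<Longrightarrow> a \<bullet> N z = 0"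
    and z0: "z0 \<in> U"
  obtains c where "c = g (c\<^sup>2)"
    "\<And>v. frechet_derivative N (at z0) v = - (2 * c) *\<^sub>R (f' z0 v - (f' z0 v \<bullet> a) *\<^sub>R a)"
proof -
  obtain D \<Phi> \<Phi>' u p q r s t w0 where
    gp: "graph_patch U f f' f'' D \<Phi> \<Phi>' (cross3 a (N z0)) a (N z0) u p q r s t" and w0: "w0 \<in> D" "\<Phi> w0 = z0"
    using tangent_graph_exists[OF z0(1) a zero[OF z0]] by metis
  define e where "e = cross3 a (N z0)"
  interpret graph_patch U f f' f'' D \<Phi> \<Phi>' e a "N z0" u p q r s t unfolding e_def by (rule gp)
  have pr: "graph_principal w = principal_at (\<Phi> w)" for w
    unfolding graph_principal_def principal_at_def ..
  have q0: "q w = 0" if "w \<in> D" for w using q_sign(2)[OF that] zero[OF \<Phi>_in[OF that]] by simp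
  have "(q has_derivative (\<lambda>h. 0)) (at w0)"
    by (rule has_derivative_transform_within_open[OF has_derivative_const[of 0] open_D w0(1)]) (simp add: q0)
  from has_derivative_unique[OF dq[OF w0(1)] this] have st: "s w0 * h$1 + t w0 * h$2 = 0" for h :: "real^2"
    by (rule fun_cong)
  from st[of "axis 1 1"] st[of "axis 2 1"] have st: "s w0 = 0" "t w0 = 0" by (simp_all add: axis_def)
  have ee: "e \<bullet> e = 1" "a \<bullet> a = 1" "N z0 \<bullet> N z0 = 1" using frame by (simp_all add: norm_eq_1)
  have "p w0 = 0"
  proof -
    define k where "k = 1 / sqrt (1 + (p w0)\<^sup>2 + (q w0)\<^sup>2)"
    have "k > 0" using area_element_pos[of "p w0" "q w0"] by (simp add: k_def)
    have "N z0 \<bullet> e = - (k * p w0)"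
      by (subst normal[OF w0(1), unfolded w0(2)])
        (use frame in \<open>simp add: k_def[symmetric] inner_diff_left ee inner_commute[of "N z0" e] inner_commute[of a e]\<close>)
    then show ?thesis using frame(5) \<open>k > 0\<close> by (simp add: inner_commute[of "N z0" e])
  qed
  define c where "c = r w0 / 2"
  have gm: "graph_mean (p w0) (q w0) (r w0) (s w0) (t w0) = c" "graph_gauss (p w0) (q w0) (r w0) (s w0) (t w0) = 0"
    using st \<open>p w0 = 0\<close> q0[OF w0(1)] by (simp_all add: graph_mean_def graph_gauss_def c_def)
  have "c = g (c\<^sup>2)"
    using wein[OF z0, unfolded weingarten_at_def graph_curvatures[OF w0(1), unfolded pr w0(2) gm]] by simp
  moreover have "frechet_derivative N (at z0) v = - (2 * c) *\<^sub>R (f' z0 v - (f' z0 v \<bullet> a) *\<^sub>R a)" for v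
  proof -
    obtain h where v: "v = \<Phi>' w0 h" using bij_is_surj[OF bij_\<Phi>'[OF w0(1)]] by (metis surjD)
    have 1: "f' z0 v = h$1 *\<^sub>R e + h$2 *\<^sub>R a"
      using tangent[OF w0(1), of h] by (simp add: v w0(2) \<open>p w0 = 0\<close> q0[OF w0(1)])
    have "- frechet_derivative N (at z0) v = (2 * c * h$1) *\<^sub>R e"
      using N_graph_deriv[OF w0(1), of h] by (simp add: v w0(2) \<open>p w0 = 0\<close> q0[OF w0(1)] st c_def)
    then have "frechet_derivative N (at z0) v = - ((2 * c * h$1) *\<^sub>R e)" by (metis minus_minus)
    moreover have "f' z0 v - (f' z0 v \<bullet> a) *\<^sub>R a = h$1 *\<^sub>R e"
      unfolding 1 using frame by (simp add: inner_add_left ee)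
    ultimately show ?thesis by simp
  qed
  ultimately show ?thesis using that by blast
qed

end

section \<open>Charts\<close>

lemma is_chart_inj: "is_chart X c \<Longrightarrow> inj_on (snd c) (fst c)"
  unfolding is_chart_def homeomorphic_map_def
  by (metis homeomorphic_imp_injective_map homeomorphic_map_def openin_subset topspace_subtopology_subset)

lemma is_chart_preimage:
  assumes c: "is_chart X c" and V: "open V"
  shows "openin X {p \<in> fst c. snd c p \<in> V}"
proof -
  have "openin X (fst c)" using c by (simp add: is_chart_def)
  then have ts: "topspace (subtopology X (fst c)) = fst c"
    by (intro topspace_subtopology_subset openin_subset)
  have "continuous_map (subtopology X (fst c)) (top_of_set (snd c ` fst c)) (snd c)"
    using c unfolding is_chart_def by (blast intro: homeomorphic_imp_continuous_map)
  moreover have "openin (top_of_set (snd c ` fst c)) (snd c ` fst c \<inter> V)"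
    by (simp add: V openin_open_Int)
  ultimately have "openin (subtopology X (fst c)) {p \<in> fst c. snd c p \<in> snd c ` fst c \<inter> V}"
    using openin_continuous_map_preimage[of "subtopology X (fst c)" "top_of_set (snd c ` fst c)" "snd c" "snd c ` fst c \<inter> V"]
    unfolding ts by blast
  moreover have "{p \<in> fst c. snd c p \<in> snd c ` fst c \<inter> V} = {p \<in> fst c. snd c p \<in> V}" by auto
  ultimately show ?thesis using \<open>openin X (fst c)\<close> openin_trans_full by metis
qed

lemma is_chart_image_open:
  assumes c: "is_chart X c" and W: "openin X W" "W \<subseteq> fst c"
  shows "open (snd c ` W)"
proof -
  have "open_map (subtopology X (fst c)) (top_of_set (snd c ` fst c)) (snd c)"
    using c unfolding is_chart_def by (blast intro: homeomorphic_imp_open_map)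
  moreover have "openin (subtopology X (fst c)) W"
    using W by (metis inf.absorb_iff2 openin_subtopology_Int2)
  ultimately have "openin (top_of_set (snd c ` fst c)) (snd c ` W)" by (simp add: open_map_def)
  then show ?thesis using c by (simp add: is_chart_def openin_open_eq)
qed

lemma in_chart_apply: "inj_on (snd c) (fst c) \<Longrightarrow> p \<in> fst c \<Longrightarrow> in_chart c F (snd c p) = F p"
  by (simp add: in_chart_def)

text \<open>\<open>T\<close> is the differential of the coordinate change. Quantifying over
  \<open>F\<close> after \<open>T\<close> lets one and the same \<open>T\<close> transform both the
  immersion and the Gauss map, as is needed to transport an eigenvalue equation.\<close>

lemma chart_change:
  assumes at: "oriented_C2_atlas X A" and c: "c \<in> A" and d: "d \<in> A" and p: "p \<in> fst c" "p \<in> fst d"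
  obtains T :: "real^2 \<Rightarrow> real^2" where "linear T" "0 < det (matrix T)"
    "\<And>(F :: 'a \<Rightarrow> real^3) D. (in_chart d F has_derivative D) (at (snd d p))
       \<Longrightarrow> (in_chart c F has_derivative (\<lambda>v. D (T v))) (at (snd c p))"
proof -
  have ch: "is_chart X c" "is_chart X d" using at c d by (auto simp: oriented_C2_atlas_def)
  note inj = ch[THEN is_chart_inj]
  define W where "W = fst c \<inter> fst d"
  have "openin X W" using ch unfolding W_def is_chart_def by blast
  then have O: "open (snd c ` W)" by (rule is_chart_image_open[OF ch(1)]) (simp add: W_def)
  have zO: "snd c p \<in> snd c ` W" using p by (simp add: W_def)
  define S where "S = in_chart c (snd d)"
  define T where "T = frechet_derivative S (at (snd c p))"
  have "C2_on (snd c ` W) S" and det: "0 < det (matrix T)"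
    using at c d zO unfolding oriented_C2_atlas_def W_def S_def T_def by blast+
  then obtain S' where "(S has_derivative blinfun_apply (S' (snd c p))) (at (snd c p))"
    unfolding C2_on_def using zO by blast
  then have dS: "(S has_derivative T) (at (snd c p))"
    unfolding T_def using frechet_derivative_at by fastforce
  have Sp: "S (snd c p) = snd d p" unfolding S_def by (rule in_chart_apply[OF inj(1) p(1)])
  show ?thesis
  proof (rule that[OF has_derivative_linear[OF dS] det])
    fix F :: "'a \<Rightarrow> real^3" and D assume "(in_chart d F has_derivative D) (at (snd d p))"
    then have "(in_chart d F has_derivative D) (at (S (snd c p)))" by (simp add: Sp)
    from has_derivative_compose[OF dS this]
    have "((\<lambda>z. in_chart d F (S z)) has_derivative (\<lambda>v. D (T v))) (at (snd c p))" .
    then show "(in_chart c F has_derivative (\<lambda>v. D (T v))) (at (snd c p))"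
    proof (rule has_derivative_transform_within_open[OF _ O zO])
      fix y assume "y \<in> snd c ` W"
      then obtain x where x: "y = snd c x" "x \<in> fst c" "x \<in> fst d" by (auto simp: W_def)
      show "in_chart d F (S y) = in_chart c F y"
        unfolding x(1) S_def in_chart_apply[OF inj(1) x(2)] in_chart_apply[OF inj(2) x(3)] ..
    qed
  qed
qed

lemma surface_patch_of_chart:
  assumes "oriented_immersed_surface X A \<psi>" and c: "c \<in> A"
  obtains f' f'' where "surface_patch (snd c ` fst c) (in_chart c \<psi>) f' f''"
proof -
  have im: "C2_immersion A \<psi>" and at: "oriented_C2_atlas X A"
    using assms(1) by (simp_all add: oriented_immersed_surface_def)
  have C2: "C2_on (snd c ` fst c) (in_chart c \<psi>)"
    using bspec[OF im[unfolded C2_immersion_def] c, THEN conjunct1] .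
  have inj: "inj (frechet_derivative (in_chart c \<psi>) (at z))" if "z \<in> snd c ` fst c" for z
    using bspec[OF im[unfolded C2_immersion_def] c, THEN conjunct2, THEN bspec, OF that] .
  have "is_chart X c" using at c by (simp add: oriented_C2_atlas_def)
  then have op: "open (snd c ` fst c)" by (simp add: is_chart_def)
  from C2 obtain f' f'' where
    d: "\<forall>z\<in>snd c ` fst c. (in_chart c \<psi> has_derivative blinfun_apply (f' z)) (at z)"
      "\<forall>z\<in>snd c ` fst c. (f' has_derivative blinfun_apply (f'' z)) (at z)" "continuous_on (snd c ` fst c) f''"
    unfolding C2_on_def C1_on_def by blast
  have "inj (blinfun_apply (f' z))" if "z \<in> snd c ` fst c" for z
    using inj[OF that] frechet_derivative_at[of "in_chart c \<psi>" "blinfun_apply (f' z)" z] d(1) that by force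
  then have "surface_patch (snd c ` fst c) (in_chart c \<psi>) f' f''"
    by (intro surface_patch.intro op) (use d in auto)
  then show ?thesis by (rule that)
qed

text \<open>The type of values is arbitrary: the lemma serves for vectors, numbers and also for the
  truth value of an equation.\<close>

lemma locally_constant_connected:
  assumes X: "connected_space X"
    and loc: "\<And>x. x \<in> topspace X \<Longrightarrow> \<exists>W. openin X W \<and> x \<in> W \<and> (\<forall>y\<in>W. F y = F x)"
    and p: "p \<in> topspace X" and q: "q \<in> topspace X"
  shows "F q = F p"
proof -
  define S where "S = {x \<in> topspace X. F x = F p}"
  have "openin X S" 
    unfolding openin_subopen[of X S]
  proof
    fix x assume x: "x \<in> S"
    then have "x \<in> topspace X" by (simp add: S_def)
    from loc[OF this] obtain W where W: "openin X W" "x \<in> W" "\<forall>y\<in>W. F y = F x"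
      by (elim exE conjE)
    have "W \<subseteq> S"
    proof
      fix y assume y: "y \<in> W"
      then have "y \<in> topspace X" using openin_subset[OF W(1)] by blast
      then show "y \<in> S" using bspec[OF W(3) y] x by (simp add: S_def)
    qed
    then show "\<exists>T. openin X T \<and> x \<in> T \<and> T \<subseteq> S" using W(1,2) by blast
  qed
  moreover have "openin X (topspace X - S)"
    unfolding openin_subopen[of X "topspace X - S"]
  proof
    fix x assume x: "x \<in> topspace X - S"
    then have "x \<in> topspace X" by (simp add: S_def)
    from loc[OF this] obtain W where W: "openin X W" "x \<in> W" "\<forall>y\<in>W. F y = F x"
      by (elim exE conjE)
    have "W \<subseteq> topspace X - S"
    proof
      fix y assume y: "y \<in> W"
      then have "y \<in> topspace X" using openin_subset[OF W(1)] by blast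
      then show "y \<in> topspace X - S" using bspec[OF W(3) y] x by (simp add: S_def)
    qed
    then show "\<exists>T. openin X T \<and> x \<in> T \<and> T \<subseteq> topspace X - S" using W(1,2) by blast
  qed
  ultimately have "openin X S" "closedin X S" by (auto simp: closedin_def S_def)
  moreover have "p \<in> S" using p by (simp add: S_def)
  ultimately have "S = topspace X" using X by (metis connected_space_clopen_in empty_iff)
  then show ?thesis using q by (auto simp: S_def)
qed

locale immersed_surface =
  fixes X :: "'a topology" and A :: "'a chart set" and \<psi> :: "'a \<Rightarrow> real^3"
  assumes surface: "oriented_immersed_surface X A \<psi>"
begin

lemma atlas: "oriented_C2_atlas X A" and connected: "connected_space X"
  using surface by (auto simp: oriented_immersed_surface_def)

lemma charts: "c \<in> A \<Longrightarrow> is_chart X c" using atlas by (auto simp: oriented_C2_atlas_def)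

lemma chart_at: "p \<in> topspace X \<Longrightarrow> \<exists>c\<in>A. p \<in> fst c"
  using atlas by (auto simp: oriented_C2_atlas_def)

text \<open>Changing the chart multiplies the cross product of the coordinate tangents by the
  determinant of the coordinate change, which is positive in an oriented atlas and so disappears
  under \<open>sgn\<close>. This makes the choice in \<open>gauss_map\<close> harmless.\<close>

lemma chart_normal_unique:
  assumes c: "c \<in> A" and d: "d \<in> A" and p: "p \<in> fst c" "p \<in> fst d"
  shows "chart_normal c \<psi> p = chart_normal d \<psi> p"
proof -
  obtain f' f'' where "surface_patch (snd d ` fst d) (in_chart d \<psi>) f' f''"
    using surface_patch_of_chart[OF surface d] by blast
  then interpret surface_patch "snd d ` fst d" "in_chart d \<psi>" f' f'' .
  obtain T where T: "linear T" "0 < det (matrix T)"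
    "\<And>(F :: 'a \<Rightarrow> real^3) D. (in_chart d F has_derivative D) (at (snd d p))
       \<Longrightarrow> (in_chart c F has_derivative (\<lambda>v. D (T v))) (at (snd c p))"
    using chart_change[OF atlas c d p] by metis
  define z where "z = snd d p"
  have z: "z \<in> snd d ` fst d" using p by (simp add: z_def)
  have Dd: "frechet_derivative (in_chart d \<psi>) (at (snd d p)) = f' z"
    using frechet_derivative_at[OF df[OF z]] by (simp add: z_def)
  have Dc: "frechet_derivative (in_chart c \<psi>) (at (snd c p)) = (\<lambda>v. f' z (T v))"
    using frechet_derivative_at[OF T(3)[OF df[OF z, unfolded z_def]]] by (simp add: z_def)
  define t1 t2 where "t1 = T (axis 1 1)" and "t2 = T (axis 2 1)"
  have "det (matrix T) = t1$1 * t2$2 - t1$2 * t2$1"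
    by (simp add: det_2 matrix_def t1_def t2_def mult.commute)
  then have "cross3 (f' z t1) (f' z t2) = det (matrix T) *\<^sub>R nv z"
    unfolding f'_eq[of z t1] f'_eq[of z t2] cross3_linear_combination nv_def by (simp add: mult.commute)
  then have "sgn (cross3 (f' z t1) (f' z t2)) = sgn (nv z)" using T(2) by (simp add: sgn_scaleR)
  then show ?thesis
    by (simp add: chart_normal_def Let_def Dd Dc t1_def t2_def nv_def f1_def f2_def)
qed

lemma gauss_map_eq: "c \<in> A \<Longrightarrow> p \<in> fst c \<Longrightarrow> gauss_map A \<psi> p = chart_normal c \<psi> p"
  unfolding gauss_map_def
  by (rule someI2[of "\<lambda>c. c \<in> A \<and> p \<in> fst c" c]) (auto intro: chart_normal_unique)

end

locale charted_surface = immersed_surface X A \<psi> + surface_patch "snd c ` fst c" "in_chart c \<psi>" f' f''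
  for X :: "'a topology" and A and \<psi> and c :: "'a chart" and f' f'' +
  assumes c_in: "c \<in> A"
begin

lemma gauss_map_N: "p \<in> fst c \<Longrightarrow> gauss_map A \<psi> p = N (snd c p)"
  using frechet_derivative_at[OF df[of "snd c p"]]
  by (simp add: gauss_map_eq[OF c_in] chart_normal_def Let_def N_def nv_def f1_def f2_def)

lemma in_chart_gauss_map: "z \<in> snd c ` fst c \<Longrightarrow> in_chart c (gauss_map A \<psi>) z = N z"
  by (auto simp: in_chart_apply[OF is_chart_inj[OF charts[OF c_in]]] gauss_map_N)

lemma gauss_map_deriv:
  assumes z: "z \<in> snd c ` fst c"
  shows "(in_chart c (gauss_map A \<psi>) has_derivative frechet_derivative N (at z)) (at z)"
  by (rule has_derivative_transform_within_open[OF _ open_U z])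
    (use N_differentiable[OF z] frechet_derivative_works in_chart_gauss_map in auto)

text \<open>The definition admits eigenvectors in any chart around the point. The differential
  \<open>T\<close> of the coordinate change is injective and carries each of them to an eigenvector
  in the fixed chart with the same eigenvalue.\<close>

lemma principal_curvatures_eq:
  assumes p: "p \<in> fst c"
  shows "principal_curvatures A \<psi> p = principal_at (snd c p)"
proof -
  have z: "snd c p \<in> snd c ` fst c" using p by simp
  have G: "frechet_derivative (in_chart c (gauss_map A \<psi>)) (at (snd c p)) = frechet_derivative N (at (snd c p))"
    using frechet_derivative_at[OF gauss_map_deriv[OF z]] by simp
  have P: "frechet_derivative (in_chart c \<psi>) (at (snd c p)) = f' (snd c p)"
    using frechet_derivative_at[OF df[OF z]] by simp
  show ?thesis
  proof (intro set_eqI iffI)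
    fix \<kappa> assume "\<kappa> \<in> principal_at (snd c p)"
    then obtain v where v: "v \<noteq> 0" "- frechet_derivative N (at (snd c p)) v = \<kappa> *\<^sub>R f' (snd c p) v"
      unfolding principal_at_def by blast
    show "\<kappa> \<in> principal_curvatures A \<psi> p"
      unfolding principal_curvatures_def mem_Collect_eq
      by (rule bexI[OF _ c_in], intro conjI p exI[of _ v]) (simp_all only: G P v not_False_eq_True)
  next
    fix \<kappa> assume "\<kappa> \<in> principal_curvatures A \<psi> p"
    then obtain d v where d: "d \<in> A" "p \<in> fst d" and v: "v \<noteq> 0"
      "- frechet_derivative (in_chart d (gauss_map A \<psi>)) (at (snd d p)) v
           = \<kappa> *\<^sub>R frechet_derivative (in_chart d \<psi>) (at (snd d p)) v"
      unfolding principal_curvatures_def by auto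
    obtain T where T: "linear T" "0 < det (matrix T)"
      "\<And>(F :: 'a \<Rightarrow> real^3) D. (in_chart c F has_derivative D) (at (snd c p))
         \<Longrightarrow> (in_chart d F has_derivative (\<lambda>v. D (T v))) (at (snd d p))"
      using chart_change[OF atlas d(1) c_in d(2) p] by metis
    have "inj T" using T(1,2) det_nz_iff_inj by (metis less_irrefl)
    then have "T v \<noteq> 0" using v(1) linear_0[OF T(1)] by (metis injD)
    moreover have "- frechet_derivative N (at (snd c p)) (T v) = \<kappa> *\<^sub>R f' (snd c p) (T v)"
      using v(2) unfolding frechet_derivative_at[OF T(3)[OF gauss_map_deriv[OF z]], symmetric]
        frechet_derivative_at[OF T(3)[OF df[OF z]], symmetric] .
    ultimately show "\<kappa> \<in> principal_at (snd c p)" unfolding principal_at_def by blast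
  qed
qed

end

section \<open>Global argument\<close>

lemma charted_surface_exists:
  assumes "oriented_immersed_surface X A \<psi>" "p \<in> topspace X"
  obtains c f' f'' where "charted_surface X A \<psi> c f' f''" "p \<in> fst c"
proof -
  interpret immersed_surface X A \<psi> by unfold_locales (rule assms(1))
  obtain c where c: "c \<in> A" "p \<in> fst c" using chart_at[OF assms(2)] by blast
  obtain f' f'' where "surface_patch (snd c ` fst c) (in_chart c \<psi>) f' f''"
    using surface_patch_of_chart[OF surface c(1)] by blast
  then have "charted_surface X A \<psi> c f' f''"
    by (intro charted_surface.intro immersed_surface_axioms charted_surface_axioms.intro c(1))
  then show ?thesis using c(2) by (rule that)
qed

context charted_surface
begin

lemma chart_openin: "openin X (fst c)"
  using charts[OF c_in] by (simp add: is_chart_def)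

lemma nbhd_of_open:
  assumes "open V" "p \<in> fst c" "snd c p \<in> V"
  shows "\<exists>W. openin X W \<and> p \<in> W \<and> (\<forall>y\<in>W. y \<in> fst c \<and> snd c y \<in> V)"
  by (rule exI[of _ "{p \<in> fst c. snd c p \<in> V}"])
    (use assms is_chart_preimage[OF charts[OF c_in]] in auto)

lemma locally_constant_of_zero_derivative:
  fixes F :: "'a \<Rightarrow> 'b::real_normed_vector"
  assumes d: "\<And>z. z \<in> snd c ` fst c \<Longrightarrow> (in_chart c F has_derivative (\<lambda>v. 0)) (at z)" and p: "p \<in> fst c"
  shows "\<exists>W. openin X W \<and> p \<in> W \<and> (\<forall>y\<in>W. F y = F p)"
proof -
  note inj = is_chart_inj[OF charts[OF c_in]]
  obtain \<rho> where \<rho>: "\<rho> > 0" "ball (snd c p) \<rho> \<subseteq> snd c ` fst c"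
    using open_U p open_contains_ball by blast
  have "\<exists>k. \<forall>z\<in>ball (snd c p) \<rho>. in_chart c F z = k"
    by (rule has_derivative_zero_constant[OF convex_ball])
      (use d \<rho>(2) has_derivative_at_withinI in blast)
  then obtain k where k: "\<And>z. z \<in> ball (snd c p) \<rho> \<Longrightarrow> in_chart c F z = k" by blast
  have ctr: "snd c p \<in> ball (snd c p) \<rho>" using \<rho>(1) by simp
  obtain W where W: "openin X W" "p \<in> W" "\<And>y. y \<in> W \<Longrightarrow> y \<in> fst c \<and> snd c y \<in> ball (snd c p) \<rho>"
    using nbhd_of_open[OF open_ball p ctr] by blast
  have "F y = F p" if "y \<in> W" for y
    using k[OF ctr] k[of "snd c y"] W(3)[OF that] in_chart_apply[OF inj, of y F] in_chart_apply[OF inj p, of F]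
    by simp
  then show ?thesis using W(1,2) by blast
qed

end

lemma constant_of_zero_derivative:
  fixes F :: "'a \<Rightarrow> 'b::real_normed_vector" and X :: "'a topology"
  assumes S: "oriented_immersed_surface X A \<psi>"
    and d: "\<And>c f' f'' z. charted_surface X A \<psi> c f' f'' \<Longrightarrow> z \<in> snd c ` fst c
      \<Longrightarrow> (in_chart c F has_derivative (\<lambda>v. 0)) (at z)"
    and pq: "p \<in> topspace X" "q \<in> topspace X"
  shows "F q = F p"
proof (rule locally_constant_connected[OF _ _ pq])
  show "connected_space X" using S by (simp add: oriented_immersed_surface_def)
  fix x assume "x \<in> topspace X"
  then obtain c f' f'' where cs: "charted_surface X A \<psi> c f' f''" "x \<in> fst c"
    using charted_surface_exists[OF S] by metis
  interpret charted_surface X A \<psi> c f' f'' by (rule cs(1))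
  show "\<exists>W. openin X W \<and> x \<in> W \<and> (\<forall>y\<in>W. F y = F x)"
    by (rule locally_constant_of_zero_derivative[OF _ cs(2)]) (rule d[OF cs(1)])
qed

locale weingarten_surface = immersed_surface X A \<psi>
  for X :: "'a topology" and A and \<psi> +
  fixes g g' :: "real \<Rightarrow> real" and a :: "real^3"
  assumes g: "\<forall>t\<ge>0. (g has_real_derivative g' t) (at t within {0..})"
    and cont_g': "continuous_on {0..} g'"
    and ell: "\<forall>t\<ge>0. 4 * t * (g' t)\<^sup>2 < 1"
    and wein: "\<And>p. p \<in> topspace X \<Longrightarrow>
       mean_curvature A \<psi> p = g ((mean_curvature A \<psi> p)\<^sup>2 - gauss_curvature A \<psi> p)"
    and norm_a: "norm a = 1"
    and hemisphere: "\<And>p. p \<in> topspace X \<Longrightarrow> 0 \<le> a \<bullet> gauss_map A \<psi> p"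
begin

lemma weingarten_in_chart:
  assumes "charted_surface X A \<psi> c f' f''" and z: "z \<in> snd c ` fst c"
  shows "weingarten_at g (surface_patch.principal_at f' z)"
proof -
  interpret charted_surface X A \<psi> c f' f'' by fact
  obtain p where p: "p \<in> fst c" "z = snd c p" using z by blast
  have "p \<in> topspace X" using p(1) openin_subset[OF chart_openin] by blast
  from wein[OF this] show ?thesis
    by (simp add: weingarten_at_def mean_curvature_def gauss_curvature_def \<kappa>\<^sub>1_def \<kappa>\<^sub>2_def
        principal_curvatures_eq[OF p(1)] p(2))
qed

text \<open>The truth value of a \<bullet> N = 0 is locally constant: near a zero by the maximum
  principle, near any other point by continuity of N.\<close>

lemma angle_zero_everywhere:
  assumes p: "p \<in> topspace X" "a \<bullet> gauss_map A \<psi> p = 0" and q: "q \<in> topspace X"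
  shows "a \<bullet> gauss_map A \<psi> q = 0"
proof -
  have "(a \<bullet> gauss_map A \<psi> q = 0) = (a \<bullet> gauss_map A \<psi> p = 0)"
  proof (rule locally_constant_connected[OF connected _ p(1) q])
    fix x assume x: "x \<in> topspace X"
    obtain c f' f'' where cs: "charted_surface X A \<psi> c f' f''" "x \<in> fst c"
      using charted_surface_exists[OF surface x] by metis
    interpret charted_surface X A \<psi> c f' f'' by (rule cs(1))
    have z: "snd c x \<in> snd c ` fst c" using cs(2) by simp
    have nonneg: "0 \<le> a \<bullet> N z" if "z \<in> snd c ` fst c" for z
      using that hemisphere openin_subset[OF chart_openin] gauss_map_N by fastforce
    have "\<exists>V. open V \<and> snd c x \<in> V \<and> V \<subseteq> snd c ` fst c
        \<and> (\<forall>z\<in>V. (a \<bullet> N z = 0) = (a \<bullet> N (snd c x) = 0))"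
    proof (cases "a \<bullet> N (snd c x) = 0")
      case True
      obtain V where V: "open V" "snd c x \<in> V" "V \<subseteq> snd c ` fst c" "\<And>z. z \<in> V \<Longrightarrow> a \<bullet> N z = 0"
        by (rule angle_zero_open[OF g cont_g' ell weingarten_in_chart[OF cs(1)] norm_a nonneg z True]) (assumption | rule that)+
      have "(a \<bullet> N z = 0) = (a \<bullet> N (snd c x) = 0)" if "z \<in> V" for z
        using V(4)[OF that] True by (simp only:)
      with V(1-3) show ?thesis by (intro exI[of _ V] conjI ballI)
    next
      case False
      define V where "V = snd c ` fst c \<inter> (\<lambda>z. a \<bullet> N z) -` (- {0})"
      have "continuous_on (snd c ` fst c) N"
        by (intro continuous_at_imp_continuous_on ballI differentiable_imp_continuous_within N_differentiable)
      then have "continuous_on (snd c ` fst c) (\<lambda>z. a \<bullet> N z)" by (intro continuous_intros)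
      then have "open V" unfolding V_def by (rule continuous_open_preimage[OF _ open_U]) auto
      moreover have "snd c x \<in> V" "V \<subseteq> snd c ` fst c" using z False by (auto simp: V_def)
      moreover have "\<forall>z\<in>V. (a \<bullet> N z = 0) = (a \<bullet> N (snd c x) = 0)" using False by (simp add: V_def)
      ultimately show ?thesis by (intro exI[of _ V] conjI)
    qed
    then obtain V where V: "open V" "snd c x \<in> V" "V \<subseteq> snd c ` fst c"
      "\<forall>z\<in>V. (a \<bullet> N z = 0) = (a \<bullet> N (snd c x) = 0)" by (elim exE conjE)
    obtain W where W: "openin X W" "x \<in> W" "\<And>y. y \<in> W \<Longrightarrow> y \<in> fst c \<and> snd c y \<in> V"
      using nbhd_of_open[OF V(1) cs(2) V(2)] by blast
    have "(a \<bullet> gauss_map A \<psi> y = 0) = (a \<bullet> gauss_map A \<psi> x = 0)" if "y \<in> W" for y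
      using bspec[OF V(4)] W(3)[OF that] by (simp only: gauss_map_N cs(2))
    with W(1,2) show "\<exists>W. openin X W \<and> x \<in> W \<and>
        (\<forall>y\<in>W. (a \<bullet> gauss_map A \<psi> y = 0) = (a \<bullet> gauss_map A \<psi> x = 0))"
      by (intro exI[of _ W] conjI ballI)
  qed
  then show ?thesis using p(2) by simp
qed

lemma plane_or_cylinder:
  assumes zero: "\<And>p. p \<in> topspace X \<Longrightarrow> a \<bullet> gauss_map A \<psi> p = 0" and p0: "p0 \<in> topspace X"
  shows "(\<exists>P. is_plane P \<and> piece_of X \<psi> P) \<or> (\<exists>Z. is_cylinder Z \<and> piece_of X \<psi> Z)"
proof -
  have shape: "\<exists>C. C = g (C\<^sup>2) \<and> (\<forall>v. frechet_derivative (surface_patch.N f') (at z) v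
       = - (2 * C) *\<^sub>R (f' z v - (f' z v \<bullet> a) *\<^sub>R a))"
    if cs: "charted_surface X A \<psi> c f' f''" and z: "z \<in> snd c ` fst c" for c f' f'' z
  proof -
    interpret charted_surface X A \<psi> c f' f'' by (rule cs)
    have aN: "a \<bullet> N z = 0" if "z \<in> snd c ` fst c" for z
      using that zero openin_subset[OF chart_openin] gauss_map_N by fastforce
    obtain C where "C = g (C\<^sup>2)"
        "\<And>v. frechet_derivative N (at z) v = - (2 * C) *\<^sub>R (f' z v - (f' z v \<bullet> a) *\<^sub>R a)"
      by (rule shape_operator_of_zero_angle[OF g ell weingarten_in_chart[OF cs] norm_a aN z]) (assumption | rule that)+
    then show ?thesis by (intro exI[of _ C] conjI allI)
  qed
  \<comment> \<open>The constant found by \<open>shape\<close> may a priori vary with the chart and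
    the point. Every such constant solves C = g (C^2), which has at most one solution, so one C
    serves the whole surface.\<close>
  obtain C where C: "\<And>c f' f'' z v. charted_surface X A \<psi> c f' f'' \<Longrightarrow> z \<in> snd c ` fst c \<Longrightarrow>
      frechet_derivative (surface_patch.N f') (at z) v = - (2 * C) *\<^sub>R (f' z v - (f' z v \<bullet> a) *\<^sub>R a)"
  proof -
    obtain c f' f'' where cs: "charted_surface X A \<psi> c f' f''" "p0 \<in> fst c"
      using charted_surface_exists[OF surface p0] by metis
    then have "snd c p0 \<in> snd c ` fst c" by simp
    from shape[OF cs(1) this] obtain C where C: "C = g (C\<^sup>2)" by blast
    show thesis
    proof (rule that[of C])
      fix c f' f'' z v assume "charted_surface X A \<psi> c f' f''" "z \<in> snd c ` fst c"
      from shape[OF this] obtain C' where C': "C' = g (C'\<^sup>2)"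
        "frechet_derivative (surface_patch.N f') (at z) v = - (2 * C') *\<^sub>R (f' z v - (f' z v \<bullet> a) *\<^sub>R a)" by blast
      moreover have "C' = C" by (rule elliptic_square_inj[OF g ell C'(1) C])
      ultimately show "frechet_derivative (surface_patch.N f') (at z) v = - (2 * C) *\<^sub>R (f' z v - (f' z v \<bullet> a) *\<^sub>R a)"
        by simp
    qed
  qed
  have aa: "a \<bullet> a = 1" using norm_a by (simp add: norm_eq_1)
  have norm_N1: "norm (gauss_map A \<psi> p) = 1" if p: "p \<in> topspace X" for p
  proof -
    obtain c f' f'' where cs: "charted_surface X A \<psi> c f' f''" "p \<in> fst c"
      using charted_surface_exists[OF surface p] by metis
    interpret charted_surface X A \<psi> c f' f'' by (rule cs(1))
    show ?thesis using gauss_map_N[OF cs(2)] norm_N cs(2) by simp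
  qed
  define G where "G p = gauss_map A \<psi> p + (2 * C) *\<^sub>R (\<psi> p - (\<psi> p \<bullet> a) *\<^sub>R a)" for p
  have Gconst: "G p = G p0" if p: "p \<in> topspace X" for p
  proof (rule constant_of_zero_derivative[OF surface _ p0 p])
    fix c f' f'' z assume cs: "charted_surface X A \<psi> c f' f''" and z: "z \<in> snd c ` fst c"
    interpret charted_surface X A \<psi> c f' f'' by (rule cs)
    have "((\<lambda>z. in_chart c (gauss_map A \<psi>) z + (2 * C) *\<^sub>R (in_chart c \<psi> z - (in_chart c \<psi> z \<bullet> a) *\<^sub>R a))
      has_derivative (\<lambda>v. frechet_derivative N (at z) v + (2 * C) *\<^sub>R (f' z v - (f' z v \<bullet> a) *\<^sub>R a))) (at z)"
      by (intro derivative_intros gauss_map_deriv[OF z] df[OF z])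
    then show "(in_chart c G has_derivative (\<lambda>v. 0)) (at z)"
      using C[OF cs z] by (simp add: in_chart_def G_def[abs_def] o_def)
  qed
  show ?thesis
  proof (cases "C = 0")
    case True
    define n where "n = gauss_map A \<psi> p0"
    have n: "gauss_map A \<psi> p = n" if "p \<in> topspace X" for p
      using Gconst[OF that] True by (simp add: G_def n_def)
    \<comment> \<open>With C = 0 the normal is the constant n, and tangent vectors are orthogonal to
      it, so the height along n has zero derivative.\<close>
    have "n \<bullet> \<psi> p = n \<bullet> \<psi> p0" if p: "p \<in> topspace X" for p
    proof (rule constant_of_zero_derivative[OF surface _ p0 p])
      fix c f' f'' z assume cs: "charted_surface X A \<psi> c f' f''" and z: "z \<in> snd c ` fst c"
      interpret charted_surface X A \<psi> c f' f'' by (rule cs)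
      have "N z = n" using z n openin_subset[OF chart_openin] gauss_map_N by fastforce
      then have "n \<bullet> f' z v = 0" for v
        using nv_orth[of z v] by (auto simp: N_def sgn_div_norm inner_commute)
      then show "(in_chart c (\<lambda>p. n \<bullet> \<psi> p) has_derivative (\<lambda>v. 0)) (at z)"
        using has_derivative_inner_right[OF df[OF z], of n] by (simp add: in_chart_def o_def)
    qed
    moreover have "n \<noteq> 0" using norm_N1[OF p0] by (auto simp: n_def)
    ultimately have "is_plane {x. n \<bullet> x = n \<bullet> \<psi> p0} \<and> piece_of X \<psi> {x. n \<bullet> x = n \<bullet> \<psi> p0}"
      unfolding is_plane_def piece_of_def by blast
    then show ?thesis by blast
  next
    case False
    \<comment> \<open>Dividing the constant by 2 C shows that the projection of \<psi> p along a
      differs from q by -N / (2 C), a vector of length r. As q is orthogonal to a, this vector is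
      also the component of \<psi> p - q perpendicular to the line, so its length is the distance to
      the axis.\<close>
    define q where "q = (1 / (2 * C)) *\<^sub>R G p0"
    define r where "r = 1 / (2 * \<bar>C\<bar>)"
    have r: "0 < r" using False by (simp add: r_def)
    have "a \<bullet> G p0 = 0" using zero[OF p0] by (simp add: G_def inner_add_right inner_diff_right aa inner_commute)
    then have qa: "q \<bullet> a = 0" by (simp add: q_def inner_commute)
    have "infdist (\<psi> p) {q + t *\<^sub>R a |t. True} = r" if p: "p \<in> topspace X" for p
    proof -
      have "(1 / (2 * C)) *\<^sub>R G p = q" using Gconst[OF p] by (simp add: q_def)
      then have "\<psi> p - (\<psi> p \<bullet> a) *\<^sub>R a - q = - (1 / (2 * C)) *\<^sub>R gauss_map A \<psi> p"
        using False by (auto simp: G_def scaleR_add_right)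
      then have "(\<psi> p - q) - ((\<psi> p - q) \<bullet> a) *\<^sub>R a = - (1 / (2 * C)) *\<^sub>R gauss_map A \<psi> p"
        by (simp add: inner_diff_left qa algebra_simps)
      then have "norm ((\<psi> p - q) - ((\<psi> p - q) \<bullet> a) *\<^sub>R a) = r"
        using norm_N1[OF p] by (simp add: r_def abs_mult)
      then show ?thesis using infdist_line[OF norm_a, of "\<psi> p" q] by simp
    qed
    then have "piece_of X \<psi> {x. infdist x {q + t *\<^sub>R a |t. True} = r}" by (auto simp: piece_of_def)
    moreover have "is_cylinder {x. infdist x {q + t *\<^sub>R a |t. True} = r}"
      unfolding is_cylinder_def using norm_a r by blast
    ultimately show ?thesis by blast
  qed
qed

end

text \<open>The interior is taken relative to the sphere, where the trace of an open half space is
  open.\<close>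

lemma open_hemisphere_interior:
  "open_hemisphere a \<subseteq> top_of_set (sphere 0 1) interior_of closed_hemisphere a"
proof (rule interior_of_maximal)
  show "open_hemisphere a \<subseteq> closed_hemisphere a"
    by (auto simp: open_hemisphere_def closed_hemisphere_def)
  have "open {x. 0 < a \<bullet> x}" by (rule open_halfspace_gt)
  moreover have "open_hemisphere a = sphere 0 1 \<inter> {x. 0 < a \<bullet> x}"
    by (auto simp: open_hemisphere_def)
  ultimately show "openin (top_of_set (sphere 0 1)) (open_hemisphere a)"
    by (simp add: openin_open_Int)
qed

theorem lemmaA:
  fixes X :: "'a topology" and A :: "'a chart set" and \<psi> :: "'a \<Rightarrow> real^3" and a :: "real^3"
  assumes "elliptic_weingarten_surface X A \<psi>"
    and "norm a = 1"
    and "gauss_map A \<psi> ` topspace X \<subseteq> closed_hemisphere a"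
  shows "(gauss_map A \<psi> ` topspace X \<subseteq> top_of_set (sphere 0 1) interior_of closed_hemisphere a
            \<and> multigraph X A \<psi>)
         \<or> (\<exists>P. is_plane P \<and> piece_of X \<psi> P)
         \<or> (\<exists>Z. is_cylinder Z \<and> piece_of X \<psi> Z)"
proof -
  have surf: "oriented_immersed_surface X A \<psi>"
    using assms(1) by (simp add: elliptic_weingarten_surface_def)
  obtain g where ell: "elliptic_function g" and w: "\<And>p. p \<in> topspace X \<Longrightarrow>
       mean_curvature A \<psi> p = g ((mean_curvature A \<psi> p)\<^sup>2 - gauss_curvature A \<psi> p)"
    using assms(1) unfolding elliptic_weingarten_surface_def by blast
  obtain g' g'' where g: "\<forall>t\<ge>0. (g has_real_derivative g' t) (at t within {0..})"
    "\<forall>t\<ge>0. (g' has_real_derivative g'' t) (at t within {0..})" "\<forall>t\<ge>0. 4 * t * (g' t)\<^sup>2 < 1"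
    using ell unfolding elliptic_function_def by blast
  have "continuous_on {0..} g'"
    by (rule DERIV_continuous_on) (use g(2) in auto)
  then interpret weingarten_surface X A \<psi> g g' a
    using surf w g assms(2,3) by unfold_locales (auto simp: closed_hemisphere_def)
  show ?thesis
  \<comment> \<open>One zero of the angle function spreads over the connected surface and leads to a
    plane or cylinder; without zeros the Gauss image avoids the boundary circle of the
    hemisphere.\<close>
  proof (cases "\<exists>p\<in>topspace X. a \<bullet> gauss_map A \<psi> p = 0")
    case True
    then obtain p where p: "p \<in> topspace X" "a \<bullet> gauss_map A \<psi> p = 0" by blast
    from plane_or_cylinder[OF angle_zero_everywhere[OF p] p(1)] show ?thesis by (rule disjI2)
  next
    case False
    have sub: "gauss_map A \<psi> ` topspace X \<subseteq> open_hemisphere a"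
    proof
      fix y assume y: "y \<in> gauss_map A \<psi> ` topspace X"
      then have "a \<bullet> y \<noteq> 0" "y \<in> closed_hemisphere a" using False assms(3) by auto
      then show "y \<in> open_hemisphere a" by (auto simp: closed_hemisphere_def open_hemisphere_def)
    qed
    then have "multigraph X A \<psi>" unfolding multigraph_def using assms(2) by blast
    with sub open_hemisphere_interior[of a] show ?thesis by blast
  qed
qed

end
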